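(* (Slow regime, large arrival rates possible.) Let $\alpha\in(0,1)$. Let $y:=\inf\{x>0:\mathbb{P}(\Lambda\le x)=1\}$ (with $y=\infty$ if the set is empty), $u(t):=\frac{y}{\mu}(1-e^{-\mu t})$ and $\rho(t):=\frac{\mathbb{E}\Lambda}{\mu}(1-e^{-\mu t})$. Let $a>\rho(t)$ with $u(t)\ge a$. With $M(\theta):=\mathbb{E}\,e^{\theta\Lambda}$ and $M^{(N)}(t)$ the queue length at time $t$ in the $N$-scaled system defined in the context, $$\lim_{N\to\infty}\Delta N^{-\alpha}\log\mathbb{P}\Big(\frac{M^{(N)}(t)}{N}\ge a\Big)=-\sup_{\theta>0}\Big(\theta a-\int_0^t\log M(\theta e^{-\mu s})\,\mathrm{d}s\Big).$$
   Context: Let $\Delta>0$, $\mu>0$, $t>0$. $\Lambda$ is a non-negative random variable with a density and finite first two moments; $\Lambda_0,\Lambda_1,\dots$ are i.i.d. copies of $\Lambda$. Define $$\Lambda^{(N)}(s):=\sum_{j=0}^\infty \Lambda_j\,1_{[j\Delta N^{-\alpha},(j+1)\Delta N^{-\alpha})}(s),\qquad \kappa_t(\Lambda^{(N)}):=\int_0^t\Lambda^{(N)}(s)\,e^{-\mu s}\,\mathrm{d}s .$$ $M^{(N)}(t)$ is the number of jobs at time $t$ in an initially empty infinite-server queue with i.i.d. exponential service times of mean $1/\mu$ (independent of the arrivals) and random arrival rate $N\Lambda^{(N)}(\cdot)$; it is a mixed Poisson random variable with random parameter distributed as $N\kappa_t(\Lambda^{(N)})$.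
   Formalization: The supremum over θ>0 is replaced by its maximum with 0; this changes nothing if M(θ) is finite for some θ>0, but if M(θ)=∞ for all θ>0 the displayed formula would give the impossible limit +∞, and the limit is then 0. *)

theory Defs
  imports "HOL-Probability.Probability"
begin

definition elog :: "ennreal \<Rightarrow> ereal" where
  "elog x = (if x = 0 then -\<infinity> else if x = top then \<infinity> else ereal (ln (enn2real x)))"

(* Moment generating function; it may take the value infinity. *)
definition mgf :: "'a measure \<Rightarrow> ('a \<Rightarrow> real) \<Rightarrow> real \<Rightarrow> ennreal" where
  "mgf P X \<theta> = (\<integral>\<^sup>+ \<omega>. ennreal (exp (\<theta> * X \<omega>)) \<partial>P)"

(* y = inf {x > 0. P(X <= x) = 1}, which is infinity if there is no such x. *)
definition upper_endpoint :: "'a measure \<Rightarrow> ('a \<Rightarrow> real) \<Rightarrow> ereal" where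
  "upper_endpoint P X = Inf {ereal x | x. x > 0 \<and> measure P {\<omega> \<in> space P. X \<omega> \<le> x} = 1}"

definition slot_length :: "real \<Rightarrow> real \<Rightarrow> nat \<Rightarrow> real" where
  "slot_length \<Delta> \<alpha> N = \<Delta> * real N powr (- \<alpha>)"

(* Lambda^(N)(s); at most one summand is non-zero. *)
definition env_rate ::
    "real \<Rightarrow> real \<Rightarrow> (nat \<Rightarrow> 'a \<Rightarrow> real) \<Rightarrow> nat \<Rightarrow> real \<Rightarrow> 'a \<Rightarrow> real" where
  "env_rate \<Delta> \<alpha> L N s \<omega> =
     (\<Sum>j. L j \<omega> * indicator {real j * slot_length \<Delta> \<alpha> N ..< (real j + 1) * slot_length \<Delta> \<alpha> N} s)"

definition kappa :: "real \<Rightarrow> real \<Rightarrow> (real \<Rightarrow> 'a \<Rightarrow> real) \<Rightarrow> 'a \<Rightarrow> real" where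
  "kappa \<mu> t r \<omega> = (LINT s:{0..t}|lborel. r s \<omega> * exp (- \<mu> * s))"

(* In contrast to poisson_pmf, the parameter 0 is meaningful here. *)
definition poisson_mass :: "real \<Rightarrow> nat \<Rightarrow> real" where
  "poisson_mass r k = r ^ k / fact k * exp (- r)"

(* X is mixed Poisson with a random parameter whose law is D.
   The queue below, with arrival rate r, is mixed Poisson with parameter
   int_0^t r(s) exp(-\<mu>(t-s)) ds. For r = N * env_rate this has the law of N * kappa only up to
   time reversal of the slots: exactly if t is a multiple of the slot length, otherwise up to one
   incomplete slot. *)
definition mixed_poisson :: "'a measure \<Rightarrow> ('a \<Rightarrow> nat) \<Rightarrow> real measure \<Rightarrow> bool" where
  "mixed_poisson P X D \<longleftrightarrow>
     X \<in> measurable P (count_space UNIV) \<and>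
     (\<forall>k. measure P {\<omega> \<in> space P. X \<omega> = k} = (LINT r|D. poisson_mass r k))"

(* The sigma-algebra generated by a sequence of random variables. *)
definition seq_algebra :: "'a measure \<Rightarrow> (nat \<Rightarrow> 'a \<Rightarrow> real) \<Rightarrow> 'a measure" where
  "seq_algebra P L =
     vimage_algebra (space P) (\<lambda>\<omega> j. L j \<omega>) (\<Pi>\<^sub>M j\<in>UNIV. (borel :: real measure))"

(* The epochs T 0 < T 1 < ... form a Cox process on the positive half-line: conditionally on F,
   a Poisson process with rate function s \<mapsto> r s \<omega>. *)
definition cox_process ::
    "'a measure \<Rightarrow> 'a measure \<Rightarrow> (real \<Rightarrow> 'a \<Rightarrow> real) \<Rightarrow> (nat \<Rightarrow> 'a \<Rightarrow> real) \<Rightarrow> bool" where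
  "cox_process P F r T \<longleftrightarrow>
     (\<forall>k. T k \<in> borel_measurable P) \<and>
     (AE \<omega> in P. 0 < T 0 \<omega> \<and> strict_mono (\<lambda>k. T k \<omega>) \<and>
        filterlim (\<lambda>k. T k \<omega>) at_top sequentially) \<and>
     (\<forall>(m :: nat) (c :: nat \<Rightarrow> real) (n :: nat \<Rightarrow> nat). 0 \<le> c 0 \<and> mono c \<longrightarrow>
        (AE \<omega> in P.
           real_cond_exp P F
             (indicator {\<omega>' \<in> space P. \<forall>i<m. card {k. T k \<omega>' \<in> {c i<..c (Suc i)}} = n i}) \<omega>
           = (\<Prod>i<m. poisson_mass (LINT s:{c i..c (Suc i)}|lborel. r s \<omega>) (n i))))"

(* X is the number of jobs at time t in an infinite-server queue that is empty at time 0, has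
   Cox arrivals, and has i.i.d. exp(\<mu>) service times S k independent of the arrivals: job k is
   present during [T k, T k + S k). *)
definition infinite_server_queue ::
    "'a measure \<Rightarrow> 'a measure \<Rightarrow> (real \<Rightarrow> 'a \<Rightarrow> real) \<Rightarrow> real \<Rightarrow> real \<Rightarrow> ('a \<Rightarrow> nat) \<Rightarrow> bool" where
  "infinite_server_queue P F r \<mu> t X \<longleftrightarrow>
     (\<exists>T S. cox_process P F r T \<and>
        prob_space.indep_vars P (\<lambda>_. borel) S UNIV \<and>
        (\<forall>k. distributed P lborel (S k) (exponential_density \<mu>)) \<and>
        prob_space.indep_var P
          (\<Pi>\<^sub>M k\<in>UNIV. borel) (\<lambda>\<omega> k. T k \<omega>) (\<Pi>\<^sub>M k\<in>UNIV. borel) (\<lambda>\<omega> k. S k \<omega>) \<and>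
        (\<forall>\<omega>\<in>space P. X \<omega> = card {k. T k \<omega> \<le> t \<and> t < T k \<omega> + S k \<omega>}))"

(* For X >= 0 and \<theta> > 0 one has mgf P X \<theta> >= 1, so e2ennreal does not cut anything off. *)
definition ld_exponent ::
    "'a measure \<Rightarrow> ('a \<Rightarrow> real) \<Rightarrow> real \<Rightarrow> real \<Rightarrow> real \<Rightarrow> real \<Rightarrow> ereal" where
  "ld_exponent P X \<mu> t a \<theta> =
     ereal (\<theta> * a)
     - enn2ereal (\<integral>\<^sup>+ s. e2ennreal (elog (mgf P X (\<theta> * exp (- \<mu> * s)))) * indicator {0..t} s \<partial>lborel)"

(* The supremum over \<theta> > 0 is already nonnegative as soon as mgf is finite at some positive
   point; so a maximum of it with 0 matters only for heavy-tailed X. *)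
lemma ld_exponent_Sup_nonneg:
  assumes P: "prob_space P" and X: "X \<in> borel_measurable P" and X0: "AE \<omega> in P. 0 \<le> X \<omega>"
    and mu: "0 < \<mu>" and t: "0 < t" and a: "0 \<le> a"
    and b: "0 < b" and fin: "mgf P X b < \<infinity>"
  shows "0 \<le> (SUP \<theta>\<in>{0<..}. ld_exponent P X \<mu> t a \<theta>)"
proof -
  interpret prob_space P by fact
  define m where "m = enn2real (mgf P X b)"
  have m: "mgf P X b = ennreal m" and m0: "0 \<le> m"
    using fin by (auto simp: m_def)
  have bound: "ereal (- (e * m * t)) \<le> (SUP \<theta>\<in>{0<..}. ld_exponent P X \<mu> t a \<theta>)"
    if e: "0 < e" "e \<le> 1" for e
  proof -
    have le: "e2ennreal (elog (mgf P X (e * b * exp (- \<mu> * s)))) \<le> ennreal (e * m)"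
      if s: "0 \<le> s" for s
    proof -
      have "mgf P X (e * b * exp (- \<mu> * s))
          \<le> (\<integral>\<^sup>+ \<omega>. ennreal (1 + e * exp (b * X \<omega>)) \<partial>P)"
        unfolding mgf_def
      proof (intro nn_integral_mono_AE, use X0 in eventually_elim)
        fix \<omega> assume x: "0 \<le> X \<omega>"
        have "exp (- \<mu> * s) \<le> 1" using mu s by simp
        then have "e * b * exp (- \<mu> * s) * X \<omega> \<le> e * b * 1 * X \<omega>"
          using x e b by (intro mult_right_mono mult_left_mono) auto
        then have "exp (e * b * exp (- \<mu> * s) * X \<omega>) \<le> exp (e * (b * X \<omega>))"
          by (simp add: mult.assoc)
        also have "\<dots> \<le> (1 - e) * exp 0 + e * exp (b * X \<omega>)"
          using convex_onD[OF exp_convex, of e 0 "b * X \<omega>"] e by simp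
        also have "\<dots> \<le> 1 + e * exp (b * X \<omega>)" using e by simp
        finally show "ennreal (exp (e * b * exp (- \<mu> * s) * X \<omega>)) \<le> ennreal (1 + e * exp (b * X \<omega>))"
          by (rule ennreal_leI)
      qed
      also have "\<dots> = (\<integral>\<^sup>+ \<omega>. 1 + ennreal e * ennreal (exp (b * X \<omega>)) \<partial>P)"
        using e by (intro nn_integral_cong) (simp add: ennreal_plus ennreal_mult)
      also have "\<dots> = 1 + ennreal e * mgf P X b"
        unfolding mgf_def using X
        by (subst nn_integral_add) (auto simp: nn_integral_cmult emeasure_space_1)
      also have "\<dots> = ennreal (1 + e * m)"
        using m m0 e by (simp add: ennreal_plus ennreal_mult)
      finally have *: "mgf P X (e * b * exp (- \<mu> * s)) \<le> ennreal (1 + e * m)" .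
      show ?thesis
      proof (cases "mgf P X (e * b * exp (- \<mu> * s)) = 0")
        case True
        then show ?thesis by (simp add: elog_def e2ennreal_neg)
      next
        case False
        define x where "x = enn2real (mgf P X (e * b * exp (- \<mu> * s)))"
        have nt: "mgf P X (e * b * exp (- \<mu> * s)) \<noteq> top"
          using * by (metis ennreal_less_top leD top.not_eq_extremum)
        have x0: "0 < x" using False nt
          by (simp add: x_def enn2real_positive_iff zero_less_iff_neq_zero top.not_eq_extremum)
        have "x \<le> 1 + e * m"
          unfolding x_def using * e m0 by (intro enn2real_leI) auto
        then have "ln x \<le> e * m"
          using x0 ln_le_minus_one[of x] by linarith
        then show ?thesis using False nt
          by (simp add: elog_def x_def ennreal_leI)
      qed
    qed
    have "(\<integral>\<^sup>+ s. e2ennreal (elog (mgf P X (e * b * exp (- \<mu> * s)))) * indicator {0..t} s \<partial>lborel)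
        \<le> (\<integral>\<^sup>+ s. ennreal (e * m) * indicator {0..t} s \<partial>lborel)"
      using le by (intro nn_integral_mono) (auto simp: indicator_def)
    also have "\<dots> = ennreal (e * m * t)"
      using e m0 t by (simp add: nn_integral_cmult_indicator ennreal_mult)
    finally have "enn2ereal (\<integral>\<^sup>+ s. e2ennreal (elog (mgf P X (e * b * exp (- \<mu> * s)))) * indicator {0..t} s \<partial>lborel)
        \<le> ereal (e * m * t)"
      using e m0 t by (metis enn2ereal_ennreal less_eq_ennreal.rep_eq mult_nonneg_nonneg less_imp_le)
    then have "ereal (e * b * a) - ereal (e * m * t) \<le> ld_exponent P X \<mu> t a (e * b)"
      unfolding ld_exponent_def by (intro ereal_minus_mono) auto
    moreover have "ereal (- (e * m * t)) \<le> ereal (e * b * a) - ereal (e * m * t)"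
      using e b a by simp
    moreover have "ld_exponent P X \<mu> t a (e * b) \<le> (SUP \<theta>\<in>{0<..}. ld_exponent P X \<mu> t a \<theta>)"
      using e b by (intro SUP_upper) auto
    ultimately show ?thesis by (meson order_trans)
  qed
  have "((\<lambda>e. ereal (- (e * m * t))) \<longlongrightarrow> ereal (- (0 * m * t))) (at_right 0)"
    by (intro tendsto_intros)
  moreover have "\<forall>\<^sub>F e in at_right 0. ereal (- (e * m * t)) \<le> (SUP \<theta>\<in>{0<..}. ld_exponent P X \<mu> t a \<theta>)"
    by (rule eventually_mono[OF eventually_at_right_real[of 0 1]]) (auto intro: bound)
  ultimately have "ereal (- (0 * m * t)) \<le> (SUP \<theta>\<in>{0<..}. ld_exponent P X \<mu> t a \<theta>)"
    by (intro tendsto_upperbound) auto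
  then show ?thesis by (simp add: zero_ereal_def)
qed

end

theory Submission
  imports Defs
begin

text \<open>
  Given the environment, the number of jobs is Poisson with mean \<open>N W\<close>, where
  \<open>W = (\<Sum>j. w j * L j)\<close> and \<open>w j\<close> is the integral of the discount over the \<open>j\<close>-th slot, of length
  \<open>\<delta> = \<Delta> N powr (- \<alpha>)\<close>. The proof separates the two sources of randomness.

  Poisson noise is negligible. A Poisson variable of mean \<open>N b\<close> stays below \<open>N a\<close>, \<open>a < b\<close>, with
  probability exponentially small in \<open>N\<close>, while the environment produces probabilities of order
  \<open>exp (- c / \<delta>)\<close>, and \<open>N \<delta>\<close> tends to infinity because \<open>\<alpha> < 1\<close>. So on the logarithmic scale \<open>1 / \<delta>\<close>
  the event is \<open>W \<ge> a\<close> (\<open>mixed_poisson_tail_le\<close> and \<open>mixed_poisson_tail_ge\<close>).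

  The environment is a sum of about \<open>t / \<delta>\<close> independent terms, with \<open>w j\<close> close to \<open>\<delta>\<close> times the
  discount, hence \<open>\<delta> * log E exp (\<theta> W / \<delta>)\<close> is a Riemann sum for the integral of
  \<open>log M (\<theta> exp (- \<mu> s))\<close> (\<open>cgf_weighted_slots_le\<close> and \<open>cgf_weighted_slots_ge\<close>). The upper bound is then
  Chernoff's. It holds whenever the integral is finite, even if \<open>M \<theta>\<close> itself is infinite.

  The lower bound is first proved for \<open>min \<Lambda> K\<close>, by exponential tilting: if the limiting cumulant
  function \<open>\<Gamma>\<close> has derivative \<open>b\<close> at \<open>\<theta>\<close>, then \<open>W\<close> is near \<open>b\<close> under the tilted law, at the price
  \<open>\<theta> b - \<Gamma> \<theta>\<close> (\<open>exponential_tilting_lower_bound\<close>). Such a \<open>\<theta>\<close> exists for each \<open>b\<close> above the mean and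
  below the largest value that \<open>W\<close> can take: it maximises \<open>\<theta> b - \<Gamma> \<theta>\<close> (\<open>exponent_maximiser\<close>). When \<open>K\<close> grows, the truncated
  exponents decrease to the exponent of \<open>\<Lambda>\<close>, and a compactness argument as in Dini's theorem shows
  that their suprema do not stay above the claimed rate (\<open>truncated_exponent_witness\<close>). If \<open>\<Lambda>\<close> has no
  exponential moment, the same argument gives the rate 0. If the mass of \<open>\<Lambda>\<close> stops at
  the level that \<open>W\<close> would need, the rate is infinite because \<open>\<Lambda>\<close> has no atoms
  (\<open>ld_exponent_unbounded\<close>).

  It remains to see that the queue is mixed Poisson (\<open>infinite_server_queue_mixed_poisson\<close>). Its
  discount is \<open>exp (- \<mu> (t - s))\<close> instead of \<open>exp (- \<mu> s)\<close>; both have the same cumulant integral, by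
  reflection.
\<close>

section \<open>Mixed Poisson random variables\<close>

lemma poisson_mass_nonneg: "0 \<le> r \<Longrightarrow> 0 \<le> poisson_mass r k"
  by (simp add: poisson_mass_def)

lemma poisson_mass_measurable [measurable]: "(\<lambda>r. poisson_mass r k) \<in> borel_measurable borel"
  unfolding poisson_mass_def by measurable

lemma poisson_mass_generating_function:
  assumes r: "0 \<le> r" and z: "0 \<le> z"
  shows "(\<Sum>k. ennreal (z ^ k) * ennreal (poisson_mass r k)) = ennreal (exp ((z - 1) * r))"
proof -
  have "(\<lambda>k. (z * r) ^ k /\<^sub>R fact k * exp (- r)) sums (exp (z * r) * exp (- r))"
    by (intro sums_mult2 exp_converges)
  also have "exp (z * r) * exp (- r) = exp ((z - 1) * r)"
    by (simp add: algebra_simps flip: exp_add)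
  also have "(\<lambda>k. (z * r) ^ k /\<^sub>R fact k * exp (- r)) = (\<lambda>k. z ^ k * poisson_mass r k)"
    by (simp add: fun_eq_iff poisson_mass_def power_mult_distrib field_simps)
  finally have "(\<lambda>k. z ^ k * poisson_mass r k) sums exp ((z - 1) * r)" .
  then have "(\<Sum>k. ennreal (z ^ k * poisson_mass r k)) = ennreal (exp ((z - 1) * r))"
    by (intro suminf_ennreal_eq) (auto simp: z r poisson_mass_nonneg)
  then show ?thesis
    by (simp add: ennreal_mult' z)
qed

lemma poisson_mass_le_1: "0 \<le> r \<Longrightarrow> poisson_mass r k \<le> 1"
proof -
  assume r: "0 \<le> r"
  have "ennreal (poisson_mass r k) \<le> (\<Sum>k. ennreal (1 ^ k) * ennreal (poisson_mass r k))"
    using ennreal_suminf_lessD[of "\<lambda>k. ennreal (1 ^ k) * ennreal (poisson_mass r k)" _ k]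
    by (metis (no_types, lifting) linorder_not_le mult_1 power_one ennreal_1 order_less_irrefl)
  also have "\<dots> = 1" using poisson_mass_generating_function[OF r, of 1] by simp
  finally show ?thesis by simp
qed

lemma nn_integral_nat_valued:
  assumes X [measurable]: "X \<in> measurable P (count_space (UNIV :: nat set))"
  shows "(\<integral>\<^sup>+ \<omega>. c (X \<omega>) \<partial>P) = (\<Sum>k. c k * emeasure P {\<omega>\<in>space P. X \<omega> = k})"
proof -
  have "(\<integral>\<^sup>+ \<omega>. c (X \<omega>) \<partial>P) = (\<integral>\<^sup>+ \<omega>. (\<Sum>k. c k * indicator {\<omega>\<in>space P. X \<omega> = k} \<omega>) \<partial>P)"
  proof (intro nn_integral_cong)
    fix \<omega> assume w: "\<omega> \<in> space P"
    have "(\<Sum>k. c k * indicator {\<omega>\<in>space P. X \<omega> = k} \<omega>)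
        = (\<Sum>k\<in>{X \<omega>}. c k * indicator {\<omega>\<in>space P. X \<omega> = k} \<omega>)"
      by (intro suminf_finite) (auto simp: indicator_def)
    then show "c (X \<omega>) = (\<Sum>k. c k * indicator {\<omega>\<in>space P. X \<omega> = k} \<omega>)"
      using w by simp
  qed
  also have "\<dots> = (\<Sum>k. c k * emeasure P {\<omega>\<in>space P. X \<omega> = k})"
    by (subst nn_integral_suminf) (auto simp: nn_integral_cmult)
  finally show ?thesis .
qed

lemma integrable_poisson_mass:
  assumes "prob_space P" and [measurable]: "R \<in> borel_measurable P" and R0: "AE \<omega> in P. 0 \<le> R \<omega>"
  shows "integrable P (\<lambda>\<omega>. poisson_mass (R \<omega>) k)"
proof -
  interpret prob_space P by fact
  show ?thesis
    by (rule integrable_const_bound[of _ 1])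
       (use R0 in eventually_elim, auto simp: poisson_mass_nonneg poisson_mass_le_1)
qed

text \<open>Every statement about the law of a mixed Poisson variable becomes one about the parameter by
  taking for \<open>c\<close> a power or an indicator.\<close>

lemma mixed_poisson_nn_integral:
  assumes P: "prob_space P" and mp: "mixed_poisson P X (distr P borel R)"
    and R [measurable]: "R \<in> borel_measurable P" and R0: "AE \<omega> in P. 0 \<le> R \<omega>"
  shows "(\<integral>\<^sup>+ \<omega>. c (X \<omega>) \<partial>P) = (\<integral>\<^sup>+ \<omega>. (\<Sum>k. c k * ennreal (poisson_mass (R \<omega>) k)) \<partial>P)"
proof -
  interpret prob_space P by fact
  have "(\<integral>\<^sup>+ \<omega>. c (X \<omega>) \<partial>P) = (\<Sum>k. c k * emeasure P {\<omega>\<in>space P. X \<omega> = k})"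
    using mp by (intro nn_integral_nat_valued) (simp add: mixed_poisson_def)
  also have "\<dots> = (\<Sum>k. c k * (\<integral>\<^sup>+ \<omega>. ennreal (poisson_mass (R \<omega>) k) \<partial>P))"
  proof -
    have "(\<integral>\<^sup>+ \<omega>. ennreal (poisson_mass (R \<omega>) k) \<partial>P) = ennreal (LINT \<omega>|P. poisson_mass (R \<omega>) k)" for k
      by (rule nn_integral_eq_integral[OF integrable_poisson_mass[OF P R R0]])
         (use R0 in eventually_elim, simp add: poisson_mass_nonneg)
    then show ?thesis
      using mp by (simp add: mixed_poisson_def emeasure_eq_measure integral_distr)
  qed
  also have "\<dots> = (\<integral>\<^sup>+ \<omega>. (\<Sum>k. c k * ennreal (poisson_mass (R \<omega>) k)) \<partial>P)"
    by (subst nn_integral_suminf) (auto simp: nn_integral_cmult)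
  finally show ?thesis .
qed

lemma mixed_poisson_generating_function:
  assumes P: "prob_space P" and mp: "mixed_poisson P X (distr P borel R)"
    and R: "R \<in> borel_measurable P" and R0: "AE \<omega> in P. 0 \<le> R \<omega>" and z: "0 \<le> z"
  shows "(\<integral>\<^sup>+ \<omega>. ennreal (z ^ X \<omega>) \<partial>P) = (\<integral>\<^sup>+ \<omega>. ennreal (exp ((z - 1) * R \<omega>)) \<partial>P)"
  unfolding mixed_poisson_nn_integral[OF P mp R R0, of "\<lambda>k. ennreal (z ^ k)"]
  by (intro nn_integral_cong_AE, use R0 in eventually_elim)
     (use z in \<open>auto simp: poisson_mass_generating_function\<close>)

lemma summable_bounded_power_series:
  fixes u :: "nat \<Rightarrow> real"
  assumes u: "\<And>k. \<bar>u k\<bar> \<le> 1" and z: "\<bar>z\<bar> < 1"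
  shows "summable (\<lambda>k. u k * z ^ k)"
proof (rule summable_comparison_test')
  show "summable (\<lambda>k. \<bar>z\<bar> ^ k)" using z by (intro summable_geometric) auto
  show "norm (u n * z ^ n) \<le> \<bar>z\<bar> ^ n" for n
    using u[of n] by (simp add: abs_mult power_abs mult_left_le_one_le)
qed

text \<open>Only nonnegative arguments are available when the series are generating functions. The first
  coefficients that differ would be the limit of the difference, divided by \<open>z ^ k\<close>, as \<open>z\<close>
  decreases to 0.\<close>

lemma bounded_power_series_unique:
  fixes p q :: "nat \<Rightarrow> real"
  assumes p: "\<And>k. \<bar>p k\<bar> \<le> 1" and q: "\<And>k. \<bar>q k\<bar> \<le> 1"
    and eq: "\<And>z. 0 \<le> z \<Longrightarrow> z < 1 \<Longrightarrow> (\<Sum>k. p k * z ^ k) = (\<Sum>k. q k * z ^ k)"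
  shows "p k = q k"
proof -
  note sm = summable_bounded_power_series
  define f where "f z = (\<Sum>k. (p k - q k) * z ^ k)" for z
  have sums: "(\<lambda>k. (p k - q k) * z ^ k) sums f z" if "\<bar>z\<bar> < 1" for z
    using summable_diff[OF sm[of p, OF p that] sm[of q, OF q that]]
    unfolding f_def by (intro summable_sums) (simp add: left_diff_distrib)
  have f0: "f z = 0" if "0 \<le> z" "z < 1" for z
    using eq[OF that] suminf_diff[OF sm[of p, OF p, of z] sm[of q, OF q, of z]] that
    unfolding f_def by (simp add: left_diff_distrib)
  have "p k - q k = 0" for k
  proof (induction k rule: less_induct)
    case (less k)
    define g where "g z = (if z = 0 then p k - q k else f z / z ^ k)" for z
    have gs: "(\<lambda>n. (p (n + k) - q (n + k)) * z ^ n) sums g z" if z: "\<bar>z\<bar> < 1" for z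
    proof (cases "z = 0")
      case True
      then show ?thesis
        using powser_sums_zero[of "\<lambda>n. p (n + k) - q (n + k)"] by (simp add: g_def)
    next
      case False
      have "(\<lambda>n. (p (n + k) - q (n + k)) * z ^ (n + k)) sums f z"
        using sums_split_initial_segment[OF sums[OF z], of k] less by simp
      from sums_divide[OF this, of "z ^ k"] show ?thesis
        using False by (simp add: g_def power_add)
    qed
    have "(g \<longlongrightarrow> p k - q k) (at 0)"
      using powser_limit_0[of 1 "\<lambda>n. p (n + k) - q (n + k)" g] gs by simp
    then have "(g \<longlongrightarrow> p k - q k) (at_right 0)"
      by (rule filterlim_mono) (auto simp: at_le)
    moreover have "\<forall>\<^sub>F z in at_right 0. g z = 0"
      by (rule eventually_mono[OF eventually_at_right_real[of 0 1]]) (auto simp: g_def f0)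
    then have "(g \<longlongrightarrow> 0) (at_right 0)" by (rule tendsto_eventually)
    ultimately show ?case by (intro tendsto_unique[of "at_right 0" g]) auto
  qed
  then show ?thesis by (simp add: eq_iff_diff_eq_0[of "p k"])
qed

text \<open>Generating functions turn the law of the queue, which is only accessible through upper and lower
  bounds, into an exact mixed Poisson law.\<close>

lemma mixed_poissonI_generating_function:
  assumes P: "prob_space P" and X [measurable]: "X \<in> measurable P (count_space UNIV)"
    and R [measurable]: "R \<in> borel_measurable P" and R0: "AE \<omega> in P. 0 \<le> R \<omega>"
    and gf: "\<And>z. 0 \<le> z \<Longrightarrow> z \<le> 1 \<Longrightarrow>
      (\<integral>\<^sup>+ \<omega>. ennreal (z ^ X \<omega>) \<partial>P) = (\<integral>\<^sup>+ \<omega>. ennreal (exp ((z - 1) * R \<omega>)) \<partial>P)"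
  shows "mixed_poisson P X (distr P borel R)"
proof -
  interpret prob_space P by fact
  note int = integrable_poisson_mass[OF P R R0]
  define p where "p k = prob {\<omega> \<in> space P. X \<omega> = k}" for k
  define q where "q k = (LINT \<omega>|P. poisson_mass (R \<omega>) k)" for k
  have q0: "0 \<le> q k" for k
    unfolding q_def using R0 by (intro integral_nonneg_AE) (auto simp: poisson_mass_nonneg)
  have q1: "q k \<le> 1" for k
    unfolding q_def using R0 int by (intro integral_le_const) (auto simp: poisson_mass_le_1)
  have qnn: "ennreal (q k) = (\<integral>\<^sup>+ \<omega>. ennreal (poisson_mass (R \<omega>) k) \<partial>P)" for k
    unfolding q_def using R0
    by (subst nn_integral_eq_integral[OF int]) (auto simp: poisson_mass_nonneg)
  have p01: "0 \<le> p k" "p k \<le> 1" for k by (auto simp: p_def)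
  have "p k = q k" for k
  proof (rule bounded_power_series_unique)
    fix z :: real assume z: "0 \<le> z" "z < 1"
    have "(\<Sum>k. ennreal (p k * z ^ k)) = (\<integral>\<^sup>+ \<omega>. ennreal (z ^ X \<omega>) \<partial>P)"
      unfolding nn_integral_nat_valued[OF X, of "\<lambda>k. ennreal (z ^ k)"]
      by (simp add: p_def emeasure_eq_measure ennreal_mult z mult.commute)
    also have "\<dots> = (\<integral>\<^sup>+ \<omega>. ennreal (exp ((z - 1) * R \<omega>)) \<partial>P)" using z by (intro gf) auto
    also have "\<dots> = (\<integral>\<^sup>+ \<omega>. (\<Sum>k. ennreal (z ^ k) * ennreal (poisson_mass (R \<omega>) k)) \<partial>P)"
      by (intro nn_integral_cong_AE, use R0 in eventually_elim)
         (use z in \<open>auto simp: poisson_mass_generating_function\<close>)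
    also have "\<dots> = (\<Sum>k. ennreal (z ^ k) * ennreal (q k))"
      by (subst nn_integral_suminf) (auto simp: nn_integral_cmult qnn)
    also have "\<dots> = (\<Sum>k. ennreal (q k * z ^ k))"
      by (simp add: ennreal_mult z q0 mult.commute)
    finally have "(\<Sum>k. ennreal (p k * z ^ k)) = (\<Sum>k. ennreal (q k * z ^ k))" .
    moreover have "summable (\<lambda>k. p k * z ^ k)" "summable (\<lambda>k. q k * z ^ k)"
      using z p01 q0 q1 by (auto intro!: summable_bounded_power_series)
    ultimately have "ennreal (\<Sum>k. p k * z ^ k) = ennreal (\<Sum>k. q k * z ^ k)"
      using z q0 p01 by (simp add: suminf_ennreal2)
    then show "(\<Sum>k. p k * z ^ k) = (\<Sum>k. q k * z ^ k)"
      using z q0 q1 p01 by (subst (asm) ennreal_inj) (auto intro!: suminf_nonneg summable_bounded_power_series)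
  qed (use p01 q0 q1 in \<open>auto simp: abs_le_iff intro: order_trans\<close>)
  then show ?thesis
    unfolding mixed_poisson_def p_def q_def by (auto simp: integral_distr)
qed

text \<open>The Chernoff bound for \<open>P(Y < a x)\<close>, where \<open>Y\<close> is Poisson with mean at least \<open>b x\<close>. The bound is
  written with a sum over \<open>k\<close> so that it can be integrated over the parameter.\<close>

lemma poisson_lower_tail:
  assumes a: "0 < a" "a < b" and r: "b * x \<le> r" and x: "0 \<le> x"
  shows "1 \<le> (\<Sum>k. indicator {k. a * x \<le> real k} k * ennreal (poisson_mass r k))
      + ennreal (exp (- (b - a - a * ln (b / a)) * x))"
proof -
  \<comment> \<open>the minimiser of \<open>(z - 1) * b - a * ln z\<close>\<close>
  define z where "z = a / b"
  have z: "0 < z" "z < 1" using a by (auto simp: z_def)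
  have r0: "0 \<le> r" using r a x by (meson mult_nonneg_nonneg less_imp_le less_trans order_trans)
  have "1 = (\<Sum>k. ennreal (1 ^ k) * ennreal (poisson_mass r k))"
    using poisson_mass_generating_function[OF r0, of 1] by simp
  also have "\<dots> \<le> (\<Sum>k. indicator {k. a * x \<le> real k} k * ennreal (poisson_mass r k)
      + ennreal (z powr (- a * x)) * (ennreal (z ^ k) * ennreal (poisson_mass r k)))"
  proof (intro suminf_le allI summableI)
    fix k
    have "1 \<le> indicator {k. a * x \<le> real k} k + ennreal (z powr (- a * x)) * ennreal (z ^ k)"
    proof (cases "a * x \<le> real k")
      case False
      have "1 = z powr 0" using z by simp
      also have "\<dots> \<le> z powr (- a * x + real k)" using z False by (intro powr_mono') auto
      also have "\<dots> = z powr (- a * x) * z ^ k" using z by (subst powr_add) (simp add: powr_realpow)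
      finally have "ennreal 1 \<le> ennreal (z powr (- a * x) * z ^ k)" by (rule ennreal_leI)
      then show ?thesis using False z by (simp add: ennreal_mult)
    qed (simp add: add_increasing2)
    from mult_right_mono[OF this, of "ennreal (poisson_mass r k)"]
    show "ennreal (1 ^ k) * ennreal (poisson_mass r k) \<le> indicator {k. a * x \<le> real k} k * ennreal (poisson_mass r k)
      + ennreal (z powr (- a * x)) * (ennreal (z ^ k) * ennreal (poisson_mass r k))"
      by (simp add: distrib_right mult.assoc)
  qed
  also have "\<dots> = (\<Sum>k. indicator {k. a * x \<le> real k} k * ennreal (poisson_mass r k))
     + ennreal (z powr (- a * x)) * ennreal (exp ((z - 1) * r))"
    using z poisson_mass_generating_function[OF r0, of z]
    by (subst suminf_add[symmetric]) (auto simp: ennreal_suminf_cmult)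
  also have "ennreal (z powr (- a * x)) * ennreal (exp ((z - 1) * r)) \<le> ennreal (exp (- (b - a - a * ln (b / a)) * x))"
  proof -
    have "z powr (- a * x) = exp (a * x * ln (b / a))"
      using a by (simp add: powr_def z_def ln_div field_simps)
    moreover have "(z - 1) * r \<le> (z - 1) * (b * x)"
      using r z by (intro mult_left_mono_neg) auto
    moreover have "(z - 1) * (b * x) = (a - b) * x" using a by (simp add: z_def field_simps)
    ultimately have "z powr (- a * x) * exp ((z - 1) * r) \<le> exp (a * x * ln (b / a)) * exp ((a - b) * x)"
      by simp
    also have "\<dots> = exp (- (b - a - a * ln (b / a)) * x)"
      by (simp add: algebra_simps flip: exp_add)
    finally show ?thesis by (simp flip: ennreal_mult add: ennreal_leI)
  qed
  finally show ?thesis by (simp add: add_left_mono)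
qed

section \<open>The infinite-server queue with Cox arrivals\<close>

lemma cox_count_probability:
  assumes P: "prob_space P" and sub: "subalgebra P F" and cox: "cox_process P F r T"
    and c: "0 \<le> c 0" "mono c"
    and R [measurable]: "\<And>i. (\<lambda>\<omega>. LINT s:{c i..c (Suc i)}|lborel. r s \<omega>) \<in> borel_measurable P"
  shows "measure P {\<omega> \<in> space P. \<forall>i<m. card {k. T k \<omega> \<in> {c i<..c (Suc i)}} = n i}
      = (LINT \<omega>|P. (\<Prod>i<m. poisson_mass (LINT s:{c i..c (Suc i)}|lborel. r s \<omega>) (n i)))"
proof -
  interpret prob_space P by fact
  interpret finite_measure_subalgebra P F by standard (rule sub)
  have T [measurable]: "\<And>k. T k \<in> borel_measurable P" using cox by (simp add: cox_process_def)
  define A where "A = {\<omega> \<in> space P. \<forall>i<m. card {k. T k \<omega> \<in> {c i<..c (Suc i)}} = n i}"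
  have A [measurable]: "A \<in> sets P" unfolding A_def by measurable
  have "AE \<omega> in P. real_cond_exp P F (indicator A) \<omega>
          = (\<Prod>i<m. poisson_mass (LINT s:{c i..c (Suc i)}|lborel. r s \<omega>) (n i))"
    using cox c unfolding cox_process_def A_def by blast
  moreover have "measure P A = (LINT \<omega>|P. real_cond_exp P F (indicator A) \<omega>)"
    by (subst real_cond_exp_int(2)) (auto intro!: integrable_real_indicator simp: emeasure_eq_measure)
  ultimately show ?thesis
    unfolding A_def[symmetric] by (auto intro!: integral_cong_AE)
qed

text \<open>Given \<open>F\<close> the counts are independent Poisson variables. Only unconditional expectations are
  computed, since the service times are independent of the arrivals but not necessarily of \<open>F\<close> and
  the arrivals jointly.\<close>

lemma cox_counts_generating_function:
  assumes P: "prob_space P" and sub: "subalgebra P F" and cox: "cox_process P F r T"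
    and c: "0 \<le> c 0" "mono c"
    and R [measurable]: "\<And>i. (\<lambda>\<omega>. LINT s:{c i..c (Suc i)}|lborel. r s \<omega>) \<in> borel_measurable P"
    and R0: "AE \<omega> in P. \<forall>i. 0 \<le> (LINT s:{c i..c (Suc i)}|lborel. r s \<omega>)"
    and q: "\<And>i. 0 \<le> q i"
  shows "(\<integral>\<^sup>+ \<omega>. (\<Prod>i<m. ennreal (q i ^ card {k. T k \<omega> \<in> {c i<..c (Suc i)}})) \<partial>P)
       = (\<integral>\<^sup>+ \<omega>. ennreal (exp (\<Sum>i<m. (q i - 1) * (LINT s:{c i..c (Suc i)}|lborel. r s \<omega>))) \<partial>P)"
proof -
  interpret prob_space P by fact
  have T [measurable]: "\<And>k. T k \<in> borel_measurable P" using cox by (simp add: cox_process_def)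
  define N where "N i \<omega> = card {k. T k \<omega> \<in> {c i<..c (Suc i)}}" for i \<omega>
  have N [measurable]: "N i \<in> measurable P (count_space UNIV)" for i
    unfolding N_def by measurable
  define R' where "R' i \<omega> = (LINT s:{c i..c (Suc i)}|lborel. r s \<omega>)" for i \<omega>
  have R' [measurable]: "R' i \<in> borel_measurable P" for i
    unfolding R'_def by (rule R)
  have R'0: "AE \<omega> in P. \<forall>i. 0 \<le> R' i \<omega>" using R0 by (simp add: R'_def)
  define A where "A n = {\<omega> \<in> space P. \<forall>i<m. N i \<omega> = n i}" for n
  have A [measurable]: "A n \<in> sets P" for n unfolding A_def by measurable
  define I where "I = (\<Pi>\<^sub>E i\<in>{..<m}. (UNIV :: nat set))"
  have I: "countable I" unfolding I_def by (intro countable_PiE) auto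
  define pm where "pm n i \<omega> = ennreal (poisson_mass (R' i \<omega>) (n i))" for n :: "nat \<Rightarrow> nat" and i \<omega>
  have prA: "emeasure P (A n) = (\<integral>\<^sup>+ \<omega>. (\<Prod>i<m. pm n i \<omega>) \<partial>P)" for n
  proof -
    have "emeasure P (A n) = ennreal (LINT \<omega>|P. (\<Prod>i<m. poisson_mass (R' i \<omega>) (n i)))"
      using cox_count_probability[OF P sub cox c R, of m n]
      by (simp add: emeasure_eq_measure A_def N_def R'_def)
    also have "\<dots> = (\<integral>\<^sup>+ \<omega>. ennreal (\<Prod>i<m. poisson_mass (R' i \<omega>) (n i)) \<partial>P)"
    proof (rule nn_integral_eq_integral[symmetric])
      show "integrable P (\<lambda>\<omega>. \<Prod>i<m. poisson_mass (R' i \<omega>) (n i))"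
        by (rule integrable_const_bound[of _ 1], use R'0 in eventually_elim)
           (auto simp: poisson_mass_nonneg poisson_mass_le_1 abs_prod intro!: prod_le_1)
      show "AE \<omega> in P. 0 \<le> (\<Prod>i<m. poisson_mass (R' i \<omega>) (n i))"
        using R'0 by eventually_elim (auto intro!: prod_nonneg poisson_mass_nonneg)
    qed
    also have "\<dots> = (\<integral>\<^sup>+ \<omega>. (\<Prod>i<m. pm n i \<omega>) \<partial>P)"
      unfolding pm_def
      by (intro nn_integral_cong_AE, use R'0 in eventually_elim)
         (auto simp: prod_ennreal poisson_mass_nonneg)
    finally show ?thesis .
  qed
  have pm_meas [measurable]: "pm n i \<in> borel_measurable P" for n i
    unfolding pm_def by measurable
  have "(\<integral>\<^sup>+ \<omega>. (\<Prod>i<m. ennreal (q i ^ N i \<omega>)) \<partial>P)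
      = (\<integral>\<^sup>+ \<omega>. (\<integral>\<^sup>+ n. (\<Prod>i<m. ennreal (q i ^ n i)) * indicator (A n) \<omega> \<partial>count_space I) \<partial>P)"
  proof (intro nn_integral_cong)
    fix \<omega> assume w: "\<omega> \<in> space P"
    define n0 where "n0 = (\<lambda>i\<in>{..<m}. N i \<omega>)"
    have n0: "n0 \<in> I" by (auto simp: n0_def I_def)
    have eq: "indicator (A n) \<omega> = (indicator {n0} n :: ennreal)" if "n \<in> I" for n
      using that w by (auto simp: indicator_def A_def n0_def I_def PiE_iff extensional_def fun_eq_iff)
    have "(\<integral>\<^sup>+ n. (\<Prod>i<m. ennreal (q i ^ n i)) * indicator (A n) \<omega> \<partial>count_space I)
        = (\<integral>\<^sup>+ n. (\<Prod>i<m. ennreal (q i ^ n i)) * indicator {n0} n \<partial>count_space I)"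
      by (intro nn_integral_cong) (simp add: eq)
    also have "\<dots> = (\<Prod>i<m. ennreal (q i ^ n0 i))"
      using n0 by (subst nn_integral_indicator_singleton) auto
    also have "\<dots> = (\<Prod>i<m. ennreal (q i ^ N i \<omega>))"
      by (intro prod.cong) (auto simp: n0_def)
    finally show "(\<Prod>i<m. ennreal (q i ^ N i \<omega>))
      = (\<integral>\<^sup>+ n. (\<Prod>i<m. ennreal (q i ^ n i)) * indicator (A n) \<omega> \<partial>count_space I)" ..
  qed
  also have "\<dots> = (\<integral>\<^sup>+ n. (\<integral>\<^sup>+ \<omega>. (\<Prod>i<m. ennreal (q i ^ n i)) * indicator (A n) \<omega> \<partial>P) \<partial>count_space I)"
    by (rule nn_integral_count_space_nn_integral[OF I]) measurable
  also have "\<dots> = (\<integral>\<^sup>+ n. (\<Prod>i<m. ennreal (q i ^ n i)) * emeasure P (A n) \<partial>count_space I)"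
    by (intro nn_integral_cong nn_integral_cmult_indicator) measurable
  also have "\<dots> = (\<integral>\<^sup>+ n. (\<integral>\<^sup>+ \<omega>. (\<Prod>i<m. ennreal (q i ^ n i) * pm n i \<omega>) \<partial>P) \<partial>count_space I)"
    unfolding prA prod.distrib by (intro nn_integral_cong nn_integral_cmult[symmetric]) measurable
  also have "\<dots> = (\<integral>\<^sup>+ \<omega>. (\<integral>\<^sup>+ n. (\<Prod>i<m. ennreal (q i ^ n i) * pm n i \<omega>) \<partial>count_space I) \<partial>P)"
  proof (rule nn_integral_count_space_nn_integral[OF I, symmetric,
        where f = "\<lambda>n \<omega>. \<Prod>i<m. ennreal (q i ^ n i) * pm n i \<omega>"])
    show "(\<lambda>\<omega>. \<Prod>i<m. ennreal (q i ^ n i) * pm n i \<omega>) \<in> borel_measurable P" for n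
      by (intro borel_measurable_prod_ennreal borel_measurable_times_ennreal borel_measurable_const pm_meas)
  qed
  also have "\<dots> = (\<integral>\<^sup>+ \<omega>. (\<Prod>i<m. (\<integral>\<^sup>+ k. ennreal (q i ^ k) * ennreal (poisson_mass (R' i \<omega>) k)
        \<partial>count_space UNIV)) \<partial>P)"
  proof (intro nn_integral_cong)
    fix \<omega>
    interpret product_sigma_finite "\<lambda>_ :: nat. count_space (UNIV :: nat set)"
      unfolding product_sigma_finite_def by (simp add: sigma_finite_measure_count_space)
    have "I = (\<Pi>\<^sub>E i\<in>{..<m}. (UNIV :: nat set))" by (simp add: I_def)
    then have cs: "count_space I = (\<Pi>\<^sub>M i\<in>{..<m}. count_space (UNIV :: nat set))"
      by (subst count_space_PiM_finite) auto
    show "(\<integral>\<^sup>+ n. (\<Prod>i<m. ennreal (q i ^ n i) * pm n i \<omega>) \<partial>count_space I)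
      = (\<Prod>i<m. (\<integral>\<^sup>+ k. ennreal (q i ^ k) * ennreal (poisson_mass (R' i \<omega>) k) \<partial>count_space UNIV))"
      unfolding cs pm_def by (rule product_nn_integral_prod) auto
  qed
  also have "\<dots> = (\<integral>\<^sup>+ \<omega>. ennreal (exp (\<Sum>i<m. (q i - 1) * R' i \<omega>)) \<partial>P)"
    by (intro nn_integral_cong_AE, use R'0 in eventually_elim)
       (use q in \<open>auto simp: nn_integral_count_space_nat poisson_mass_generating_function exp_sum prod_ennreal\<close>)
  finally show ?thesis by (simp add: N_def R'_def)
qed

text \<open>Thinning with the epochs held fixed: an epoch in the \<open>i\<close>-th interval is kept if its mark exceeds
  \<open>b i\<close>, so it contributes the factor \<open>E z ^ Bernoulli (p i)\<close>.\<close>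

lemma marked_count_generating_function:
  fixes S :: "nat \<Rightarrow> 'a \<Rightarrow> real"
  assumes P: "prob_space P" and ind: "prob_space.indep_vars P (\<lambda>_. borel) S UNIV"
    and p: "\<And>i k. i < m \<Longrightarrow> measure P {\<omega> \<in> space P. b i < S k \<omega>} = p i"
    and c: "mono c" and fin: "\<And>i. finite {k. \<tau> k \<in> {c i<..c (Suc i)}}" and z: "0 \<le> z"
  shows "(\<integral>\<^sup>+ \<omega>. ennreal (z ^ card {k. \<exists>i<m. \<tau> k \<in> {c i<..c (Suc i)} \<and> b i < S k \<omega>}) \<partial>P)
       = (\<Prod>i<m. ennreal ((1 + p i * (z - 1)) ^ card {k. \<tau> k \<in> {c i<..c (Suc i)}}))"
proof -
  interpret prob_space P by fact
  have S [measurable]: "random_variable borel (S k)" for k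
    using ind by (auto simp: indep_vars_def)
  define K where "K = (\<Union>i<m. {k. \<tau> k \<in> {c i<..c (Suc i)}})"
  have K: "finite K" unfolding K_def using fin by auto
  have uniq: "i = j" if "x \<in> {c i<..c (Suc i)}" "x \<in> {c j<..c (Suc j)}" for i j x
  proof (rule ccontr)
    assume "i \<noteq> j"
    then consider "Suc i \<le> j" | "Suc j \<le> i" by linarith
    then show False using that monoD[OF c, of "Suc i" j] monoD[OF c, of "Suc j" i] by cases auto
  qed
  define \<iota> where "\<iota> k = (THE i. \<tau> k \<in> {c i<..c (Suc i)})" for k
  have \<iota>: "\<iota> k = i" if "\<tau> k \<in> {c i<..c (Suc i)}" for k i
    unfolding \<iota>_def using that uniq by (intro the_equality) auto
  have \<iota>K: "\<iota> k < m" "\<tau> k \<in> {c (\<iota> k)<..c (Suc (\<iota> k))}" if "k \<in> K" for k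
    using that \<iota> unfolding K_def by auto
  define f where "f k x = (if b (\<iota> k) < x then ennreal z else 1)" for k x
  have fm [measurable]: "f k \<in> borel_measurable borel" for k unfolding f_def by measurable
  have "ennreal (z ^ card {k. \<exists>i<m. \<tau> k \<in> {c i<..c (Suc i)} \<and> b i < S k \<omega>}) = (\<Prod>k\<in>K. f k (S k \<omega>))" for \<omega>
  proof -
    have "{k. \<exists>i<m. \<tau> k \<in> {c i<..c (Suc i)} \<and> b i < S k \<omega>} = K \<inter> {k. b (\<iota> k) < S k \<omega>}"
      using \<iota> \<iota>K by (fastforce simp: K_def)
    then show ?thesis
      using K z by (simp add: f_def prod.If_cases ennreal_power)
  qed
  then have "(\<integral>\<^sup>+ \<omega>. ennreal (z ^ card {k. \<exists>i<m. \<tau> k \<in> {c i<..c (Suc i)} \<and> b i < S k \<omega>}) \<partial>P)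
     = (\<integral>\<^sup>+ \<omega>. (\<Prod>k\<in>K. f k (S k \<omega>)) \<partial>P)" by simp
  also have "\<dots> = (\<Prod>k\<in>K. \<integral>\<^sup>+ \<omega>. f k (S k \<omega>) \<partial>P)"
    by (rule indep_vars_nn_integral[OF K])
       (auto intro!: indep_vars_compose2[OF indep_vars_subset[OF ind], where Y = f])
  also have "\<dots> = (\<Prod>k\<in>K. ennreal (1 + p (\<iota> k) * (z - 1)))"
  proof (rule prod.cong[OF refl])
    fix k assume k: "k \<in> K"
    let ?B = "{\<omega> \<in> space P. b (\<iota> k) < S k \<omega>}"
    have pB: "prob ?B = p (\<iota> k)" using p \<iota>K(1)[OF k] by simp
    have "(\<integral>\<^sup>+ \<omega>. f k (S k \<omega>) \<partial>P) = (\<integral>\<^sup>+ \<omega>. ennreal z * indicator ?B \<omega> + indicator (space P - ?B) \<omega> \<partial>P)"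
      by (intro nn_integral_cong) (auto simp: f_def indicator_def)
    also have "\<dots> = ennreal z * emeasure P ?B + emeasure P (space P - ?B)"
      by (subst nn_integral_add) (auto simp: nn_integral_cmult)
    also have "\<dots> = ennreal z * ennreal (p (\<iota> k)) + ennreal (1 - p (\<iota> k))"
      by (simp add: emeasure_eq_measure prob_compl pB)
    also have "\<dots> = ennreal (1 + p (\<iota> k) * (z - 1))"
      using pB z measure_nonneg[of P ?B] prob_le_1[of ?B]
      by (simp add: algebra_simps flip: ennreal_mult ennreal_plus)
    finally show "(\<integral>\<^sup>+ \<omega>. f k (S k \<omega>) \<partial>P) = ennreal (1 + p (\<iota> k) * (z - 1))" .
  qed
  also have "\<dots> = (\<Prod>i<m. \<Prod>k\<in>{k\<in>K. \<iota> k = i}. ennreal (1 + p (\<iota> k) * (z - 1)))"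
    using K \<iota>K by (intro prod.group[symmetric]) auto
  also have "\<dots> = (\<Prod>i<m. ennreal ((1 + p i * (z - 1)) ^ card {k. \<tau> k \<in> {c i<..c (Suc i)}}))"
  proof (rule prod.cong[OF refl])
    fix i assume i: "i \<in> {..<m}"
    have "{k\<in>K. \<iota> k = i} = {k. \<tau> k \<in> {c i<..c (Suc i)}}"
      using i \<iota> \<iota>K by (auto simp: K_def)
    moreover have "0 \<le> 1 + p i * (z - 1)"
    proof -
      have "0 \<le> p i" "p i \<le> 1" using p[of i 0] i by (auto simp flip: p[of i 0])
      then show ?thesis using z mult_nonneg_nonneg[of "p i" z] unfolding right_diff_distrib by linarith
    qed
    ultimately show "(\<Prod>k\<in>{k\<in>K. \<iota> k = i}. ennreal (1 + p (\<iota> k) * (z - 1)))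
       = ennreal ((1 + p i * (z - 1)) ^ card {k. \<tau> k \<in> {c i<..c (Suc i)}})"
      by (subst prod.cong[OF refl, where h = "\<lambda>_. ennreal (1 + p i * (z - 1))"]) (auto simp: ennreal_power)
  qed
  finally show ?thesis .
qed

lemma nn_integral_indep_var:
  assumes P: "prob_space P" and ind: "prob_space.indep_var P A X B Y"
    and f [measurable]: "f \<in> borel_measurable (A \<Otimes>\<^sub>M B)"
  shows "(\<integral>\<^sup>+ \<omega>. f (X \<omega>, Y \<omega>) \<partial>P) = (\<integral>\<^sup>+ \<omega>. \<integral>\<^sup>+ \<omega>'. f (X \<omega>, Y \<omega>') \<partial>P \<partial>P)"
proof -
  interpret prob_space P by fact
  have X [measurable]: "random_variable A X" and Y [measurable]: "random_variable B Y"
    and eq: "distr P A X \<Otimes>\<^sub>M distr P B Y = distr P (A \<Otimes>\<^sub>M B) (\<lambda>x. (X x, Y x))"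
    using ind by (auto simp: indep_var_distribution_eq)
  interpret Y: prob_space "distr P B Y" by (rule prob_space_distr) fact
  have "(\<integral>\<^sup>+ \<omega>. f (X \<omega>, Y \<omega>) \<partial>P) = (\<integral>\<^sup>+ x. f x \<partial>(distr P A X \<Otimes>\<^sub>M distr P B Y))"
    unfolding eq by (subst nn_integral_distr) auto
  also have "\<dots> = (\<integral>\<^sup>+ x. \<integral>\<^sup>+ y. f (x, y) \<partial>distr P B Y \<partial>distr P A X)"
    by (rule Y.nn_integral_fst[symmetric]) (simp cong: measurable_cong_sets)
  also have "\<dots> = (\<integral>\<^sup>+ \<omega>. \<integral>\<^sup>+ \<omega>'. f (X \<omega>, Y \<omega>') \<partial>P \<partial>P)"
  proof -
    have "(\<lambda>x. \<integral>\<^sup>+ y. f (x, y) \<partial>distr P B Y) \<in> borel_measurable A"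
      by (rule Y.borel_measurable_nn_integral_fst) (simp cong: measurable_cong_sets)
    then show ?thesis
      by (subst nn_integral_distr) (auto intro!: nn_integral_cong nn_integral_distr)
  qed
  finally show ?thesis .
qed

text \<open>Thinning of a Poisson process: each factor \<open>1 + p i * (z - 1)\<close> enters the generating function of
  the counts as its argument, and multiplies the intensity in the exponent by \<open>p i\<close>.\<close>

lemma thinned_cox_generating_function:
  assumes P: "prob_space P" and sub: "subalgebra P F" and cox: "cox_process P F r T"
    and indS: "prob_space.indep_vars P (\<lambda>_. borel) S UNIV"
    and TS: "prob_space.indep_var P
          (\<Pi>\<^sub>M k\<in>UNIV. borel) (\<lambda>\<omega> k. T k \<omega>) (\<Pi>\<^sub>M k\<in>UNIV. borel) (\<lambda>\<omega> k. S k \<omega>)"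
    and p: "\<And>i k. i < m \<Longrightarrow> measure P {\<omega> \<in> space P. b i < S k \<omega>} = p i"
    and p0: "\<And>i. 0 \<le> p i" and p01: "\<And>i. p i \<le> 1"
    and c: "0 \<le> c 0" "mono c"
    and R [measurable]: "\<And>i. (\<lambda>\<omega>. LINT s:{c i..c (Suc i)}|lborel. r s \<omega>) \<in> borel_measurable P"
    and R0: "AE \<omega> in P. \<forall>i. 0 \<le> (LINT s:{c i..c (Suc i)}|lborel. r s \<omega>)"
    and z: "0 \<le> z" "z \<le> 1"
  shows "(\<integral>\<^sup>+ \<omega>. ennreal (z ^ card {k. \<exists>i<m. T k \<omega> \<in> {c i<..c (Suc i)} \<and> b i < S k \<omega>}) \<partial>P)
       = (\<integral>\<^sup>+ \<omega>. ennreal (exp ((z - 1) * (\<Sum>i<m. p i * (LINT s:{c i..c (Suc i)}|lborel. r s \<omega>)))) \<partial>P)"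
proof -
  interpret prob_space P by fact
  have T [measurable]: "\<And>k. T k \<in> borel_measurable P"
    and Tlim: "AE \<omega> in P. filterlim (\<lambda>k. T k \<omega>) at_top sequentially"
    using cox by (auto simp: cox_process_def)
  define f where "f = (\<lambda>(\<tau>, \<sigma>). ennreal (z ^ card {k :: nat. \<exists>i<m. \<tau> k \<in> {c i<..c (Suc i)} \<and> b i < (\<sigma> k :: real)}))"
  have [measurable]: "(\<lambda>x. fst x k) \<in> borel_measurable ((\<Pi>\<^sub>M k\<in>UNIV. (borel :: real measure)) \<Otimes>\<^sub>M (\<Pi>\<^sub>M k\<in>UNIV. (borel :: real measure)))"
    and [measurable]: "(\<lambda>x. snd x k) \<in> borel_measurable ((\<Pi>\<^sub>M k\<in>UNIV. (borel :: real measure)) \<Otimes>\<^sub>M (\<Pi>\<^sub>M k\<in>UNIV. (borel :: real measure)))"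
    for k :: nat
    by (auto intro: measurable_compose[OF measurable_fst measurable_component_singleton]
      measurable_compose[OF measurable_snd measurable_component_singleton])
  have [measurable]: "f \<in> borel_measurable ((\<Pi>\<^sub>M k\<in>UNIV. borel) \<Otimes>\<^sub>M (\<Pi>\<^sub>M k\<in>UNIV. borel))"
    unfolding f_def by measurable
  have pos: "0 \<le> 1 + p i * (z - 1)" for i
  proof -
    have "p i * (1 - z) \<le> 1 * 1"
      using p01[of i] z by (intro mult_mono') (auto simp: p0)
    then show ?thesis by (simp add: algebra_simps)
  qed
  have "(\<integral>\<^sup>+ \<omega>. ennreal (z ^ card {k. \<exists>i<m. T k \<omega> \<in> {c i<..c (Suc i)} \<and> b i < S k \<omega>}) \<partial>P)
      = (\<integral>\<^sup>+ \<omega>. f (\<lambda>k. T k \<omega>, \<lambda>k. S k \<omega>) \<partial>P)" by (simp add: f_def)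
  also have "\<dots> = (\<integral>\<^sup>+ \<omega>. \<integral>\<^sup>+ \<omega>'. f (\<lambda>k. T k \<omega>, \<lambda>k. S k \<omega>') \<partial>P \<partial>P)"
    by (rule nn_integral_indep_var[OF P TS]) measurable
  also have "\<dots> = (\<integral>\<^sup>+ \<omega>. (\<Prod>i<m. ennreal ((1 + p i * (z - 1)) ^ card {k. T k \<omega> \<in> {c i<..c (Suc i)}})) \<partial>P)"
  proof (intro nn_integral_cong_AE, use Tlim in eventually_elim)
    fix \<omega> assume lim: "filterlim (\<lambda>k. T k \<omega>) at_top sequentially"
    have "finite {k. T k \<omega> \<in> {c i<..c (Suc i)}}" for i
    proof -
      obtain k0 where "\<And>k. k \<ge> k0 \<Longrightarrow> c (Suc i) < T k \<omega>"
        using lim unfolding filterlim_at_top_dense eventually_sequentially by blast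
      then have "{k. T k \<omega> \<in> {c i<..c (Suc i)}} \<subseteq> {..<k0}"
        by (auto simp: not_le[symmetric])
      then show ?thesis by (rule finite_subset) simp
    qed
    then show "(\<integral>\<^sup>+ \<omega>'. f (\<lambda>k. T k \<omega>, \<lambda>k. S k \<omega>') \<partial>P)
      = (\<Prod>i<m. ennreal ((1 + p i * (z - 1)) ^ card {k. T k \<omega> \<in> {c i<..c (Suc i)}}))"
      unfolding f_def using marked_count_generating_function[OF P indS p c(2) _ z(1)] by simp
  qed
  also have "\<dots> = (\<integral>\<^sup>+ \<omega>. ennreal (exp (\<Sum>i<m. ((1 + p i * (z - 1)) - 1) * (LINT s:{c i..c (Suc i)}|lborel. r s \<omega>))) \<partial>P)"
    by (rule cox_counts_generating_function[OF P sub cox c R R0 pos])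
  finally show ?thesis by (simp add: sum_distrib_left mult_ac)
qed

lemma set_integral_split_mono:
  fixes f :: "real \<Rightarrow> real" and c :: "nat \<Rightarrow> real"
  assumes c: "mono c" and int: "set_integrable lborel {c 0..c m} f"
  shows "(LINT s:{c 0..c m}|lborel. f s) = (\<Sum>i<m. LINT s:{c i..c (Suc i)}|lborel. f s)"
  using int
proof (induction m)
  case 0
  then show ?case by (simp add: set_borel_integral_eq_integral)
next
  case (Suc m)
  have le: "c 0 \<le> c m" "c m \<le> c (Suc m)" using monoD[OF c] by auto
  have i1: "set_integrable lborel {c 0..c m} f" and i2: "set_integrable lborel {c m..c (Suc m)} f"
    using le by (auto intro: set_integrable_subset[OF Suc.prems])
  have "(LINT s:{c 0..c (Suc m)}|lborel. f s) = integral {c 0..c (Suc m)} f"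
    using Suc.prems by (rule set_borel_integral_eq_integral)
  also have "\<dots> = integral {c 0..c m} f + integral {c m..c (Suc m)} f"
    using le set_borel_integral_eq_integral(1)[OF Suc.prems]
    by (intro Henstock_Kurzweil_Integration.integral_combine[symmetric]) auto
  also have "\<dots> = (LINT s:{c 0..c m}|lborel. f s) + (LINT s:{c m..c (Suc m)}|lborel. f s)"
    using i1 i2 by (simp add: set_borel_integral_eq_integral)
  finally show ?case using Suc.IH[OF i1] by simp
qed

text \<open>A job that arrives in the \<open>i\<close>-th interval of a grid is present at time \<open>t\<close> if its service time
  exceeds \<open>t\<close> minus the left end point, and only if it exceeds \<open>t\<close> minus the right end point. The
  two comparison counts depend on the arrivals only through the interval, so the thinning lemma
  applies to them.\<close>

lemma present_count_sandwich:
  fixes \<tau> \<sigma> :: "nat \<Rightarrow> real"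
  assumes pos: "\<And>k. 0 < \<tau> k" and lim: "filterlim \<tau> at_top sequentially"
    and h: "0 < h" and m: "0 < m" and t: "t = real m * h"
  shows "card {k. \<exists>i<m. \<tau> k \<in> {real i * h<..real (Suc i) * h} \<and> t - real i * h < \<sigma> k}
       \<le> card {k. \<tau> k \<le> t \<and> t < \<tau> k + \<sigma> k}" (is "card ?lo \<le> card ?X")
    and "card {k. \<tau> k \<le> t \<and> t < \<tau> k + \<sigma> k}
       \<le> card {k. \<exists>i<m. \<tau> k \<in> {real i * h<..real (Suc i) * h} \<and> t - real (Suc i) * h < \<sigma> k}"
       (is "_ \<le> card ?hi")
proof -
  have le: "real (Suc i) * h \<le> t" if "i < m" for i
    unfolding t using that h by (intro mult_right_mono) auto
  obtain k0 where k0: "\<And>k. k \<ge> k0 \<Longrightarrow> t < \<tau> k"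
    using lim unfolding filterlim_at_top_dense eventually_sequentially by blast
  have fin: "finite {k. \<tau> k \<le> t}"
    by (rule finite_subset[of _ "{..<k0}"]) (use k0 in \<open>auto simp: not_le[symmetric]\<close>)
  have "?lo \<subseteq> ?X" using le by fastforce
  then show "card ?lo \<le> card ?X" by (intro card_mono finite_subset[OF _ fin]) auto
  have "?X \<subseteq> ?hi"
  proof safe
    fix k assume k: "\<tau> k \<le> t" "t < \<tau> k + \<sigma> k"
    define i where "i = nat (\<lceil>\<tau> k / h\<rceil> - 1)"
    have "0 < \<tau> k / h" using pos h by simp
    then have c1: "1 \<le> \<lceil>\<tau> k / h\<rceil>" by (simp add: one_le_ceiling)
    have "\<tau> k / h \<le> real m" using k h t by (simp add: pos_divide_le_eq)
    then have "\<lceil>\<tau> k / h\<rceil> \<le> int m" by (simp add: ceiling_le_iff)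
    then have im: "i < m" using c1 m unfolding i_def by linarith
    have ri: "real i = real_of_int \<lceil>\<tau> k / h\<rceil> - 1"
      unfolding i_def using c1 by (subst of_nat_nat) auto
    have "real i < \<tau> k / h" "\<tau> k / h \<le> real i + 1"
      unfolding ri by linarith+
    then have "\<tau> k \<in> {real i * h<..real (Suc i) * h}"
      using h by (simp add: pos_less_divide_eq pos_divide_le_eq add.commute)
    then show "\<exists>i<m. \<tau> k \<in> {real i * h<..real (Suc i) * h} \<and> t - real (Suc i) * h < \<sigma> k"
      using im k by (intro exI[of _ i]) auto
  qed
  moreover have "finite ?hi"
    by (rule finite_subset[OF _ fin]) (use le in fastforce)
  ultimately show "card ?X \<le> card ?hi" by (intro card_mono) auto
qed

lemma discounted_integral_grid_bounds:
  fixes f :: "real \<Rightarrow> real"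
  assumes int: "set_integrable lborel {0..t} f" and f0: "\<And>s. 0 \<le> f s"
    and mu: "0 < \<mu>" and h: "0 < h" and t: "t = real m * h"
  defines "K \<equiv> LINT s:{0..t}|lborel. f s * exp (- \<mu> * (t - s))"
    and "G \<equiv> \<Sum>i<m. exp (- \<mu> * (t - real i * h)) * (LINT s:{real i * h..real (Suc i) * h}|lborel. f s)"
  shows "G \<le> K \<and> K \<le> exp (\<mu> * h) * G"
proof -
  define c where "c i = real i * h" for i :: nat
  define p where "p i = exp (- \<mu> * (t - c i))" for i
  define g where "g s = f s * exp (- \<mu> * (t - s))" for s
  have c: "mono c" "c 0 = 0" "c m = t" "\<And>i. c (Suc i) = c i + h"
    using h by (auto simp: c_def t mono_def mult_right_mono algebra_simps)
  have pS: "p (Suc i) = exp (\<mu> * h) * p i" for i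
    by (simp add: p_def c algebra_simps flip: exp_add)
  have intg: "set_integrable lborel {0..t} g"
    unfolding g_def set_integrable_def
  proof (rule Bochner_Integration.integrable_bound)
    show "integrable lborel (\<lambda>s. indicat_real {0..t} s *\<^sub>R f s)"
      using int by (simp add: set_integrable_def)
    then have [measurable]: "(\<lambda>s. indicat_real {0..t} s *\<^sub>R f s) \<in> borel_measurable lborel"
      by (rule borel_measurable_integrable)
    have "(\<lambda>s. (indicat_real {0..t} s *\<^sub>R f s) * exp (- \<mu> * (t - s))) \<in> borel_measurable lborel"
      by measurable
    then show "(\<lambda>s. indicat_real {0..t} s *\<^sub>R (f s * exp (- \<mu> * (t - s)))) \<in> borel_measurable lborel"
      by (simp add: mult.assoc)
    have "\<bar>f s\<bar> * exp (- \<mu> * (t - s)) \<le> \<bar>f s\<bar> * 1" if "s \<le> t" for s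
      using that mu by (intro mult_left_mono) auto
    then show "AE s in lborel. norm (indicat_real {0..t} s *\<^sub>R (f s * exp (- \<mu> * (t - s))))
        \<le> norm (indicat_real {0..t} s *\<^sub>R f s)"
      by (auto simp: indicator_def abs_mult)
  qed
  have sub: "{c i..c (Suc i)} \<subseteq> {0..t}" if "i < m" for i
    using monoD[OF c(1), of "Suc i" m] monoD[OF c(1), of 0 i] that c(2,3) by auto
  have "K = (\<Sum>i<m. LINT s:{c i..c (Suc i)}|lborel. g s)"
    using set_integral_split_mono[OF c(1), of m g] intg by (simp add: c(2,3) K_def g_def)
  moreover have "p i * (LINT s:{c i..c (Suc i)}|lborel. f s) \<le> (LINT s:{c i..c (Suc i)}|lborel. g s)
      \<and> (LINT s:{c i..c (Suc i)}|lborel. g s) \<le> exp (\<mu> * h) * (p i * (LINT s:{c i..c (Suc i)}|lborel. f s))"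
    if i: "i < m" for i
  proof -
    have ig: "set_integrable lborel {c i..c (Suc i)} g"
      and ir: "set_integrable lborel {c i..c (Suc i)} f"
      by (auto intro: set_integrable_subset[OF intg _ sub[OF i]] set_integrable_subset[OF int _ sub[OF i]])
    have "p i * f s \<le> g s \<and> g s \<le> exp (\<mu> * h) * p i * f s" if s: "s \<in> {c i..c (Suc i)}" for s
    proof -
      have "p i \<le> exp (- \<mu> * (t - s))" using s mu by (simp add: p_def mult_left_mono)
      moreover have "exp (- \<mu> * (t - s)) \<le> p (Suc i)" using s mu by (simp add: p_def mult_left_mono)
      ultimately show ?thesis
        using f0 by (auto simp: g_def pS mult.commute[of _ "f s"] intro!: mult_left_mono)
    qed
    then have "(LINT s:{c i..c (Suc i)}|lborel. p i * f s) \<le> (LINT s:{c i..c (Suc i)}|lborel. g s)"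
      "(LINT s:{c i..c (Suc i)}|lborel. g s) \<le> (LINT s:{c i..c (Suc i)}|lborel. exp (\<mu> * h) * p i * f s)"
      using ig ir by (simp_all only: set_integral_mono set_integrable_mult_right)
    then show ?thesis by (simp add: set_integral_mult_right mult.assoc)
  qed
  moreover have "G = (\<Sum>i<m. p i * (LINT s:{c i..c (Suc i)}|lborel. f s))"
    unfolding G_def p_def c_def ..
  ultimately show ?thesis
    by (auto simp: sum_distrib_left intro!: sum_mono)
qed

text \<open>The two comparison counts of a grid of mesh \<open>h\<close> are mixed Poisson with parameters within a factor
  \<open>exp (\<mu> * h)\<close> of the discounted integral. Letting \<open>h\<close> tend to 0 gives the generating function of
  the queue length, and with it its law.\<close>

theorem infinite_server_queue_mixed_poisson:
  assumes P: "prob_space P" and sub: "subalgebra P F"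
    and queue: "infinite_server_queue P F r \<mu> t X" and mu: "0 < \<mu>" and t: "0 < t"
    and r [measurable]: "(\<lambda>(\<omega>, s). r s \<omega>) \<in> borel_measurable (P \<Otimes>\<^sub>M lborel)"
    and r0: "AE \<omega> in P. \<forall>s. 0 \<le> r s \<omega>"
    and int: "AE \<omega> in P. set_integrable lborel {0..t} (\<lambda>s. r s \<omega>)"
  shows "mixed_poisson P X (distr P borel (\<lambda>\<omega>. LINT s:{0..t}|lborel. r s \<omega> * exp (- \<mu> * (t - s))))"
proof -
  interpret prob_space P by fact
  define \<kappa> where "\<kappa> \<omega> = (LINT s:{0..t}|lborel. r s \<omega> * exp (- \<mu> * (t - s)))" for \<omega>
  obtain T S where cox: "cox_process P F r T"
    and indS: "indep_vars (\<lambda>_. borel) S UNIV"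
    and S: "\<And>k. distributed P lborel (S k) (exponential_density \<mu>)"
    and TS: "indep_var (\<Pi>\<^sub>M k\<in>UNIV. borel) (\<lambda>\<omega> k. T k \<omega>) (\<Pi>\<^sub>M k\<in>UNIV. borel) (\<lambda>\<omega> k. S k \<omega>)"
    and X: "\<And>\<omega>. \<omega> \<in> space P \<Longrightarrow> X \<omega> = card {k. T k \<omega> \<le> t \<and> t < T k \<omega> + S k \<omega>}"
    using queue unfolding infinite_server_queue_def by auto
  have T [measurable]: "\<And>k. T k \<in> borel_measurable P"
    and Tpos: "AE \<omega> in P. 0 < T 0 \<omega>" and Tmono: "AE \<omega> in P. strict_mono (\<lambda>k. T k \<omega>)"
    and Tlim: "AE \<omega> in P. filterlim (\<lambda>k. T k \<omega>) at_top sequentially"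
    using cox by (auto simp: cox_process_def)
  have S_meas [measurable]: "S k \<in> borel_measurable P" for k
    using distributed_measurable[OF S, of k] by simp
  have X_meas [measurable]: "X \<in> measurable P (count_space UNIV)"
  proof -
    have "(\<lambda>\<omega>. card {k. T k \<omega> \<le> t \<and> t < T k \<omega> + S k \<omega>}) \<in> measurable P (count_space UNIV)"
      by measurable
    then show ?thesis by (subst measurable_cong[OF X])
  qed
  have [measurable]: "(\<lambda>x. r (snd x) (fst x)) \<in> borel_measurable (P \<Otimes>\<^sub>M lborel)"
    using r by (simp add: case_prod_beta')
  have R_meas [measurable]: "(\<lambda>\<omega>. LINT s:{u..v}|lborel. r s \<omega>) \<in> borel_measurable P" for u v
    unfolding set_lebesgue_integral_def
    by (intro lborel.borel_measurable_lebesgue_integral) (simp add: case_prod_beta')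
  have \<kappa>_meas [measurable]: "\<kappa> \<in> borel_measurable P"
    unfolding \<kappa>_def set_lebesgue_integral_def
    by (intro lborel.borel_measurable_lebesgue_integral) (simp add: case_prod_beta')
  have \<kappa>0: "AE \<omega> in P. 0 \<le> \<kappa> \<omega>"
    using r0 unfolding \<kappa>_def set_lebesgue_integral_def by eventually_elim (auto intro!: integral_nonneg_AE)
  have pS: "prob {\<omega> \<in> space P. b < S k \<omega>} = exp (- \<mu> * b)" if "0 \<le> b" for b k
    using exponential_distributedD_gt[OF S that mu, of k] by (simp add: mult.commute)

  define E where "E z u = (\<integral>\<^sup>+ \<omega>. ennreal (exp ((z - 1) * (exp u * \<kappa> \<omega>))) \<partial>P)" for z u
  have sandwich: "E z (\<mu> * h) \<le> (\<integral>\<^sup>+ \<omega>. ennreal (z ^ X \<omega>) \<partial>P)"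
      "(\<integral>\<^sup>+ \<omega>. ennreal (z ^ X \<omega>) \<partial>P) \<le> E z (- \<mu> * h)"
    if z: "0 \<le> z" "z \<le> 1" and h_def: "h = t / real m" and m: "0 < m" for z h m
  proof -
    have h: "0 < h" and hm: "real m * h = t" using t m by (auto simp: h_def)
    define c where "c i = real i * h" for i :: nat
    have c: "0 \<le> c 0" "mono c" and c0: "c 0 = 0" and cm: "c m = t"
      using h hm by (auto simp: c_def mono_def mult_right_mono)
    have cS: "c (Suc i) = c i + h" for i by (simp add: c_def algebra_simps)
    have ctS: "c (Suc i) \<le> t" if "i < m" for i using monoD[OF c(2), of "Suc i" m] that cm by simp
    have ct: "c i \<le> t" if "i \<le> m" for i using monoD[OF c(2) that] cm by simp
    define R where "R i \<omega> = (LINT s:{c i..c (Suc i)}|lborel. r s \<omega>)" for i \<omega>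
    have R0: "AE \<omega> in P. \<forall>i. 0 \<le> R i \<omega>"
      using r0 unfolding R_def set_lebesgue_integral_def by eventually_elim (auto intro!: integral_nonneg_AE)
    \<comment> \<open>the minimum keeps \<open>p i\<close> a probability for the grid points beyond \<open>t\<close>\<close>
    define p where "p i = min 1 (exp (- \<mu> * (t - c i)))" for i
    have p: "0 \<le> p i" "p i \<le> 1" for i by (auto simp: p_def)
    have p_eq: "p i = exp (- \<mu> * (t - c i))" if "i \<le> m" for i
      unfolding p_def using ct[OF that] mu by (intro min_absorb2) simp
    have pS_eq: "p (Suc i) = exp (\<mu> * h) * p i" if "i < m" for i
      using that by (simp add: p_eq cS algebra_simps flip: exp_add)
    define Y where "Y b \<omega> = card {k. \<exists>i<m. T k \<omega> \<in> {c i<..c (Suc i)} \<and> b i < S k \<omega>}" for b \<omega>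
    have gf: "(\<integral>\<^sup>+ \<omega>. ennreal (z ^ Y b \<omega>) \<partial>P) = (\<integral>\<^sup>+ \<omega>. ennreal (exp ((z - 1) * (\<Sum>i<m. q i * R i \<omega>))) \<partial>P)"
      if "\<And>i k. i < m \<Longrightarrow> prob {\<omega> \<in> space P. b i < S k \<omega>} = q i" "\<And>i. 0 \<le> q i" "\<And>i. q i \<le> 1" for b q
      unfolding Y_def R_def
      by (rule thinned_cox_generating_function[OF P sub cox indS TS that c R_meas _ z])
         (use R0 in \<open>simp_all add: R_def\<close>)
    define lo hi where "lo = (\<lambda>i. t - c i)" and "hi = (\<lambda>i. t - c (Suc i))"
    have gf_lo: "(\<integral>\<^sup>+ \<omega>. ennreal (z ^ Y lo \<omega>) \<partial>P) = (\<integral>\<^sup>+ \<omega>. ennreal (exp ((z - 1) * (\<Sum>i<m. p i * R i \<omega>))) \<partial>P)"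
      by (rule gf) (use ct in \<open>auto simp: lo_def pS p_eq p less_imp_le\<close>)
    have gf_hi: "(\<integral>\<^sup>+ \<omega>. ennreal (z ^ Y hi \<omega>) \<partial>P)
        = (\<integral>\<^sup>+ \<omega>. ennreal (exp ((z - 1) * (\<Sum>i<m. p (Suc i) * R i \<omega>))) \<partial>P)"
      by (rule gf) (use ct in \<open>auto simp: hi_def pS p_eq p\<close>)

    have count: "AE \<omega> in P. Y lo \<omega> \<le> X \<omega> \<and> X \<omega> \<le> Y hi \<omega>"
      using Tpos Tmono Tlim AE_space
    proof eventually_elim
      case (elim \<omega>)
      have pos: "0 < T k \<omega>" for k
        using elim(1) strict_mono_less_eq[OF elim(2), of 0 k] by simp
      show ?case
        using present_count_sandwich[where \<tau> = "\<lambda>k. T k \<omega>" and \<sigma> = "\<lambda>k. S k \<omega>", OF pos elim(3) h m hm[symmetric]]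
        unfolding Y_def X[OF elim(4)] lo_def hi_def c_def by blast
    qed
    have weight: "AE \<omega> in P. (\<Sum>i<m. p i * R i \<omega>) \<le> \<kappa> \<omega> \<and> \<kappa> \<omega> \<le> exp (\<mu> * h) * (\<Sum>i<m. p i * R i \<omega>)"
      using r0 int
    proof eventually_elim
      case (elim \<omega>)
      then have "\<forall>s. 0 \<le> r s \<omega>" by simp
      from discounted_integral_grid_bounds[OF elim(2) spec[OF this] mu h hm[symmetric]]
      show ?case by (simp add: \<kappa>_def R_def p_eq c_def)
    qed
    have e1: "exp (\<mu> * h) * exp (- \<mu> * h) = 1" by (simp flip: exp_add)
    have "E z (\<mu> * h) \<le> (\<integral>\<^sup>+ \<omega>. ennreal (z ^ Y hi \<omega>) \<partial>P)"
      unfolding gf_hi E_def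
    proof (intro nn_integral_mono_AE, use weight in eventually_elim)
      fix \<omega> assume "(\<Sum>i<m. p i * R i \<omega>) \<le> \<kappa> \<omega> \<and> \<kappa> \<omega> \<le> exp (\<mu> * h) * (\<Sum>i<m. p i * R i \<omega>)"
      then have "(z - 1) * (exp (\<mu> * h) * \<kappa> \<omega>) \<le> (z - 1) * (exp (\<mu> * h) * (\<Sum>i<m. p i * R i \<omega>))"
        using z by (intro mult_left_mono_neg mult_left_mono) auto
      also have "exp (\<mu> * h) * (\<Sum>i<m. p i * R i \<omega>) = (\<Sum>i<m. p (Suc i) * R i \<omega>)"
        by (simp add: sum_distrib_left pS_eq mult.assoc)
      finally show "ennreal (exp ((z - 1) * (exp (\<mu> * h) * \<kappa> \<omega>)))
          \<le> ennreal (exp ((z - 1) * (\<Sum>i<m. p (Suc i) * R i \<omega>)))" by (simp add: ennreal_leI)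
    qed
    also have "\<dots> \<le> (\<integral>\<^sup>+ \<omega>. ennreal (z ^ X \<omega>) \<partial>P)"
      using z by (intro nn_integral_mono_AE, use count in eventually_elim)
        (auto intro!: ennreal_leI power_decreasing)
    finally show "E z (\<mu> * h) \<le> (\<integral>\<^sup>+ \<omega>. ennreal (z ^ X \<omega>) \<partial>P)" .
    have "(\<integral>\<^sup>+ \<omega>. ennreal (z ^ X \<omega>) \<partial>P) \<le> (\<integral>\<^sup>+ \<omega>. ennreal (z ^ Y lo \<omega>) \<partial>P)"
      using z by (intro nn_integral_mono_AE, use count in eventually_elim)
        (auto intro!: ennreal_leI power_decreasing)
    also have "\<dots> \<le> E z (- \<mu> * h)"
      unfolding gf_lo E_def
    proof (intro nn_integral_mono_AE, use weight in eventually_elim)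
      fix \<omega> assume *: "(\<Sum>i<m. p i * R i \<omega>) \<le> \<kappa> \<omega> \<and> \<kappa> \<omega> \<le> exp (\<mu> * h) * (\<Sum>i<m. p i * R i \<omega>)"
      have "exp (- \<mu> * h) * \<kappa> \<omega> \<le> exp (- \<mu> * h) * (exp (\<mu> * h) * (\<Sum>i<m. p i * R i \<omega>))"
        using * by (intro mult_left_mono) auto
      also have "\<dots> = (\<Sum>i<m. p i * R i \<omega>)" using e1 by (simp add: mult_ac)
      finally have "(z - 1) * (\<Sum>i<m. p i * R i \<omega>) \<le> (z - 1) * (exp (- \<mu> * h) * \<kappa> \<omega>)"
        using z by (intro mult_left_mono_neg) auto
      then show "ennreal (exp ((z - 1) * (\<Sum>i<m. p i * R i \<omega>)))
          \<le> ennreal (exp ((z - 1) * (exp (- \<mu> * h) * \<kappa> \<omega>)))" by (simp add: ennreal_leI)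
    qed
    finally show "(\<integral>\<^sup>+ \<omega>. ennreal (z ^ X \<omega>) \<partial>P)
      \<le> E z (- \<mu> * h)" .
  qed

  show ?thesis
    unfolding \<kappa>_def[symmetric]
  proof (rule mixed_poissonI_generating_function[OF P X_meas \<kappa>_meas \<kappa>0])
    fix z :: real assume z: "0 \<le> z" "z \<le> 1"
    have lim: "(\<lambda>n. E z (u * (t / real (Suc n)))) \<longlonglongrightarrow> (\<integral>\<^sup>+ \<omega>. ennreal (exp ((z - 1) * \<kappa> \<omega>)) \<partial>P)" for u
      unfolding E_def
    proof (rule nn_integral_dominated_convergence[where w = "\<lambda>_. 1"])
      show "AE \<omega> in P. ennreal (exp ((z - 1) * (exp (u * (t / real (Suc n))) * \<kappa> \<omega>))) \<le> 1" for n
        using \<kappa>0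
      proof eventually_elim
        fix \<omega> assume "0 \<le> \<kappa> \<omega>"
        then have "(z - 1) * (exp (u * (t / real (Suc n))) * \<kappa> \<omega>) \<le> 0"
          using z by (intro mult_nonpos_nonneg) auto
        then show "ennreal (exp ((z - 1) * (exp (u * (t / real (Suc n))) * \<kappa> \<omega>))) \<le> 1"
          by simp
      qed
      show "AE \<omega> in P. (\<lambda>n. ennreal (exp ((z - 1) * (exp (u * (t / real (Suc n))) * \<kappa> \<omega>))))
          \<longlonglongrightarrow> ennreal (exp ((z - 1) * \<kappa> \<omega>))"
      proof (intro AE_I2 tendsto_ennrealI)
        fix \<omega>
        have "(\<lambda>n. t / real (Suc n)) \<longlonglongrightarrow> 0"
          using LIMSEQ_Suc[OF lim_const_over_n[of t]] by simp
        then have "(\<lambda>n. exp ((z - 1) * (exp (u * (t / real (Suc n))) * \<kappa> \<omega>)))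
            \<longlonglongrightarrow> exp ((z - 1) * (exp (u * 0) * \<kappa> \<omega>))"
          by (intro tendsto_intros)
        then show "(\<lambda>n. exp ((z - 1) * (exp (u * (t / real (Suc n))) * \<kappa> \<omega>)))
            \<longlonglongrightarrow> exp ((z - 1) * \<kappa> \<omega>)" by simp
      qed
    qed (auto simp: emeasure_space_1)
    show "(\<integral>\<^sup>+ \<omega>. ennreal (z ^ X \<omega>) \<partial>P) = (\<integral>\<^sup>+ \<omega>. ennreal (exp ((z - 1) * \<kappa> \<omega>)) \<partial>P)"
    proof (rule antisym)
      show "(\<integral>\<^sup>+ \<omega>. ennreal (z ^ X \<omega>) \<partial>P) \<le> (\<integral>\<^sup>+ \<omega>. ennreal (exp ((z - 1) * \<kappa> \<omega>)) \<partial>P)"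
        by (rule LIMSEQ_le_const[OF lim[of "- \<mu>"]], intro exI allI impI, rule sandwich(2)[OF z refl]) simp
      show "(\<integral>\<^sup>+ \<omega>. ennreal (exp ((z - 1) * \<kappa> \<omega>)) \<partial>P) \<le> (\<integral>\<^sup>+ \<omega>. ennreal (z ^ X \<omega>) \<partial>P)"
        by (rule LIMSEQ_le_const2[OF lim[of \<mu>]], intro exI allI impI, rule sandwich(1)[OF z refl]) simp
    qed
  qed
qed

section \<open>Cumulant generating functions\<close>

text \<open>Negative logarithms are cut off at 0. The arguments below are moment generating functions of
  nonnegative variables at nonnegative points, hence at least 1.\<close>

definition ennlog :: "ennreal \<Rightarrow> ennreal" where
  "ennlog x = e2ennreal (elog x)"

lemma ennlog_ennreal: "1 \<le> x \<Longrightarrow> ennlog (ennreal x) = ennreal (ln x)"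
  by (auto simp: ennlog_def elog_def)

lemma ennlog_top [simp]: "ennlog top = top"
  by (simp add: ennlog_def elog_def)

lemma ennreal_ge_1_cases [case_names real top]:
  assumes "1 \<le> (x :: ennreal)"
  obtains r where "x = ennreal r" "1 \<le> r" | "x = top"
  using assms by (cases x) auto

lemma ennlog_mono:
  assumes "1 \<le> x" "x \<le> y" shows "ennlog x \<le> ennlog y"
proof -
  from assms have "1 \<le> y" by simp
  with assms(1) show ?thesis
    using assms(2)
    by (elim ennreal_ge_1_cases) (auto simp: ennlog_ennreal ennreal_leI top_unique)
qed

lemma ennlog_mult:
  assumes "1 \<le> x" "1 \<le> y" shows "ennlog (x * y) = ennlog x + ennlog y"
proof (cases "x = top \<or> y = top")
  case True
  have "x \<noteq> 0" "y \<noteq> 0" using assms by auto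
  then show ?thesis using True by (auto simp: ennreal_mult_eq_top_iff ennreal_mult_top ennreal_top_mult)
next
  case False
  then obtain r s where "x = ennreal r" "1 \<le> r" "y = ennreal s" "1 \<le> s"
    using assms by (metis ennreal_ge_1_cases)
  moreover from this have "1 \<le> r * s" using mult_mono[of 1 r 1 s] by simp
  ultimately show ?thesis
    by (simp add: ennlog_ennreal ln_mult flip: ennreal_mult ennreal_plus)
qed

lemma ennlog_prod:
  assumes "\<And>j. j \<in> J \<Longrightarrow> 1 \<le> x j" shows "ennlog (\<Prod>j\<in>J. x j) = (\<Sum>j\<in>J. ennlog (x j))"
  using assms
proof (induction J rule: infinite_finite_induct)
  case (insert j J)
  have "1 \<le> (\<Prod>j\<in>J. x j)" using insert by (intro prod_ge_1) auto
  then show ?case using insert by (simp add: ennlog_mult)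
qed (auto simp: ennlog_ennreal[of 1, simplified])

lemma exp_ennlog:
  assumes "1 \<le> x" "ennlog x \<noteq> top" shows "x = ennreal (exp (enn2real (ennlog x)))"
  using assms by (cases x rule: ennreal_ge_1_cases) (auto simp: ennlog_ennreal)

lemma ennlog_le_iff:
  assumes "1 \<le> x" "0 \<le> c" shows "ennlog x \<le> ennreal c \<longleftrightarrow> x \<le> ennreal (exp c)"
  using assms
proof (cases x rule: ennreal_ge_1_cases)
  case (real r)
  then have "ln r \<le> c \<longleftrightarrow> r \<le> exp c" using ln_ge_iff[of r] by (metis exp_le_cancel_iff exp_ln less_le_trans zero_less_one)
  with real show ?thesis using assms by (simp add: ennlog_ennreal)
qed (auto simp: top_unique)

lemma ennlog_measurable [measurable]: "ennlog \<in> borel_measurable borel"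
  unfolding ennlog_def elog_def by measurable

definition cgf :: "'a measure \<Rightarrow> ('a \<Rightarrow> real) \<Rightarrow> real \<Rightarrow> ennreal" where
  "cgf P X v = ennlog (mgf P X v)"

locale nonneg_rv = prob_space P for P :: "'a measure" +
  fixes X :: "'a \<Rightarrow> real"
  assumes X_measurable [measurable]: "X \<in> borel_measurable P"
    and X_nonneg: "AE \<omega> in P. 0 \<le> X \<omega>"
begin

lemma mgf_mono: "v \<le> v' \<Longrightarrow> mgf P X v \<le> mgf P X v'"
  unfolding mgf_def
  by (intro nn_integral_mono_AE, use X_nonneg in eventually_elim) (auto intro!: ennreal_leI mult_right_mono)

lemma mgf_0: "mgf P X 0 = 1"
  by (simp add: mgf_def emeasure_space_1)

lemma mgf_ge_1: "0 \<le> v \<Longrightarrow> 1 \<le> mgf P X v"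
  using mgf_mono[of 0 v] by (simp add: mgf_0)

lemma cgf_0: "cgf P X 0 = 0"
  using ennlog_ennreal[of 1] by (simp add: cgf_def mgf_0)

lemma cgf_mono: "0 \<le> v \<Longrightarrow> v \<le> v' \<Longrightarrow> cgf P X v \<le> cgf P X v'"
  unfolding cgf_def by (intro ennlog_mono mgf_ge_1 mgf_mono)

lemma mgf_eq_exp_cgf: "0 \<le> v \<Longrightarrow> cgf P X v \<noteq> top \<Longrightarrow> mgf P X v = ennreal (exp (enn2real (cgf P X v)))"
  unfolding cgf_def by (intro exp_ennlog mgf_ge_1)

lemma cgf_le_iff: "0 \<le> v \<Longrightarrow> 0 \<le> c \<Longrightarrow> cgf P X v \<le> ennreal c \<longleftrightarrow> mgf P X v \<le> ennreal (exp c)"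
  unfolding cgf_def by (intro ennlog_le_iff mgf_ge_1)

text \<open>Convexity of the cumulant generating function along a ray. It treats the incomplete last slot: a
  slot of length \<open>r * \<delta>\<close> counts at most \<open>r\<close> times as much as a full one.\<close>

lemma cgf_mult_le:
  assumes r: "0 \<le> r" "r \<le> 1" and v: "0 \<le> v"
  shows "cgf P X (r * v) \<le> ennreal r * cgf P X v"
proof (cases "r = 0 \<or> cgf P X v = top")
  case True
  then show ?thesis using r by (auto simp: cgf_0 ennreal_mult_top)
next
  case False
  define c where "c = enn2real (cgf P X v)"
  have c: "cgf P X v = ennreal c" "0 \<le> c" using False by (auto simp: c_def less_top)
  have m: "mgf P X v = ennreal (exp c)" using mgf_eq_exp_cgf[OF v] False by (simp add: c_def)
  have "mgf P X (r * v) \<le> (\<integral>\<^sup>+ \<omega>. ennreal (exp ((r - 1) * c)) * (ennreal r * ennreal (exp (v * X \<omega>)) + ennreal ((1 - r) * exp c)) \<partial>P)"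
    unfolding mgf_def
  proof (intro nn_integral_mono)
    fix \<omega>
    have "exp (v * X \<omega>) powr r * exp c powr (1 - r) \<le> r * exp (v * X \<omega>) + (1 - r) * exp c"
      using r by (intro Youngs_inequality_0) auto
    then have "exp ((r - 1) * c) * (exp (r * (v * X \<omega>)) * exp ((1 - r) * c))
        \<le> exp ((r - 1) * c) * (r * exp (v * X \<omega>) + (1 - r) * exp c)"
      by (intro mult_left_mono) (auto simp: exp_powr_real mult.commute)
    moreover have "exp ((r - 1) * c) * (exp (r * (v * X \<omega>)) * exp ((1 - r) * c)) = exp (r * v * X \<omega>)"
      by (simp add: algebra_simps flip: exp_add)
    ultimately have "ennreal (exp (r * v * X \<omega>)) \<le> ennreal (exp ((r - 1) * c) * (r * exp (v * X \<omega>) + (1 - r) * exp c))"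
      by (intro ennreal_leI) simp
    then show "ennreal (exp (r * v * X \<omega>)) \<le> ennreal (exp ((r - 1) * c))
        * (ennreal r * ennreal (exp (v * X \<omega>)) + ennreal ((1 - r) * exp c))"
      using r by (simp add: ennreal_mult ennreal_plus)
  qed
  also have "\<dots> = ennreal (exp ((r - 1) * c)) * (ennreal r * mgf P X v + ennreal ((1 - r) * exp c))"
    unfolding mgf_def
    by (simp add: nn_integral_cmult nn_integral_add emeasure_space_1)
  also have "\<dots> = ennreal (exp ((r - 1) * c) * exp c)"
    using r by (simp add: m algebra_simps flip: ennreal_mult ennreal_plus)
  also have "\<dots> = ennreal (exp (r * c))" by (simp add: algebra_simps flip: exp_add)
  finally have "cgf P X (r * v) \<le> ennreal (r * c)"
    using r v c by (subst cgf_le_iff) auto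
  then show ?thesis using r c by (simp add: ennreal_mult)
qed

lemma mgf_measurable [measurable]: "mgf P X \<in> borel_measurable borel"
  unfolding mgf_def by measurable

lemma cgf_measurable [measurable]: "cgf P X \<in> borel_measurable borel"
  unfolding cgf_def by measurable

end

locale bounded_rv = nonneg_rv +
  fixes K :: real
  assumes X_le: "AE \<omega> in P. X \<omega> \<le> K" and K_nonneg: "0 \<le> K"
begin

lemma mgf_le_shift:
  assumes "v \<le> v'" shows "mgf P X v' \<le> ennreal (exp (K * (v' - v))) * mgf P X v"
proof -
  have "mgf P X v' \<le> (\<integral>\<^sup>+ \<omega>. ennreal (exp (K * (v' - v))) * ennreal (exp (v * X \<omega>)) \<partial>P)"
    unfolding mgf_def
  proof (intro nn_integral_mono_AE, use X_le in eventually_elim)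
    fix \<omega> assume "X \<omega> \<le> K"
    then have "(v' - v) * X \<omega> \<le> (v' - v) * K" using assms by (intro mult_left_mono) auto
    then have "exp (v' * X \<omega>) \<le> exp (K * (v' - v)) * exp (v * X \<omega>)"
      by (simp add: algebra_simps flip: exp_add)
    then show "ennreal (exp (v' * X \<omega>)) \<le> ennreal (exp (K * (v' - v))) * ennreal (exp (v * X \<omega>))"
      by (simp add: ennreal_leI flip: ennreal_mult)
  qed
  also have "\<dots> = ennreal (exp (K * (v' - v))) * mgf P X v"
    unfolding mgf_def by (intro nn_integral_cmult) auto
  finally show ?thesis .
qed

lemma cgf_le_shift:
  assumes "0 \<le> v" "v \<le> v'" shows "cgf P X v' \<le> ennreal (K * (v' - v)) + cgf P X v"
proof -
  have 1: "1 \<le> exp (K * (v' - v))" using assms K_nonneg by simp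
  have "cgf P X v' \<le> ennlog (ennreal (exp (K * (v' - v))) * mgf P X v)"
    unfolding cgf_def using assms by (intro ennlog_mono mgf_ge_1 mgf_le_shift) auto
  also have "\<dots> = ennreal (K * (v' - v)) + cgf P X v"
    using 1 assms unfolding cgf_def by (subst ennlog_mult) (auto simp: mgf_ge_1 ennlog_ennreal)
  finally show ?thesis .
qed

lemma cgf_le: "0 \<le> v \<Longrightarrow> cgf P X v \<le> ennreal (K * v)"
  using cgf_le_shift[of 0 v] by (simp add: cgf_0)

end

lemma mgf_weighted_sum:
  assumes P: "prob_space P" and ind: "prob_space.indep_vars P (\<lambda>_. borel) L (UNIV :: nat set)"
    and X [measurable]: "X \<in> borel_measurable P"
    and copies: "\<And>j. distr P borel (L j) = distr P borel X"
  shows "mgf P (\<lambda>\<omega>. \<Sum>j<n. w j * L j \<omega>) v = (\<Prod>j<n. mgf P X (v * w j))"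
proof -
  interpret prob_space P by fact
  have L [measurable]: "L j \<in> borel_measurable P" for j using ind by (auto simp: indep_vars_def)
  have "mgf P (\<lambda>\<omega>. \<Sum>j<n. w j * L j \<omega>) v = (\<integral>\<^sup>+ \<omega>. (\<Prod>j<n. ennreal (exp (v * w j * L j \<omega>))) \<partial>P)"
    unfolding mgf_def by (simp add: sum_distrib_left exp_sum prod_ennreal mult.assoc)
  also have "\<dots> = (\<Prod>j<n. \<integral>\<^sup>+ \<omega>. ennreal (exp (v * w j * L j \<omega>)) \<partial>P)"
    by (rule indep_vars_nn_integral)
       (auto intro!: indep_vars_compose2[OF indep_vars_subset[OF ind], where Y = "\<lambda>j x. ennreal (exp (v * w j * x))"])
  also have "\<dots> = (\<Prod>j<n. mgf P X (v * w j))"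
  proof (rule prod.cong[OF refl])
    fix j
    have "(\<integral>\<^sup>+ \<omega>. ennreal (exp (v * w j * L j \<omega>)) \<partial>P) = (\<integral>\<^sup>+ x. ennreal (exp (v * w j * x)) \<partial>distr P borel (L j))"
      by (subst nn_integral_distr) auto
    then show "(\<integral>\<^sup>+ \<omega>. ennreal (exp (v * w j * L j \<omega>)) \<partial>P) = mgf P X (v * w j)"
      unfolding copies mgf_def by (simp add: nn_integral_distr)
  qed
  finally show ?thesis .
qed

lemma cgf_weighted_sum:
  assumes X: "nonneg_rv P X" and ind: "prob_space.indep_vars P (\<lambda>_. borel) L (UNIV :: nat set)"
    and copies: "\<And>j. distr P borel (L j) = distr P borel X"
    and w: "\<And>j. 0 \<le> w j" and v: "0 \<le> v"
  shows "cgf P (\<lambda>\<omega>. \<Sum>j<n. w j * L j \<omega>) v = (\<Sum>j<n. cgf P X (v * w j))"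
proof -
  interpret nonneg_rv P X by fact
  have "cgf P (\<lambda>\<omega>. \<Sum>j<n. w j * L j \<omega>) v = ennlog (\<Prod>j<n. mgf P X (v * w j))"
    unfolding cgf_def by (subst mgf_weighted_sum[OF prob_space_axioms ind X_measurable copies]) simp
  also have "\<dots> = (\<Sum>j<n. cgf P X (v * w j))"
    unfolding cgf_def using v w by (intro ennlog_prod mgf_ge_1) auto
  finally show ?thesis .
qed

section \<open>Slots and the Riemann sum of the cumulants\<close>

definition slot :: "real \<Rightarrow> real \<Rightarrow> nat \<Rightarrow> real set" where
  "slot t \<delta> j = {0..t} \<inter> {real j * \<delta>..<(real j + 1) * \<delta>}"

definition slot_weight :: "(real \<Rightarrow> real) \<Rightarrow> real \<Rightarrow> real \<Rightarrow> nat \<Rightarrow> real" where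
  "slot_weight h t \<delta> j = (LINT s:slot t \<delta> j|lborel. h s)"

text \<open>The successor accounts for the incomplete last slot. It consists of the point \<open>t\<close> alone if \<open>t\<close> is a
  multiple of \<open>\<delta>\<close>.\<close>

definition n_slots :: "real \<Rightarrow> real \<Rightarrow> nat" where
  "n_slots t \<delta> = Suc (nat \<lfloor>t / \<delta>\<rfloor>)"

definition cgf_integral :: "'a measure \<Rightarrow> ('a \<Rightarrow> real) \<Rightarrow> (real \<Rightarrow> real) \<Rightarrow> real \<Rightarrow> real \<Rightarrow> ennreal" where
  "cgf_integral P X h t \<theta> = (\<integral>\<^sup>+ s. cgf P X (\<theta> * h s) * indicator {0..t} s \<partial>lborel)"

lemma slot_sets [measurable]: "slot t \<delta> j \<in> sets borel"
  by (simp add: slot_def)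

lemma slot_subset: "slot t \<delta> j \<subseteq> {0..t}"
  by (auto simp: slot_def)

lemma emeasure_slot_le: "0 < \<delta> \<Longrightarrow> emeasure lborel (slot t \<delta> j) \<le> ennreal \<delta>"
proof -
  assume d: "0 < \<delta>"
  have "emeasure lborel (slot t \<delta> j) \<le> emeasure lborel {real j * \<delta>..<(real j + 1) * \<delta>}"
    by (intro emeasure_mono) (auto simp: slot_def)
  also have "\<dots> = ennreal \<delta>" using d by (simp add: algebra_simps)
  finally show ?thesis .
qed

lemma emeasure_slot: "0 < \<delta> \<Longrightarrow> emeasure lborel (slot t \<delta> j) = ennreal (measure lborel (slot t \<delta> j))"
  using emeasure_slot_le[of \<delta> t j] by (intro emeasure_eq_ennreal_measure) (auto simp: top_unique)

lemma measure_slot_le: "0 < \<delta> \<Longrightarrow> measure lborel (slot t \<delta> j) \<le> \<delta>"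
  using emeasure_slot_le[of \<delta> t j] by (simp add: emeasure_slot)

lemma full_slot: "0 < \<delta> \<Longrightarrow> j < nat \<lfloor>t / \<delta>\<rfloor> \<Longrightarrow> slot t \<delta> j = {real j * \<delta>..<(real j + 1) * \<delta>}"
proof -
  assume d: "0 < \<delta>" and j: "j < nat \<lfloor>t / \<delta>\<rfloor>"
  have "real j + 1 \<le> t / \<delta>" using j by linarith
  then have "(real j + 1) * \<delta> \<le> t" using d by (simp add: pos_le_divide_eq)
  moreover have "0 \<le> real j * \<delta>" using d by simp
  ultimately show ?thesis by (auto simp: slot_def)
qed

lemma n_slots_gt: "0 < \<delta> \<Longrightarrow> 0 \<le> t \<Longrightarrow> t < real (n_slots t \<delta>) * \<delta>"
proof -
  assume d: "0 < \<delta>" "0 \<le> t"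
  have "t / \<delta> < real (n_slots t \<delta>)"
    using d unfolding n_slots_def by (simp add: less_floor_iff) linarith
  then show ?thesis using d by (simp add: pos_divide_less_eq)
qed

lemma slot_unique: "0 < \<delta> \<Longrightarrow> s \<in> slot t \<delta> j \<longleftrightarrow> 0 \<le> s \<and> s \<le> t \<and> j = nat \<lfloor>s / \<delta>\<rfloor>"
proof -
  assume d: "0 < \<delta>"
  have "j = nat \<lfloor>s / \<delta>\<rfloor> \<longleftrightarrow> real j * \<delta> \<le> s \<and> s < (real j + 1) * \<delta>" if "0 \<le> s"
  proof -
    have "j = nat \<lfloor>s / \<delta>\<rfloor> \<longleftrightarrow> int j = \<lfloor>s / \<delta>\<rfloor>" using that d by auto
    also have "\<dots> \<longleftrightarrow> real j \<le> s / \<delta> \<and> s / \<delta> < real j + 1" by (auto simp: floor_eq_iff eq_commute[of "int j"])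
    finally show ?thesis using d by (simp add: pos_le_divide_eq pos_divide_less_eq)
  qed
  then show ?thesis by (auto simp: slot_def)
qed

lemma sum_indicator_slots:
  assumes d: "0 < \<delta>" and t: "0 \<le> t"
  shows "(\<Sum>j<n_slots t \<delta>. indicator (slot t \<delta> j) s) = (indicator {0..t} s :: 'b :: {comm_monoid_add, zero_neq_one})"
proof (cases "s \<in> {0..t}")
  case True
  then have "s / \<delta> \<le> t / \<delta>" using d by (intro divide_right_mono) auto
  then have "nat \<lfloor>s / \<delta>\<rfloor> < n_slots t \<delta>"
    unfolding n_slots_def less_Suc_eq_le by (intro nat_mono floor_mono)
  then show ?thesis using True d
    by (subst sum.remove[of _ "nat \<lfloor>s / \<delta>\<rfloor>"]) (auto simp: slot_unique indicator_def)
next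
  case False
  then have "s \<notin> slot t \<delta> j" for j using slot_subset[of t \<delta> j] by blast
  then show ?thesis using False by simp
qed

lemma cgf_integral_slots:
  assumes X: "nonneg_rv P X" and h [measurable]: "h \<in> borel_measurable borel" and d: "0 < \<delta>" and t: "0 \<le> t"
  shows "cgf_integral P X h t \<theta>
    = (\<Sum>j<n_slots t \<delta>. \<integral>\<^sup>+ s. cgf P X (\<theta> * h s) * indicator (slot t \<delta> j) s \<partial>lborel)"
proof -
  interpret nonneg_rv P X by fact
  have "(\<Sum>j<n_slots t \<delta>. \<integral>\<^sup>+ s. cgf P X (\<theta> * h s) * indicator (slot t \<delta> j) s \<partial>lborel)
     = (\<integral>\<^sup>+ s. (\<Sum>j<n_slots t \<delta>. cgf P X (\<theta> * h s) * indicator (slot t \<delta> j) s) \<partial>lborel)"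
    by (intro nn_integral_sum[symmetric]) auto
  then show ?thesis
    unfolding cgf_integral_def by (simp add: sum_indicator_slots[OF d t] flip: sum_distrib_left)
qed

text \<open>The slow variation \<open>h_ratio\<close> is shared by \<open>exp (- \<mu> s)\<close> and \<open>exp (- \<mu> (t - s))\<close>. With it, values in one
  slot differ by a factor of at most \<open>exp (\<mu> * \<delta>)\<close>, which is absorbed into \<open>\<theta>\<close>.\<close>

locale discount =
  fixes h :: "real \<Rightarrow> real" and \<mu> t :: real
  assumes h_cont: "continuous_on UNIV h" and h_pos: "\<And>s. 0 < h s"
    and h_le_1: "\<And>s. s \<in> {0..t} \<Longrightarrow> h s \<le> 1"
    and h_ratio: "\<And>s s'. h s \<le> exp (\<mu> * \<bar>s - s'\<bar>) * h s'"
    and mu: "0 < \<mu>" and t: "0 < t"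
begin

lemma h_measurable [measurable]: "h \<in> borel_measurable borel"
  using h_cont by (rule borel_measurable_continuous_onI)

lemma h_integrable: "set_integrable lborel (slot t \<delta> j) h"
  by (rule set_integrable_subset[OF borel_integrable_atLeastAtMost' _ slot_subset])
     (auto intro: continuous_on_subset[OF h_cont])

lemma set_integral_const_slot: "0 < \<delta> \<Longrightarrow> (LINT s:slot t \<delta> j|lborel. c) = measure lborel (slot t \<delta> j) * (c :: real)"
  by (subst set_integral_const) (auto simp: emeasure_slot)

lemma set_integrable_const_slot: "0 < \<delta> \<Longrightarrow> set_integrable lborel (slot t \<delta> j) (\<lambda>_. c :: real)"
  unfolding set_integrable_def
  by (intro integrable_scaleR_left) (auto simp: emeasure_slot intro!: integrable_real_indicator)

lemma slot_weight_nonneg: "0 \<le> slot_weight h t \<delta> j"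
  unfolding slot_weight_def set_lebesgue_integral_def
  by (intro integral_nonneg_AE) (auto simp: less_imp_le[OF h_pos])

lemma slot_weight_le:
  assumes d: "0 < \<delta>" and s: "s \<in> slot t \<delta> j"
  shows "slot_weight h t \<delta> j \<le> measure lborel (slot t \<delta> j) * (exp (\<mu> * \<delta>) * h s)"
proof -
  have "slot_weight h t \<delta> j \<le> (LINT s':slot t \<delta> j|lborel. exp (\<mu> * \<delta>) * h s)"
    unfolding slot_weight_def
  proof (intro set_integral_mono h_integrable set_integrable_const_slot[OF d])
    fix s' assume s': "s' \<in> slot t \<delta> j"
    have "\<bar>s' - s\<bar> \<le> \<delta>" using s s' by (auto simp: slot_def algebra_simps)
    then have "exp (\<mu> * \<bar>s' - s\<bar>) \<le> exp (\<mu> * \<delta>)" using mu by simp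
    then show "h s' \<le> exp (\<mu> * \<delta>) * h s"
      using h_ratio[of s' s] mult_right_mono[OF _ less_imp_le[OF h_pos[of s]]] by fastforce
  qed
  then show ?thesis by (simp only: set_integral_const_slot[OF d])
qed

lemma slot_weight_ge:
  assumes d: "0 < \<delta>" and s: "s \<in> slot t \<delta> j"
  shows "measure lborel (slot t \<delta> j) * (exp (- \<mu> * \<delta>) * h s) \<le> slot_weight h t \<delta> j"
proof -
  have "(LINT s':slot t \<delta> j|lborel. exp (- \<mu> * \<delta>) * h s) \<le> slot_weight h t \<delta> j"
    unfolding slot_weight_def
  proof (intro set_integral_mono h_integrable set_integrable_const_slot[OF d])
    fix s' assume s': "s' \<in> slot t \<delta> j"
    have "\<bar>s - s'\<bar> \<le> \<delta>" using s s' by (auto simp: slot_def algebra_simps)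
    then have "exp (\<mu> * \<bar>s - s'\<bar>) \<le> exp (\<mu> * \<delta>)" using mu by simp
    then have "h s \<le> exp (\<mu> * \<delta>) * h s'"
      using h_ratio[of s s'] mult_right_mono[OF _ less_imp_le[OF h_pos[of s']]] by fastforce
    then have "exp (- \<mu> * \<delta>) * h s \<le> exp (- \<mu> * \<delta>) * (exp (\<mu> * \<delta>) * h s')" by (intro mult_left_mono) auto
    then show "exp (- \<mu> * \<delta>) * h s \<le> h s'" by (simp flip: exp_add mult.assoc)
  qed
  then show ?thesis by (simp only: set_integral_const_slot[OF d])
qed

text \<open>The factor \<open>exp (- \<mu> * \<delta>)\<close> makes the argument at most \<open>\<theta> * h s\<close> for every \<open>s\<close> in the slot, times the
  filled proportion of the slot. Thus the comparison with the integral needs only monotonicity and,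
  for an incomplete slot, convexity along a ray. It survives a singularity of the integrand at the end of the interval.\<close>

lemma slot_cgf_le:
  assumes X: "nonneg_rv P X" and d: "0 < \<delta>" and th: "0 \<le> \<theta>"
  shows "ennreal \<delta> * cgf P X (\<theta> * exp (- \<mu> * \<delta>) / \<delta> * slot_weight h t \<delta> j)
       \<le> (\<integral>\<^sup>+ s. cgf P X (\<theta> * h s) * indicator (slot t \<delta> j) s \<partial>lborel)"
proof -
  interpret nonneg_rv P X by fact
  define r where "r = measure lborel (slot t \<delta> j)"
  define v where "v = \<theta> * exp (- \<mu> * \<delta>) / \<delta> * slot_weight h t \<delta> j"
  have v0: "0 \<le> v" using th d slot_weight_nonneg by (simp add: v_def)
  have r: "0 \<le> r" "r \<le> \<delta>" using measure_slot_le[OF d] by (auto simp: r_def)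
  show ?thesis
  proof (cases "r = 0")
    case True
    have "slot_weight h t \<delta> j = 0"
    proof (cases "slot t \<delta> j = {}")
      case False
      then obtain s where "s \<in> slot t \<delta> j" by auto
      from slot_weight_le[OF d this] slot_weight_nonneg[of \<delta> j] True show ?thesis by (simp add: r_def)
    qed (simp add: slot_weight_def set_lebesgue_integral_def)
    then show ?thesis by (simp add: cgf_0)
  next
    case False
    then have r0: "0 < r" using r by simp
    have "ennreal \<delta> * cgf P X v = ennreal r * (ennreal (\<delta> / r) * cgf P X v)"
      using r0 d by (simp add: mult.assoc[symmetric] flip: ennreal_mult)
    also have "\<dots> = (\<integral>\<^sup>+ s. (ennreal (\<delta> / r) * cgf P X v) * indicator (slot t \<delta> j) s \<partial>lborel)"
      using d by (subst nn_integral_cmult_indicator) (auto simp: emeasure_slot r_def mult.commute)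
    also have "\<dots> \<le> (\<integral>\<^sup>+ s. cgf P X (\<theta> * h s) * indicator (slot t \<delta> j) s \<partial>lborel)"
    proof (intro nn_integral_mono)
      fix s
      show "ennreal (\<delta> / r) * cgf P X v * indicator (slot t \<delta> j) s \<le> cgf P X (\<theta> * h s) * indicator (slot t \<delta> j) s"
      proof (cases "s \<in> slot t \<delta> j")
        case True
        have "v \<le> \<theta> * exp (- \<mu> * \<delta>) / \<delta> * (r * (exp (\<mu> * \<delta>) * h s))"
          unfolding v_def r_def using th d by (intro mult_left_mono slot_weight_le[OF d True]) auto
        also have "\<dots> = (r / \<delta>) * (\<theta> * h s) * (exp (- \<mu> * \<delta>) * exp (\<mu> * \<delta>))" by simp
        also have "exp (- \<mu> * \<delta>) * exp (\<mu> * \<delta>) = 1" by (simp flip: exp_add)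
        finally have "cgf P X v \<le> cgf P X ((r / \<delta>) * (\<theta> * h s))" using v0 by (intro cgf_mono) auto
        also have "\<dots> \<le> ennreal (r / \<delta>) * cgf P X (\<theta> * h s)"
          using r d th h_pos[of s] by (intro cgf_mult_le) auto
        finally have "ennreal (\<delta> / r) * cgf P X v \<le> ennreal (\<delta> / r) * (ennreal (r / \<delta>) * cgf P X (\<theta> * h s))"
          by (intro mult_left_mono) auto
        also have "\<dots> = cgf P X (\<theta> * h s)" using r0 d by (simp add: mult.assoc[symmetric] flip: ennreal_mult)
        finally show ?thesis using True by simp
      qed simp
    qed
    finally show ?thesis by (simp add: v_def)
  qed
qed

lemma cgf_weighted_slots_le:
  assumes X: "nonneg_rv P X" and ind: "prob_space.indep_vars P (\<lambda>_. borel) L (UNIV :: nat set)"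
    and copies: "\<And>j. distr P borel (L j) = distr P borel X"
    and d: "0 < \<delta>" and th: "0 \<le> \<theta>"
  shows "ennreal \<delta> * cgf P (\<lambda>\<omega>. \<Sum>j<n_slots t \<delta>. slot_weight h t \<delta> j * L j \<omega>) (\<theta> * exp (- \<mu> * \<delta>) / \<delta>)
    \<le> cgf_integral P X h t \<theta>"
proof -
  have "ennreal \<delta> * cgf P (\<lambda>\<omega>. \<Sum>j<n_slots t \<delta>. slot_weight h t \<delta> j * L j \<omega>) (\<theta> * exp (- \<mu> * \<delta>) / \<delta>)
    = (\<Sum>j<n_slots t \<delta>. ennreal \<delta> * cgf P X (\<theta> * exp (- \<mu> * \<delta>) / \<delta> * slot_weight h t \<delta> j))"
    using d th by (subst cgf_weighted_sum[OF X ind copies slot_weight_nonneg]) (auto simp: sum_distrib_left)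
  also have "\<dots> \<le> (\<Sum>j<n_slots t \<delta>. \<integral>\<^sup>+ s. cgf P X (\<theta> * h s) * indicator (slot t \<delta> j) s \<partial>lborel)"
    by (intro sum_mono slot_cgf_le[OF X d th])
  also have "\<dots> = cgf_integral P X h t \<theta>"
    using cgf_integral_slots[OF X h_measurable d] t by simp
  finally show ?thesis .
qed

text \<open>Full slots are compared by monotonicity, as for the upper bound. The incomplete slot is discarded:
  for a bounded variable its share of the integral is at most \<open>K * \<theta> * \<delta>\<close>.\<close>

lemma cgf_weighted_slots_ge:
  assumes X: "bounded_rv P X K" and ind: "prob_space.indep_vars P (\<lambda>_. borel) L (UNIV :: nat set)"
    and copies: "\<And>j. distr P borel (L j) = distr P borel X"
    and d: "0 < \<delta>" and th: "0 \<le> \<theta>"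
  shows "cgf_integral P X h t \<theta>
    \<le> ennreal \<delta> * cgf P (\<lambda>\<omega>. \<Sum>j<n_slots t \<delta>. slot_weight h t \<delta> j * L j \<omega>) (\<theta> * exp (\<mu> * \<delta>) / \<delta>)
      + ennreal (K * \<theta> * \<delta>)"
proof -
  interpret bounded_rv P X K by fact
  have X': "nonneg_rv P X" by (rule nonneg_rv_axioms)
  let ?v = "\<lambda>j. \<theta> * exp (\<mu> * \<delta>) / \<delta> * slot_weight h t \<delta> j"
  let ?I = "\<lambda>j. \<integral>\<^sup>+ s. cgf P X (\<theta> * h s) * indicator (slot t \<delta> j) s \<partial>lborel"
  define m where "m = nat \<lfloor>t / \<delta>\<rfloor>"
  have full: "?I j \<le> ennreal \<delta> * cgf P X (?v j)" if j: "j < m" for j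
  proof -
    have slot: "emeasure lborel (slot t \<delta> j) = ennreal \<delta>"
      using d j by (simp add: full_slot m_def algebra_simps)
    then have msl: "measure lborel (slot t \<delta> j) = \<delta>" using d by (simp add: measure_def)
    have "?I j \<le> (\<integral>\<^sup>+ s. cgf P X (?v j) * indicator (slot t \<delta> j) s \<partial>lborel)"
    proof (intro nn_integral_mono)
      fix s
      show "cgf P X (\<theta> * h s) * indicator (slot t \<delta> j) s \<le> cgf P X (?v j) * indicator (slot t \<delta> j) s"
      proof (cases "s \<in> slot t \<delta> j")
        case True
        have "\<theta> * exp (\<mu> * \<delta>) / \<delta> * (\<delta> * (exp (- \<mu> * \<delta>) * h s)) \<le> ?v j"
          using th d slot_weight_ge[OF d True] by (intro mult_left_mono) (auto simp: msl)
        moreover have "\<theta> * exp (\<mu> * \<delta>) / \<delta> * (\<delta> * (exp (- \<mu> * \<delta>) * h s))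
            = \<theta> * h s * (exp (\<mu> * \<delta>) * exp (- \<mu> * \<delta>))" using d by simp
        moreover have "exp (\<mu> * \<delta>) * exp (- \<mu> * \<delta>) = 1" by (simp flip: exp_add)
        ultimately have "\<theta> * h s \<le> ?v j" by simp
        then show ?thesis using True th h_pos[of s] by (auto intro!: cgf_mono)
      qed simp
    qed
    also have "\<dots> = ennreal \<delta> * cgf P X (?v j)"
      by (subst nn_integral_cmult_indicator) (auto simp: slot mult.commute)
    finally show ?thesis .
  qed
  have last: "?I m \<le> ennreal (K * \<theta> * \<delta>)"
  proof -
    have "?I m \<le> (\<integral>\<^sup>+ s. ennreal (K * \<theta>) * indicator (slot t \<delta> m) s \<partial>lborel)"
    proof (intro nn_integral_mono)
      fix s
      show "cgf P X (\<theta> * h s) * indicator (slot t \<delta> m) s \<le> ennreal (K * \<theta>) * indicator (slot t \<delta> m) s"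
      proof (cases "s \<in> slot t \<delta> m")
        case True
        then have "h s \<le> 1" using slot_subset h_le_1 by blast
        then have "\<theta> * h s \<le> \<theta> * 1" using th by (intro mult_left_mono) auto
        then have "K * (\<theta> * h s) \<le> K * \<theta>" using K_nonneg by (intro mult_left_mono) auto
        then have "ennreal (K * (\<theta> * h s)) \<le> ennreal (K * \<theta>)" by (rule ennreal_leI)
        moreover have "cgf P X (\<theta> * h s) \<le> ennreal (K * (\<theta> * h s))" using th h_pos[of s] by (intro cgf_le) auto
        ultimately show ?thesis using True by simp
      qed simp
    qed
    also have "\<dots> = ennreal (K * \<theta>) * emeasure lborel (slot t \<delta> m)"
      by (subst nn_integral_cmult_indicator) auto
    also have "\<dots> \<le> ennreal (K * \<theta>) * ennreal \<delta>" by (intro mult_left_mono emeasure_slot_le d) auto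
    also have "\<dots> = ennreal (K * \<theta> * \<delta>)" using K_nonneg th d by (simp add: ennreal_mult)
    finally show ?thesis .
  qed
  have "cgf_integral P X h t \<theta> = (\<Sum>j<m. ?I j) + ?I m"
    using cgf_integral_slots[OF X' h_measurable d, of t \<theta>] t by (simp add: n_slots_def m_def)
  also have "\<dots> \<le> (\<Sum>j<m. ennreal \<delta> * cgf P X (?v j)) + ennreal (K * \<theta> * \<delta>)"
    by (intro add_mono sum_mono full last) auto
  also have "(\<Sum>j<m. ennreal \<delta> * cgf P X (?v j)) \<le> (\<Sum>j<n_slots t \<delta>. ennreal \<delta> * cgf P X (?v j))"
    by (intro sum_mono2) (auto simp: n_slots_def m_def)
  also have "\<dots> = ennreal \<delta> * cgf P (\<lambda>\<omega>. \<Sum>j<n_slots t \<delta>. slot_weight h t \<delta> j * L j \<omega>) (\<theta> * exp (\<mu> * \<delta>) / \<delta>)"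
    using d th by (subst cgf_weighted_sum[OF X' ind copies slot_weight_nonneg]) (auto simp: sum_distrib_left)
  finally show ?thesis by (simp add: add_right_mono)
qed

end

lemma forward_discount: "0 < \<mu> \<Longrightarrow> 0 < t \<Longrightarrow> discount (\<lambda>s. exp (- (\<mu> * s))) \<mu> t"
proof
  fix s s' :: real assume "0 < \<mu>"
  then have "- \<mu> * s \<le> \<mu> * \<bar>s - s'\<bar> + - \<mu> * s'"
    using mult_left_mono[of "s' - s" "\<bar>s - s'\<bar>" \<mu>] by (simp add: algebra_simps)
  then show "exp (- (\<mu> * s)) \<le> exp (\<mu> * \<bar>s - s'\<bar>) * exp (- (\<mu> * s'))"
    by (simp flip: exp_add)
qed (auto intro!: continuous_intros)

lemma backward_discount: "0 < \<mu> \<Longrightarrow> 0 < t \<Longrightarrow> discount (\<lambda>s. exp (- (\<mu> * (t - s)))) \<mu> t"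
proof
  fix s s' :: real assume "0 < \<mu>"
  then have "- \<mu> * (t - s) \<le> \<mu> * \<bar>s - s'\<bar> + - \<mu> * (t - s')"
    using mult_left_mono[of "s - s'" "\<bar>s - s'\<bar>" \<mu>] by (simp add: algebra_simps)
  then show "exp (- (\<mu> * (t - s))) \<le> exp (\<mu> * \<bar>s - s'\<bar>) * exp (- (\<mu> * (t - s')))"
    by (simp flip: exp_add)
qed (auto intro!: continuous_intros)

text \<open>This is where the difference between the discount seen by the queue and the one in \<open>kappa\<close>
  disappears.\<close>

lemma cgf_integral_reflect:
  assumes "nonneg_rv P X"
  shows "cgf_integral P X (\<lambda>s. exp (- (\<mu> * (t - s)))) t \<theta> = cgf_integral P X (\<lambda>s. exp (- (\<mu> * s))) t \<theta>"
proof -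
  interpret nonneg_rv P X by fact
  have "cgf_integral P X (\<lambda>s. exp (- (\<mu> * s))) t \<theta>
    = ennreal \<bar>-1\<bar> * (\<integral>\<^sup>+ s. cgf P X (\<theta> * exp (- (\<mu> * (t + - 1 * s)))) * indicator {0..t} (t + - 1 * s) \<partial>lborel)"
    unfolding cgf_integral_def by (rule nn_integral_real_affine) auto
  also have "\<dots> = cgf_integral P X (\<lambda>s. exp (- (\<mu> * (t - s)))) t \<theta>"
    unfolding cgf_integral_def by (auto intro!: nn_integral_cong simp: indicator_def)
  finally show ?thesis ..
qed

lemma env_rate_eq_sum:
  assumes d: "0 < slot_length \<Delta> \<alpha> N" and s: "s \<in> {0..t}"
  shows "env_rate \<Delta> \<alpha> L N s \<omega>
    = (\<Sum>j<n_slots t (slot_length \<Delta> \<alpha> N). L j \<omega> * indicator (slot t (slot_length \<Delta> \<alpha> N) j) s)"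
proof -
  let ?d = "slot_length \<Delta> \<alpha> N"
  have "env_rate \<Delta> \<alpha> L N s \<omega> = (\<Sum>j<n_slots t ?d. L j \<omega> * indicator {real j * ?d..<(real j + 1) * ?d} s)"
    unfolding env_rate_def
  proof (intro suminf_finite)
    fix j assume "j \<notin> {..<n_slots t ?d}"
    then have "real (n_slots t ?d) * ?d \<le> real j * ?d" using d by (intro mult_right_mono) auto
    then have "s < real j * ?d" using n_slots_gt[OF d, of t] s by auto
    then show "L j \<omega> * indicator {real j * ?d..<(real j + 1) * ?d} s = 0" by simp
  qed simp
  then show ?thesis using s by (simp add: slot_def indicator_def)
qed

lemma (in discount) env_rate_integral:
  assumes d: "0 < slot_length \<Delta> \<alpha> N"
  shows "(LINT s:{0..t}|lborel. env_rate \<Delta> \<alpha> L N s \<omega> * h s)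
    = (\<Sum>j<n_slots t (slot_length \<Delta> \<alpha> N). slot_weight h t (slot_length \<Delta> \<alpha> N) j * L j \<omega>)"
proof -
  let ?d = "slot_length \<Delta> \<alpha> N"
  have "(LINT s:{0..t}|lborel. env_rate \<Delta> \<alpha> L N s \<omega> * h s)
     = (LINT s|lborel. (\<Sum>j<n_slots t ?d. L j \<omega> * (indicator (slot t ?d j) s *\<^sub>R h s)))"
    unfolding set_lebesgue_integral_def
  proof (intro Bochner_Integration.integral_cong refl)
    fix s
    show "indicator {0..t} s *\<^sub>R (env_rate \<Delta> \<alpha> L N s \<omega> * h s)
      = (\<Sum>j<n_slots t ?d. L j \<omega> * (indicator (slot t ?d j) s *\<^sub>R h s))"
    proof (cases "s \<in> {0..t}")
      case True
      then show ?thesis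
        by (simp only: env_rate_eq_sum[OF d True] sum_distrib_right) (simp only: mult.assoc indicator_simps real_scaleR_def mult_1)
    next
      case False
      then have "s \<notin> slot t ?d j" for j using slot_subset[of t ?d j] by blast
      then show ?thesis using False by simp
    qed
  qed
  also have "\<dots> = (\<Sum>j<n_slots t ?d. LINT s|lborel. L j \<omega> * (indicator (slot t ?d j) s *\<^sub>R h s))"
    using h_integrable unfolding set_integrable_def by (intro Bochner_Integration.integral_sum) auto
  also have "\<dots> = (\<Sum>j<n_slots t ?d. slot_weight h t ?d j * L j \<omega>)"
    by (simp add: slot_weight_def set_lebesgue_integral_def mult.commute)
  finally show ?thesis .
qed

section \<open>The limiting cumulant function of a bounded rate\<close>

context bounded_rv
begin


lemma cgf_finite: "0 \<le> v \<Longrightarrow> cgf P X v \<noteq> top"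
  using cgf_le[of v] by (auto simp: top_unique)

lemma cgf_eq: "0 \<le> v \<Longrightarrow> cgf P X v = ennreal (enn2real (cgf P X v))"
  using cgf_finite by (simp add: less_top)

lemma enn2real_cgf_mono: "0 \<le> v \<Longrightarrow> v \<le> v' \<Longrightarrow> enn2real (cgf P X v) \<le> enn2real (cgf P X v')"
  using cgf_finite[of v'] by (intro enn2real_mono cgf_mono) (auto simp: less_top)

lemma enn2real_cgf_shift:
  assumes "0 \<le> v" "v \<le> v'"
  shows "enn2real (cgf P X v') \<le> enn2real (cgf P X v) + K * (v' - v)"
proof -
  have "cgf P X v' \<le> ennreal (K * (v' - v) + enn2real (cgf P X v))"
    using cgf_le_shift[OF assms] cgf_eq[OF assms(1)] assms K_nonneg by (subst ennreal_plus) auto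
  then have "enn2real (cgf P X v') \<le> K * (v' - v) + enn2real (cgf P X v)"
    using assms K_nonneg by (intro enn2real_leI) auto
  then show ?thesis by simp
qed

lemma cgf_continuous: "continuous_on {0..} (\<lambda>v. enn2real (cgf P X v))"
proof (rule lipschitz_on_continuous_on)
  show "K-lipschitz_on {0..} (\<lambda>v. enn2real (cgf P X v))"
  proof (rule lipschitz_on_leI)
    fix x y :: real assume "x \<in> {0..}" "y \<in> {0..}" "x \<le> y"
    then show "dist (enn2real (cgf P X x)) (enn2real (cgf P X y)) \<le> K * dist x y"
      using enn2real_cgf_shift[of x y] enn2real_cgf_mono[of x y] by (auto simp: dist_real_def)
  qed (rule K_nonneg)
qed

end

locale bounded_discount = bounded_rv + discount
begin

definition \<Gamma> :: "real \<Rightarrow> real" where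
  "\<Gamma> \<theta> = enn2real (cgf_integral P X h t \<theta>)"

lemma cgf_integral_shift:
  assumes "0 \<le> \<theta>" "\<theta> \<le> \<theta>'"
  shows "cgf_integral P X h t \<theta>' \<le> cgf_integral P X h t \<theta> + ennreal (K * t * (\<theta>' - \<theta>))"
proof -
  have "cgf_integral P X h t \<theta>'
      \<le> (\<integral>\<^sup>+ s. cgf P X (\<theta> * h s) * indicator {0..t} s + ennreal (K * (\<theta>' - \<theta>)) * indicator {0..t} s \<partial>lborel)"
    unfolding cgf_integral_def
  proof (intro nn_integral_mono)
    fix s
    show "cgf P X (\<theta>' * h s) * indicator {0..t} s
       \<le> cgf P X (\<theta> * h s) * indicator {0..t} s + ennreal (K * (\<theta>' - \<theta>)) * indicator {0..t} s"
    proof (cases "s \<in> {0..t}")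
      case True
      have "cgf P X (\<theta>' * h s) \<le> ennreal (K * (\<theta>' * h s - \<theta> * h s)) + cgf P X (\<theta> * h s)"
        using assms h_pos[of s] by (intro cgf_le_shift) (auto intro: mult_right_mono)
      moreover have "K * (\<theta>' * h s - \<theta> * h s) \<le> K * (\<theta>' - \<theta>)"
      proof -
        have "(\<theta>' - \<theta>) * h s \<le> (\<theta>' - \<theta>) * 1" using assms h_le_1[OF True] by (intro mult_left_mono) auto
        then show ?thesis using K_nonneg by (intro mult_left_mono) (auto simp: algebra_simps)
      qed
      then have "ennreal (K * (\<theta>' * h s - \<theta> * h s)) \<le> ennreal (K * (\<theta>' - \<theta>))" by (rule ennreal_leI)
      ultimately have "cgf P X (\<theta>' * h s) \<le> ennreal (K * (\<theta>' - \<theta>)) + cgf P X (\<theta> * h s)"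
        by (meson add_right_mono order_trans)
      then show ?thesis using True by (simp add: add.commute)
    qed simp
  qed
  also have "\<dots> = cgf_integral P X h t \<theta> + ennreal (K * t * (\<theta>' - \<theta>))"
  proof -
    have "(\<integral>\<^sup>+ s. ennreal (K * (\<theta>' - \<theta>)) * indicator {0..t} s \<partial>lborel) = ennreal (K * t * (\<theta>' - \<theta>))"
      using K_nonneg assms t by (subst nn_integral_cmult_indicator) (auto simp: mult_ac simp flip: ennreal_mult)
    then show ?thesis unfolding cgf_integral_def by (subst nn_integral_add) auto
  qed
  finally show ?thesis .
qed

lemma cgf_integral_0: "cgf_integral P X h t 0 = 0"
  by (simp add: cgf_integral_def cgf_0)

lemma cgf_integral_finite: "0 \<le> \<theta> \<Longrightarrow> cgf_integral P X h t \<theta> \<noteq> top"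
  using cgf_integral_shift[of 0 \<theta>] by (auto simp: cgf_integral_0 top_unique)

lemma cgf_integral_eq: "0 \<le> \<theta> \<Longrightarrow> cgf_integral P X h t \<theta> = ennreal (\<Gamma> \<theta>)"
  using cgf_integral_finite by (simp add: \<Gamma>_def less_top)

lemma \<Gamma>_nonneg: "0 \<le> \<Gamma> \<theta>" by (simp add: \<Gamma>_def)

lemma \<Gamma>_0: "\<Gamma> 0 = 0" by (simp add: \<Gamma>_def cgf_integral_0)

lemma \<Gamma>_mono: "0 \<le> \<theta> \<Longrightarrow> \<theta> \<le> \<theta>' \<Longrightarrow> \<Gamma> \<theta> \<le> \<Gamma> \<theta>'"
proof -
  assume a: "0 \<le> \<theta>" "\<theta> \<le> \<theta>'"
  have "cgf_integral P X h t \<theta> \<le> cgf_integral P X h t \<theta>'"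
    unfolding cgf_integral_def using a
    by (intro nn_integral_mono mult_right_mono cgf_mono) (auto simp: less_imp_le[OF h_pos])
  then show ?thesis using a cgf_integral_finite[of \<theta>'] unfolding \<Gamma>_def by (intro enn2real_mono) (auto simp: less_top)
qed

lemma \<Gamma>_shift: "0 \<le> \<theta> \<Longrightarrow> \<theta> \<le> \<theta>' \<Longrightarrow> \<Gamma> \<theta>' \<le> \<Gamma> \<theta> + K * t * (\<theta>' - \<theta>)"
  using cgf_integral_shift[of \<theta> \<theta>'] K_nonneg t
  by (simp add: cgf_integral_eq \<Gamma>_nonneg flip: ennreal_plus)

lemma \<Gamma>_continuous: "continuous_on {0..} \<Gamma>"
proof (rule lipschitz_on_continuous_on)
  show "(K * t)-lipschitz_on {0..} \<Gamma>"
  proof (rule lipschitz_on_leI)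
    fix x y :: real assume "x \<in> {0..}" "y \<in> {0..}" "x \<le> y"
    then show "dist (\<Gamma> x) (\<Gamma> y) \<le> K * t * dist x y"
      using \<Gamma>_shift[of x y] \<Gamma>_mono[of x y] by (auto simp: dist_real_def)
  qed (use K_nonneg t in simp)
qed

lemma cgf_weighted_slots_tendsto:
  assumes ind: "prob_space.indep_vars P (\<lambda>_. borel) L (UNIV :: nat set)"
    and copies: "\<And>j. distr P borel (L j) = distr P borel X"
    and d: "\<And>N. 0 < \<delta> N" and dlim: "\<delta> \<longlonglongrightarrow> 0" and th: "0 \<le> \<theta>"
  defines "W \<equiv> \<lambda>N \<omega>. \<Sum>j<n_slots t (\<delta> N). slot_weight h t (\<delta> N) j * L j \<omega>"
  shows "cgf P (W N) (\<theta> / \<delta> N) \<noteq> top"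
    and "(\<lambda>N. \<delta> N * enn2real (cgf P (W N) (\<theta> / \<delta> N))) \<longlonglongrightarrow> \<Gamma> \<theta>"
proof -
  have X: "nonneg_rv P X" by (rule nonneg_rv_axioms)
  have X': "bounded_rv P X K" by (rule bounded_rv_axioms)
  let ?c = "\<lambda>N. cgf P (W N) (\<theta> / \<delta> N)"
  have e1: "\<theta> * exp (\<mu> * x) * exp (- \<mu> * x) = \<theta>" and e2: "\<theta> * exp (- \<mu> * x) * exp (\<mu> * x) = \<theta>" for x
    by (simp_all only: mult.assoc mult_exp_exp) simp_all
  have U: "ennreal (\<delta> N) * ?c N \<le> ennreal (\<Gamma> (\<theta> * exp (\<mu> * \<delta> N)))" for N
    using cgf_weighted_slots_le[OF X ind copies d[of N], of "\<theta> * exp (\<mu> * \<delta> N)"] th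
    unfolding e1 W_def by (subst cgf_integral_eq[symmetric]) auto
  have L: "ennreal (\<Gamma> (\<theta> * exp (- \<mu> * \<delta> N))) \<le> ennreal (\<delta> N) * ?c N + ennreal (K * (\<theta> * exp (- \<mu> * \<delta> N)) * \<delta> N)" for N
    using cgf_weighted_slots_ge[OF X' ind copies d[of N], of "\<theta> * exp (- \<mu> * \<delta> N)"] th
    unfolding e2 W_def by (subst cgf_integral_eq[symmetric]) auto
  show fin: "?c N \<noteq> top" for N
    using U[of N] d[of N] by (auto simp: ennreal_mult_top top_unique)
  define C where "C N = enn2real (?c N)" for N
  have C: "?c N = ennreal (C N)" "0 \<le> C N" for N using fin[of N] by (simp_all add: C_def less_top)
  have U': "\<delta> N * C N \<le> \<Gamma> (\<theta> * exp (\<mu> * \<delta> N))" for N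
    using U[of N] d[of N] C(2) unfolding C(1) by (simp add: \<Gamma>_nonneg flip: ennreal_mult)
  have L': "\<Gamma> (\<theta> * exp (- \<mu> * \<delta> N)) - K * (\<theta> * exp (- \<mu> * \<delta> N)) * \<delta> N \<le> \<delta> N * C N" for N
  proof -
    have "ennreal (\<Gamma> (\<theta> * exp (- \<mu> * \<delta> N)))
        \<le> ennreal (\<delta> N * C N + K * (\<theta> * exp (- \<mu> * \<delta> N)) * \<delta> N)"
      using L[of N] d[of N] C(2)[of N] K_nonneg th unfolding C(1) by (simp add: ennreal_mult ennreal_plus)
    then show ?thesis using d[of N] C(2)[of N] K_nonneg th by (subst (asm) ennreal_le_iff) auto
  qed
  have lim: "(\<lambda>N. \<Gamma> (\<theta> * exp (u * \<delta> N))) \<longlonglongrightarrow> \<Gamma> \<theta>" for u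
  proof (rule continuous_on_tendsto_compose[OF \<Gamma>_continuous])
    have "(\<lambda>N. \<theta> * exp (u * \<delta> N)) \<longlonglongrightarrow> \<theta> * exp (u * 0)" by (intro tendsto_intros dlim)
    then show "(\<lambda>N. \<theta> * exp (u * \<delta> N)) \<longlonglongrightarrow> \<theta>" by simp
  qed (use th in auto)
  have "(\<lambda>N. K * (\<theta> * exp (- \<mu> * \<delta> N)) * \<delta> N) \<longlonglongrightarrow> K * (\<theta> * exp (- \<mu> * 0)) * 0"
    by (intro tendsto_intros dlim)
  from tendsto_diff[OF lim[of "- \<mu>"] this]
  have "(\<lambda>N. \<Gamma> (\<theta> * exp (- \<mu> * \<delta> N)) - K * (\<theta> * exp (- \<mu> * \<delta> N)) * \<delta> N) \<longlonglongrightarrow> \<Gamma> \<theta>"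
    by (simp only: mult_zero_right diff_zero)
  then have "(\<lambda>N. \<delta> N * C N) \<longlonglongrightarrow> \<Gamma> \<theta>"
    by (rule tendsto_sandwich[OF always_eventually[OF allI[OF L']] always_eventually[OF allI[OF U']] _ lim[of \<mu>]])
  then show "(\<lambda>N. \<delta> N * enn2real (?c N)) \<longlonglongrightarrow> \<Gamma> \<theta>"
    by (simp only: C_def)
qed

end

lemma has_integral_exp_affine:
  fixes \<mu> t A B :: real
  assumes "0 < \<mu>" "0 \<le> t"
  shows "((\<lambda>s. A * exp (- (\<mu> * s)) + B) has_integral A * ((1 - exp (- (\<mu> * t))) / \<mu>) + B * t) {0..t}"
proof -
  have "((\<lambda>s. A * exp (- (\<mu> * s)) + B) has_integral
      (- A / \<mu> * exp (- (\<mu> * t)) + B * t) - (- A / \<mu> * exp (- (\<mu> * 0)) + B * 0)) {0..t}"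
  proof (rule fundamental_theorem_of_calculus)
    fix s
    have "((\<lambda>s. - A / \<mu> * exp (- (\<mu> * s)) + B * s) has_real_derivative
       - A / \<mu> * (exp (- (\<mu> * s)) * - \<mu>) + B) (at s within {0..t})"
      by (rule derivative_eq_intros refl | simp)+
    then show "((\<lambda>s. - A / \<mu> * exp (- (\<mu> * s)) + B * s) has_vector_derivative
       A * exp (- (\<mu> * s)) + B) (at s within {0..t})"
      using assms by (simp add: has_real_derivative_iff_has_vector_derivative)
  qed (use assms in simp)
  moreover have "(- A / \<mu> * exp (- (\<mu> * t)) + B * t) - (- A / \<mu> * exp (- (\<mu> * 0)) + B * 0)
      = A * ((1 - exp (- (\<mu> * t))) / \<mu>) + B * t"
    using assms by (simp add: diff_divide_distrib right_diff_distrib)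
  ultimately show ?thesis by metis
qed

locale bounded_exponential = bounded_rv + fixes \<mu> t :: real assumes mu_pos: "0 < \<mu>" and t_pos: "0 < t"

sublocale bounded_exponential \<subseteq> bounded_discount P X K "\<lambda>s. exp (- (\<mu> * s))" \<mu> t
  using forward_discount[OF mu_pos t_pos]
  by (simp add: bounded_discount_def bounded_rv_axioms)

context bounded_exponential
begin

lemma \<Gamma>_integral:
  assumes th: "0 \<le> \<theta>"
  shows "((\<lambda>s. enn2real (cgf P X (\<theta> * exp (- (\<mu> * s))))) has_integral \<Gamma> \<theta>) {0..t}"
proof -
  let ?g = "\<lambda>s. enn2real (cgf P X (\<theta> * exp (- (\<mu> * s))))"
  have cont: "continuous_on {0..t} ?g"
    by (rule continuous_on_compose2[OF cgf_continuous]) (use th in \<open>auto intro!: continuous_intros\<close>)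
  have int: "set_integrable lborel {0..t} ?g" by (rule borel_integrable_atLeastAtMost'[OF cont])
  have "cgf_integral P X (\<lambda>s. exp (- (\<mu> * s))) t \<theta> = (\<integral>\<^sup>+ s. ennreal (indicator {0..t} s *\<^sub>R ?g s) \<partial>lborel)"
    unfolding cgf_integral_def
    using cgf_eq[of "\<theta> * exp (- \<mu> * _)"] th by (intro nn_integral_cong) (auto simp: indicator_def)
  also have "\<dots> = ennreal (LINT s:{0..t}|lborel. ?g s)"
    using int unfolding set_integrable_def set_lebesgue_integral_def
    by (intro nn_integral_eq_integral) auto
  finally have "\<Gamma> \<theta> = (LINT s:{0..t}|lborel. ?g s)"
    unfolding \<Gamma>_def set_lebesgue_integral_def by (simp add: Bochner_Integration.integral_nonneg)
  also have "\<dots> = integral {0..t} ?g" using int by (rule set_borel_integral_eq_integral)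
  finally show ?thesis
    using set_borel_integral_eq_integral(1)[OF int] by (simp add: has_integral_integral)
qed

text \<open>The substitution \<open>v = \<theta> * exp (- \<mu> * s)\<close> gives
  \<open>\<Gamma> \<theta> = (1 / \<mu>) * integral {\<theta> * exp (- \<mu> * t)..\<theta>} (\<lambda>v. cgf v / v)\<close>. So \<open>\<Gamma>\<close> is differentiable by the
  fundamental theorem of calculus, and continuity of the cumulant generating function is enough.\<close>

lemma \<Gamma>_differentiable:
  assumes th: "0 < \<theta>"
  shows "\<exists>D. (\<Gamma> has_real_derivative D) (at \<theta>)"
proof -
  define g where "g v = enn2real (cgf P X v) / v" for v
  define e where "e = exp (- (\<mu> * t))"
  have e: "0 < e" "e < 1" using mu_pos t_pos by (auto simp: e_def)
  define l where "l = \<theta> * e / 2"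
  have l: "0 < l" using th e by (simp add: l_def)
  define H where "H v = integral {l..v} g" for v
  have H: "(H has_real_derivative g v) (at v)" if "l < v" for v
  proof -
    have "continuous_on {l..v + 1} g"
      unfolding g_def using l by (intro continuous_intros continuous_on_subset[OF cgf_continuous]) auto
    then have "(H has_real_derivative g v) (at v within {l..v + 1})"
      unfolding H_def using that by (intro integral_has_real_derivative) auto
    then show ?thesis using that by (simp add: at_within_Icc_at)
  qed
  have eq: "(H x - H (x * e)) / \<mu> = \<Gamma> x" if x: "x \<in> {\<theta> / 2<..}" for x
  proof -
    have x0: "0 < x" using x th by auto
    have "\<theta> / 2 * e < x * e" using x e by (intro mult_strict_right_mono) auto
    then have "x * e > l" by (simp add: l_def)
    have big: "l < x * exp (- (\<mu> * s))" if "s \<in> {0..t}" for s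
    proof -
      have "x * e \<le> x * exp (- (\<mu> * s))" using that mu_pos x0 by (simp add: e_def mult_left_mono)
      with \<open>x * e > l\<close> show ?thesis by simp
    qed
    have "((\<lambda>s. enn2real (cgf P X (x * exp (- (\<mu> * s))))) has_integral
        (- H (x * exp (- (\<mu> * t))) / \<mu>) - (- H (x * exp (- (\<mu> * 0))) / \<mu>)) {0..t}"
    proof (rule fundamental_theorem_of_calculus)
      fix s assume s: "s \<in> {0..t}"
      have "((\<lambda>s. x * exp (- (\<mu> * s))) has_real_derivative x * (exp (- (\<mu> * s)) * - \<mu>)) (at s)"
        by (rule derivative_eq_intros refl | simp)+
      then have "((\<lambda>s. H (x * exp (- (\<mu> * s)))) has_real_derivative
          g (x * exp (- (\<mu> * s))) * (x * (exp (- (\<mu> * s)) * - \<mu>))) (at s)"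
        using H[OF big[OF s]] by (intro DERIV_chain2[where f = H and g = "\<lambda>s. x * exp (- (\<mu> * s))"])
      then have "((\<lambda>s. - H (x * exp (- (\<mu> * s))) / \<mu>) has_real_derivative
          - (g (x * exp (- (\<mu> * s))) * (x * (exp (- (\<mu> * s)) * - \<mu>))) / \<mu>) (at s)"
        by (intro DERIV_cdivide DERIV_minus)
      moreover have "- (g (x * exp (- (\<mu> * s))) * (x * (exp (- (\<mu> * s)) * - \<mu>))) / \<mu> = enn2real (cgf P X (x * exp (- (\<mu> * s))))"
      proof -
        have "x * exp (- (\<mu> * s)) \<noteq> 0" using x0 by simp
        then show ?thesis unfolding g_def using mu_pos by (simp del: mult_eq_0_iff)
      qed
      ultimately show "((\<lambda>s. - H (x * exp (- (\<mu> * s))) / \<mu>) has_vector_derivative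
          enn2real (cgf P X (x * exp (- (\<mu> * s))))) (at s within {0..t})"
        by (simp add: has_real_derivative_iff_has_vector_derivative has_vector_derivative_at_within)
    qed (use t_pos in simp)
    with \<Gamma>_integral[of x] have "\<Gamma> x = (- H (x * exp (- (\<mu> * t))) / \<mu>) - (- H (x * exp (- (\<mu> * 0))) / \<mu>)"
      using x0 by (intro has_integral_unique) auto
    then show ?thesis by (simp add: e_def diff_divide_distrib)
  qed
  have "\<theta> * e > l" using th e by (simp add: l_def)
  then have d2: "(H has_real_derivative g (\<theta> * e)) (at (\<theta> * e))" by (rule H)
  have "\<theta> * 1 > \<theta> * e" using th e by (intro mult_strict_left_mono) auto
  then have d1: "(H has_real_derivative g \<theta>) (at \<theta>)" using \<open>\<theta> * e > l\<close> by (intro H) simp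
  have "((\<lambda>x. x * e) has_real_derivative e) (at \<theta>)"
    by (rule derivative_eq_intros refl | simp)+
  then have "((\<lambda>x. H (x * e)) has_real_derivative g (\<theta> * e) * e) (at \<theta>)"
    using d2 by (intro DERIV_chain2[where f = H and g = "\<lambda>x. x * e"])
  then have "((\<lambda>x. (H x - H (x * e)) / \<mu>) has_real_derivative (g \<theta> - g (\<theta> * e) * e) / \<mu>) (at \<theta>)"
    by (intro DERIV_cdivide DERIV_diff d1)
  then have "(\<Gamma> has_real_derivative (g \<theta> - g (\<theta> * e) * e) / \<mu>) (at \<theta>)"
    by (rule has_field_derivative_transform_within_open[where S = "{\<theta> / 2<..}"])
       (use th eq in auto)
  then show ?thesis ..
qed

text \<open>Together with the next lemma this bounds the slope of \<open>\<Gamma>\<close> at 0 by the mean of the discounted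
  integral, so the exponent of a level above the mean is positive for small \<open>\<theta>\<close>.\<close>

lemma cgf_quadratic_bound:
  assumes v: "0 \<le> v" "v * K \<le> 1"
  shows "enn2real (cgf P X v) \<le> v * expectation X + v\<^sup>2 * K\<^sup>2"
proof -
  have int: "integrable P X"
    by (rule integrable_const_bound[of _ K]) (use X_nonneg X_le in eventually_elim, auto)
  have EX: "0 \<le> expectation X" using X_nonneg by (rule integral_nonneg_AE)
  have "mgf P X v \<le> (\<integral>\<^sup>+ \<omega>. ennreal (1 + v * X \<omega> + v\<^sup>2 * K\<^sup>2) \<partial>P)"
    unfolding mgf_def
  proof (intro nn_integral_mono_AE, use X_nonneg X_le in eventually_elim)
    fix \<omega> assume x: "0 \<le> X \<omega>" "X \<omega> \<le> K"
    have "v * X \<omega> \<le> v * K" using x v by (intro mult_left_mono) auto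
    then have "exp (v * X \<omega>) \<le> 1 + v * X \<omega> + (v * X \<omega>)\<^sup>2"
      using x v by (intro exp_bound) auto
    also have "(v * X \<omega>)\<^sup>2 \<le> v\<^sup>2 * K\<^sup>2"
      unfolding power_mult_distrib using x by (intro mult_left_mono power_mono) auto
    finally show "ennreal (exp (v * X \<omega>)) \<le> ennreal (1 + v * X \<omega> + v\<^sup>2 * K\<^sup>2)"
      by (intro ennreal_leI) simp
  qed
  also have "\<dots> = ennreal (expectation (\<lambda>\<omega>. 1 + v * X \<omega> + v\<^sup>2 * K\<^sup>2))"
    using int v by (intro nn_integral_eq_integral) (use X_nonneg in auto)
  also have "expectation (\<lambda>\<omega>. 1 + v * X \<omega> + v\<^sup>2 * K\<^sup>2) = 1 + (v * expectation X + v\<^sup>2 * K\<^sup>2)"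
    using int by (simp add: prob_space)
  also have "ennreal \<dots> \<le> ennreal (exp (v * expectation X + v\<^sup>2 * K\<^sup>2))"
    by (intro ennreal_leI exp_ge_add_one_self)
  finally have "cgf P X v \<le> ennreal (v * expectation X + v\<^sup>2 * K\<^sup>2)"
    using v EX by (subst cgf_le_iff) auto
  then show ?thesis using v EX by (intro enn2real_leI) auto
qed

lemma \<Gamma>_quadratic_bound:
  assumes th: "0 \<le> \<theta>" "\<theta> * K \<le> 1"
  shows "\<Gamma> \<theta> \<le> \<theta> * (expectation X / \<mu> * (1 - exp (- (\<mu> * t)))) + \<theta>\<^sup>2 * K\<^sup>2 * t"
proof -
  have "\<Gamma> \<theta> \<le> \<theta> * expectation X * ((1 - exp (- (\<mu> * t))) / \<mu>) + \<theta>\<^sup>2 * K\<^sup>2 * t"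
  proof (rule has_integral_le[OF \<Gamma>_integral[OF th(1)] has_integral_exp_affine[OF mu_pos less_imp_le[OF t_pos]]])
    fix s assume s: "s \<in> {0..t}"
    define v where "v = \<theta> * exp (- (\<mu> * s))"
    have "\<theta> * exp (- (\<mu> * s)) \<le> \<theta> * 1" using s th mu_pos by (intro mult_left_mono) auto
    then have v: "0 \<le> v" "v \<le> \<theta>" using th by (auto simp: v_def)
    have "v * K \<le> 1" using mult_right_mono[OF v(2) K_nonneg] th by simp
    then have "enn2real (cgf P X v) \<le> v * expectation X + v\<^sup>2 * K\<^sup>2" using v by (intro cgf_quadratic_bound)
    also have "v\<^sup>2 * K\<^sup>2 \<le> \<theta>\<^sup>2 * K\<^sup>2" using v by (intro mult_right_mono power_mono) auto
    finally show "enn2real (cgf P X (\<theta> * exp (- (\<mu> * s)))) \<le> \<theta> * expectation X * exp (- (\<mu> * s)) + \<theta>\<^sup>2 * K\<^sup>2"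
      by (simp add: v_def mult_ac)
  qed
  then show ?thesis by (simp add: mult_ac)
qed

text \<open>The exponent is 0 at 0, not positive at \<open>R\<close>, and positive somewhere between. So its maximum over
  \<open>{0..R}\<close> lies in the interior, where the derivative vanishes.\<close>

lemma exponent_maximiser:
  assumes b: "expectation X / \<mu> * (1 - exp (- (\<mu> * t))) < b" and R: "0 < R" "R * b - \<Gamma> R \<le> 0"
  obtains \<theta>0 where "0 < \<theta>0" "\<theta>0 < R" "(\<Gamma> has_real_derivative b) (at \<theta>0)"
proof -
  define \<rho> where "\<rho> = expectation X / \<mu> * (1 - exp (- (\<mu> * t)))"
  define f where "f \<theta> = \<theta> * b - \<Gamma> \<theta>" for \<theta>
  have "continuous_on {0..R} f"
    unfolding f_def by (intro continuous_intros continuous_on_subset[OF \<Gamma>_continuous]) auto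
  then obtain \<theta>0 where th0: "\<theta>0 \<in> {0..R}" and max: "\<And>\<theta>. \<theta> \<in> {0..R} \<Longrightarrow> f \<theta> \<le> f \<theta>0"
    using continuous_attains_sup[of "{0..R}" f] R by auto
  \<comment> \<open>small enough for the quadratic bound to hold and its error to be below half the linear gain\<close>
  define \<eta> where "\<eta> = min R (min (1 / (K + 1)) ((b - \<rho>) / (2 * (K\<^sup>2 * t + 1))))"
  have C: "0 < K\<^sup>2 * t + 1" using t_pos by (simp add: add_nonneg_pos)
  have eta: "0 < \<eta>" "\<eta> \<le> R" using R b C K_nonneg by (auto simp: \<eta>_def \<rho>_def)
  have "\<eta> * (K + 1) \<le> 1"
    using K_nonneg unfolding \<eta>_def by (subst pos_le_divide_eq[symmetric]) auto
  then have etaK: "\<eta> * K \<le> 1" using eta by (simp add: algebra_simps)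
  have "\<eta> * (2 * (K\<^sup>2 * t + 1)) \<le> b - \<rho>"
    using C unfolding \<eta>_def by (subst pos_le_divide_eq[symmetric]) auto
  then have "\<eta> * (K\<^sup>2 * t) < b - \<rho>" 
  proof -
    assume "\<eta> * (2 * (K\<^sup>2 * t + 1)) \<le> b - \<rho>"
    moreover have "\<eta> * (2 * (K\<^sup>2 * t + 1)) = 2 * (\<eta> * (K\<^sup>2 * t)) + 2 * \<eta>" by (simp add: algebra_simps)
    moreover have "0 \<le> \<eta> * (K\<^sup>2 * t)" using eta t_pos by simp
    ultimately show ?thesis using eta by linarith
  qed
  then have "0 < \<eta> * (b - \<rho> - \<eta> * (K\<^sup>2 * t))" using eta by simp
  also have "\<dots> \<le> f \<eta>"
    using \<Gamma>_quadratic_bound[OF less_imp_le[OF eta(1)] etaK]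
    by (simp add: f_def \<rho>_def algebra_simps power2_eq_square)
  also have "f \<eta> \<le> f \<theta>0" using eta by (intro max) auto
  finally have pos: "0 < f \<theta>0" .
  have th: "0 < \<theta>0" "\<theta>0 < R"
    using pos th0 R(2) by (auto simp: f_def \<Gamma>_0 less_le)
  obtain D where D: "(\<Gamma> has_real_derivative D) (at \<theta>0)" using \<Gamma>_differentiable[OF th(1)] by auto
  have "(f has_real_derivative b - D) (at \<theta>0)"
    unfolding f_def by (rule derivative_eq_intros D refl | simp)+
  then have "b - D = 0"
  proof (rule DERIV_local_max)
    show "0 < min \<theta>0 (R - \<theta>0)" using th by simp
    show "\<forall>y. \<bar>\<theta>0 - y\<bar> < min \<theta>0 (R - \<theta>0) \<longrightarrow> f y \<le> f \<theta>0" by (auto intro!: max)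
  qed
  with D th show ?thesis by (intro that) auto
qed

end

section \<open>Lower bounds by exponential tilting\<close>

text \<open>The range of \<open>x\<close> is split at \<open>b - \<epsilon>\<close> and \<open>b + \<epsilon>\<close>. The outer parts are paid for by lowering or
  raising the tilting parameter by \<open>\<eta>\<close>.\<close>

lemma exp_tilt_cases:
  fixes d \<theta> \<eta> b \<epsilon> x :: real
  assumes d: "0 < d" and eta: "0 \<le> \<eta>" and th: "0 \<le> \<theta>"
  shows "exp (\<theta> / d * x) \<le> exp (\<theta> * (b + \<epsilon>) / d) * indicator {b - \<epsilon><..} x
      + exp (\<eta> * (b - \<epsilon>) / d) * exp ((\<theta> - \<eta>) / d * x)
      + exp (- \<eta> * (b + \<epsilon>) / d) * exp ((\<theta> + \<eta>) / d * x)"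
proof -
  have e: "exp (u / d) * exp (v / d * x) = exp ((u + v * x) / d)" for u v
    by (simp add: add_divide_distrib exp_add)
  have le: "exp (\<theta> / d * x) \<le> exp (u / d)" if "\<theta> * x \<le> u" for u
    using divide_right_mono[OF that less_imp_le[OF d]] by simp
  consider "x \<le> b - \<epsilon>" | "b + \<epsilon> \<le> x" | "b - \<epsilon> < x" "x < b + \<epsilon>" by linarith
  then show ?thesis
  proof cases
    case 1
    then have "\<eta> * x \<le> \<eta> * (b - \<epsilon>)" using eta by (intro mult_left_mono) auto
    then have "exp (\<theta> / d * x) \<le> exp ((\<eta> * (b - \<epsilon>) + (\<theta> - \<eta>) * x) / d)"
      by (intro le) (simp add: left_diff_distrib)
    then show ?thesis unfolding e by (intro add_increasing2 add_increasing) auto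
  next
    case 2
    then have "\<eta> * (b + \<epsilon>) \<le> \<eta> * x" using eta by (intro mult_left_mono) auto
    then have "exp (\<theta> / d * x) \<le> exp ((- \<eta> * (b + \<epsilon>) + (\<theta> + \<eta>) * x) / d)"
      by (intro le) (simp add: distrib_right)
    then show ?thesis unfolding e by (intro add_increasing) auto
  next
    case 3
    then have "\<theta> * x \<le> \<theta> * (b + \<epsilon>)" using th by (intro mult_left_mono) auto
    then have "exp (\<theta> / d * x) \<le> exp (\<theta> * (b + \<epsilon>) / d) * indicator {b - \<epsilon><..} x"
      using le 3 by simp
    then show ?thesis by (intro add_increasing2) auto
  qed
qed

text \<open>The lower bound of the Gaertner-Ellis theorem at a point of differentiability. Integrating the preceding inequality bounds the moment
  generating function at \<open>\<theta> / \<delta>\<close> by three terms. By differentiability at \<open>\<theta>\<close> the two that come from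
  \<open>\<theta> - \<eta>\<close> and \<open>\<theta> + \<eta>\<close> are exponentially smaller than the left-hand side, so the third, which
  contains the probability, carries at least half of it. No tilted measure has to be constructed.\<close>

lemma exponential_tilting_lower_bound:
  assumes W: "\<And>N. nonneg_rv P (W N)" and d: "\<And>N. 0 < \<delta> N" and dlim: "\<delta> \<longlonglongrightarrow> 0"
    and fin: "\<And>N \<theta>. 0 < \<theta> \<Longrightarrow> cgf P (W N) (\<theta> / \<delta> N) \<noteq> top"
    and lim: "\<And>\<theta>. 0 < \<theta> \<Longrightarrow> (\<lambda>N. \<delta> N * enn2real (cgf P (W N) (\<theta> / \<delta> N))) \<longlonglongrightarrow> G \<theta>"
    and th: "0 < \<theta>" and D: "(G has_real_derivative b) (at \<theta>)"
    and b': "b' < b" and c: "\<theta> * b - G \<theta> < c"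
  shows "\<forall>\<^sub>F N in sequentially. exp (- c / \<delta> N) \<le> measure P {\<omega> \<in> space P. b' < W N \<omega>}"
proof -
  interpret prob_space P using W[of 0] by (simp add: nonneg_rv_def)
  have [measurable]: "W N \<in> borel_measurable P" for N
    using W[of N] by (rule nonneg_rv.X_measurable)
  define l where "l N \<theta> = \<delta> N * enn2real (cgf P (W N) (\<theta> / \<delta> N))" for N \<theta>
  have mgf: "mgf P (W N) (x / \<delta> N) = ennreal (exp (l N x / \<delta> N))" if "0 < x" for x N
    using nonneg_rv.mgf_eq_exp_cgf[OF W _ fin[OF that]] that d[of N] by (simp add: l_def)
  define \<epsilon> where "\<epsilon> = min (b - b') ((c - (\<theta> * b - G \<theta>)) / (2 * \<theta>))"
  have eps: "0 < \<epsilon>" "b' \<le> b - \<epsilon>" using b' c th by (auto simp: \<epsilon>_def)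
  have "\<epsilon> \<le> (c - (\<theta> * b - G \<theta>)) / (2 * \<theta>)" by (simp add: \<epsilon>_def)
  then have "\<theta> * \<epsilon> \<le> (c - (\<theta> * b - G \<theta>)) / 2" using th by (simp add: field_simps)
  then have c': "\<theta> * (b + \<epsilon>) - G \<theta> < c" using c by (simp add: algebra_simps)

  obtain \<eta> where eta: "0 < \<eta>" "\<eta> < \<theta>"
    and up: "G (\<theta> + \<eta>) - G \<theta> < \<eta> * (b + \<epsilon>)" and down: "G (\<theta> - \<eta>) - G \<theta> < - \<eta> * (b - \<epsilon>)"
  proof -
    have "((\<lambda>x. (G (\<theta> + x) - G \<theta>) / x) \<longlongrightarrow> b) (at 0)" using D by (simp add: DERIV_def)
    then have "\<forall>\<^sub>F x in at 0. dist ((G (\<theta> + x) - G \<theta>) / x) b < \<epsilon>"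
      using eps(1) by (rule tendstoD)
    then obtain r where r: "0 < r" "\<And>x. x \<noteq> 0 \<Longrightarrow> \<bar>x\<bar> < r \<Longrightarrow> dist ((G (\<theta> + x) - G \<theta>) / x) b < \<epsilon>"
      by (auto simp: eventually_at dist_real_def)
    define \<eta> where "\<eta> = min r \<theta> / 2"
    have e: "0 < \<eta>" "\<eta> < \<theta>" "\<eta> < r" using r th by (auto simp: \<eta>_def)
    have "(G (\<theta> + \<eta>) - G \<theta>) / \<eta> < b + \<epsilon>" using r(2)[of \<eta>] e by (auto simp: dist_real_def abs_less_iff)
    moreover have "b - \<epsilon> < (G (\<theta> + - \<eta>) - G \<theta>) / (- \<eta>)" using r(2)[of "- \<eta>"] e by (simp add: dist_real_def abs_less_iff) 
    ultimately show ?thesis using e by (intro that[of \<eta>]) (auto simp: field_simps)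
  qed

  have bound: "exp (l N \<theta> / \<delta> N) \<le> exp (\<theta> * (b + \<epsilon>) / \<delta> N) * prob {\<omega> \<in> space P. b' < W N \<omega>}
      + exp (\<eta> * (b - \<epsilon>) / \<delta> N) * exp (l N (\<theta> - \<eta>) / \<delta> N)
      + exp (- \<eta> * (b + \<epsilon>) / \<delta> N) * exp (l N (\<theta> + \<eta>) / \<delta> N)" for N
  proof -
    let ?A = "{\<omega> \<in> space P. b' < W N \<omega>}"
    define p q r where "p = exp (\<theta> * (b + \<epsilon>) / \<delta> N)" and "q = exp (\<eta> * (b - \<epsilon>) / \<delta> N)"
      and "r = exp (- \<eta> * (b + \<epsilon>) / \<delta> N)"
    have pqr: "0 \<le> p" "0 \<le> q" "0 \<le> r" by (auto simp: p_def q_def r_def)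
    have "ennreal (exp (l N \<theta> / \<delta> N)) = mgf P (W N) (\<theta> / \<delta> N)" using th by (simp add: mgf)
    also have "\<dots> \<le> (\<integral>\<^sup>+ \<omega>. ennreal p * indicator ?A \<omega> + ennreal q * ennreal (exp ((\<theta> - \<eta>) / \<delta> N * W N \<omega>))
        + ennreal r * ennreal (exp ((\<theta> + \<eta>) / \<delta> N * W N \<omega>)) \<partial>P)"
      unfolding mgf_def
    proof (intro nn_integral_mono)
      fix \<omega> assume w: "\<omega> \<in> space P"
      let ?down = "exp ((\<theta> - \<eta>) / \<delta> N * W N \<omega>)" and ?up = "exp ((\<theta> + \<eta>) / \<delta> N * W N \<omega>)"
      have "exp (\<theta> / \<delta> N * W N \<omega>) \<le> p * indicator {b - \<epsilon><..} (W N \<omega>) + q * ?down + r * ?up"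
        unfolding p_def q_def r_def using th eta by (intro exp_tilt_cases d) auto
      also have "\<dots> \<le> p * indicator ?A \<omega> + q * ?down + r * ?up"
        using eps w pqr by (intro add_right_mono mult_left_mono) (auto simp: indicator_def)
      finally have "ennreal (exp (\<theta> / \<delta> N * W N \<omega>)) \<le> ennreal (p * indicator ?A \<omega> + q * ?down + r * ?up)"
        by (rule ennreal_leI)
      then show "ennreal (exp (\<theta> / \<delta> N * W N \<omega>)) \<le> ennreal p * indicator ?A \<omega> + ennreal q * ennreal ?down
          + ennreal r * ennreal ?up"
        using pqr by (cases "\<omega> \<in> ?A") (simp_all add: ennreal_mult ennreal_plus)
    qed
    also have "\<dots> = ennreal p * emeasure P ?A + ennreal q * mgf P (W N) ((\<theta> - \<eta>) / \<delta> N)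
        + ennreal r * mgf P (W N) ((\<theta> + \<eta>) / \<delta> N)"
      unfolding mgf_def by (simp add: nn_integral_add nn_integral_cmult)
    also have "\<dots> = ennreal (p * prob ?A + q * exp (l N (\<theta> - \<eta>) / \<delta> N) + r * exp (l N (\<theta> + \<eta>) / \<delta> N))"
      using eta pqr by (simp add: mgf emeasure_eq_measure ennreal_mult)
    finally show ?thesis
      unfolding p_def[symmetric] q_def[symmetric] r_def[symmetric]
      by (subst (asm) ennreal_le_iff) (auto simp: pqr)
  qed

  have dinf: "filterlim (\<lambda>N. inverse (\<delta> N)) at_top sequentially"
    using dlim d by (intro filterlim_inverse_at_top) auto
  have small: "(\<lambda>N. exp (x N / \<delta> N)) \<longlonglongrightarrow> 0" if "x \<longlonglongrightarrow> y" "y < 0" for x and y :: real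
  proof -
    have "filterlim (\<lambda>N. x N * inverse (\<delta> N)) at_bot sequentially"
      by (rule filterlim_tendsto_neg_mult_at_bot[OF that dinf])
    then show ?thesis
      by (intro filterlim_compose[OF exp_at_bot]) (simp add: divide_inverse)
  qed
  have l_lim: "(\<lambda>N. l N x) \<longlonglongrightarrow> G x" if "0 < x" for x
    using lim[OF that] by (simp add: l_def)
  have s1: "(\<lambda>N. exp ((\<eta> * (b - \<epsilon>) + l N (\<theta> - \<eta>) - l N \<theta>) / \<delta> N)) \<longlonglongrightarrow> 0"
    by (rule small[OF tendsto_diff[OF tendsto_add[OF tendsto_const l_lim] l_lim]]) (use eta th down in auto)
  have s2: "(\<lambda>N. exp ((- \<eta> * (b + \<epsilon>) + l N (\<theta> + \<eta>) - l N \<theta>) / \<delta> N)) \<longlonglongrightarrow> 0"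
    by (rule small[OF tendsto_diff[OF tendsto_add[OF tendsto_const l_lim] l_lim]]) (use eta th up in auto)
  have s3: "(\<lambda>N. exp ((\<theta> * (b + \<epsilon>) - l N \<theta> - c) / \<delta> N)) \<longlonglongrightarrow> 0"
    by (rule small[OF tendsto_diff[OF tendsto_diff[OF tendsto_const l_lim] tendsto_const]]) (use th c' in auto)
  have "\<forall>\<^sub>F N in sequentially. exp ((\<eta> * (b - \<epsilon>) + l N (\<theta> - \<eta>) - l N \<theta>) / \<delta> N) < 1/4
      \<and> exp ((- \<eta> * (b + \<epsilon>) + l N (\<theta> + \<eta>) - l N \<theta>) / \<delta> N) < 1/4
      \<and> exp ((\<theta> * (b + \<epsilon>) - l N \<theta> - c) / \<delta> N) < 1/2"
    by (intro eventually_conj order_tendstoD(2)[OF s1] order_tendstoD(2)[OF s2] order_tendstoD(2)[OF s3]) auto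
  then show ?thesis
  proof eventually_elim
    case (elim N)
    let ?p = "prob {\<omega> \<in> space P. b' < W N \<omega>}"
    let ?E = "exp (- l N \<theta> / \<delta> N)"
    have e: "exp (u / \<delta> N) * exp (v / \<delta> N) = exp ((u + v) / \<delta> N)" for u v
      by (simp only: mult_exp_exp add_divide_distrib)
    have m: "exp (u / \<delta> N) * exp (v / \<delta> N) * ?E = exp ((u + v - l N \<theta>) / \<delta> N)" for u v
      by (simp only: e) simp
    have m': "exp (u / \<delta> N) * ?p * ?E = exp ((u - l N \<theta>) / \<delta> N) * ?p" for u
      using e[of u "- l N \<theta>"] by (simp only: mult.assoc mult.commute[of ?p]) (simp only: mult.assoc[symmetric] add_uminus_conv_diff)
    have "1 = exp (l N \<theta> / \<delta> N) * ?E" by (simp add: exp_minus)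
    also have "exp (l N \<theta> / \<delta> N) * ?E \<le> (exp (\<theta> * (b + \<epsilon>) / \<delta> N) * ?p
      + exp (\<eta> * (b - \<epsilon>) / \<delta> N) * exp (l N (\<theta> - \<eta>) / \<delta> N)
      + exp (- \<eta> * (b + \<epsilon>) / \<delta> N) * exp (l N (\<theta> + \<eta>) / \<delta> N)) * ?E"
      by (intro mult_right_mono bound) auto
    also have "\<dots> = exp ((\<theta> * (b + \<epsilon>) - l N \<theta>) / \<delta> N) * ?p
      + exp ((\<eta> * (b - \<epsilon>) + l N (\<theta> - \<eta>) - l N \<theta>) / \<delta> N)
      + exp ((- \<eta> * (b + \<epsilon>) + l N (\<theta> + \<eta>) - l N \<theta>) / \<delta> N)"
      by (simp only: distrib_right m m')
    finally have "1/2 \<le> exp ((\<theta> * (b + \<epsilon>) - l N \<theta>) / \<delta> N) * ?p" using elim by linarith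
    then have "exp ((\<theta> * (b + \<epsilon>) - l N \<theta> - c) / \<delta> N) \<le> exp ((\<theta> * (b + \<epsilon>) - l N \<theta>) / \<delta> N) * ?p"
      using elim by linarith
    also have "exp ((\<theta> * (b + \<epsilon>) - l N \<theta> - c) / \<delta> N) = exp ((\<theta> * (b + \<epsilon>) - l N \<theta>) / \<delta> N) * exp (- c / \<delta> N)"
      by (simp only: e add_uminus_conv_diff)
    finally show "exp (- c / \<delta> N) \<le> ?p" by simp
  qed
qed

section \<open>Truncation of the rate\<close>

context nonneg_rv
begin

lemma truncated_rv: "0 \<le> K \<Longrightarrow> bounded_rv P (\<lambda>\<omega>. min (X \<omega>) K) K"
  by unfold_locales (use X_nonneg in \<open>auto elim: eventually_mono\<close>)

lemma nonneg_rv_truncated: "0 \<le> K \<Longrightarrow> nonneg_rv P (\<lambda>\<omega>. min (X \<omega>) K)"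
  using truncated_rv[of K] by (simp add: bounded_rv_def)

lemma mgf_truncated_mono:
  assumes "0 \<le> v" "K \<le> K'"
  shows "mgf P (\<lambda>\<omega>. min (X \<omega>) K) v \<le> mgf P (\<lambda>\<omega>. min (X \<omega>) K') v"
  unfolding mgf_def using assms by (intro nn_integral_mono ennreal_leI) (auto intro!: mult_left_mono)

lemma cgf_truncated_mono:
  assumes "0 \<le> v" "0 \<le> K" "K \<le> K'"
  shows "cgf P (\<lambda>\<omega>. min (X \<omega>) K) v \<le> cgf P (\<lambda>\<omega>. min (X \<omega>) K') v"
  unfolding cgf_def using assms
  by (intro ennlog_mono mgf_truncated_mono nonneg_rv.mgf_ge_1[OF nonneg_rv_truncated]) auto

lemma mgf_truncated_SUP:
  assumes v: "0 \<le> v" shows "(SUP K::nat. mgf P (\<lambda>\<omega>. min (X \<omega>) (real K)) v) = mgf P X v"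
proof -
  have "(SUP K::nat. mgf P (\<lambda>\<omega>. min (X \<omega>) (real K)) v)
      = (\<integral>\<^sup>+ \<omega>. (SUP K::nat. ennreal (exp (v * min (X \<omega>) (real K)))) \<partial>P)"
    unfolding mgf_def
    by (intro nn_integral_monotone_convergence_SUP[symmetric])
       (auto simp: incseq_def le_fun_def intro!: ennreal_leI mult_left_mono v)
  also have "\<dots> = mgf P X v"
    unfolding mgf_def
  proof (intro nn_integral_cong antisym SUP_least)
    fix \<omega> and K :: nat
    show "ennreal (exp (v * min (X \<omega>) (real K))) \<le> ennreal (exp (v * X \<omega>))"
      by (auto intro!: ennreal_leI mult_left_mono v)
    have "ennreal (exp (v * X \<omega>)) = ennreal (exp (v * min (X \<omega>) (real (nat \<lceil>X \<omega>\<rceil>))))"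
      by (simp add: min_absorb1 real_nat_ceiling_ge)
    then show "ennreal (exp (v * X \<omega>)) \<le> (SUP K::nat. ennreal (exp (v * min (X \<omega>) (real K))))"
      by (metis (mono_tags, lifting) SUP_upper UNIV_I)
  qed
  finally show ?thesis .
qed

lemma cgf_truncated_SUP:
  assumes v: "0 \<le> v" shows "(SUP K::nat. cgf P (\<lambda>\<omega>. min (X \<omega>) (real K)) v) = cgf P X v"
proof (rule antisym)
  have "mgf P (\<lambda>\<omega>. min (X \<omega>) (real K)) v \<le> mgf P X v" for K :: nat
    using mgf_truncated_SUP[OF v] SUP_upper[of K UNIV "\<lambda>K. mgf P (\<lambda>\<omega>. min (X \<omega>) (real K)) v"] by simp
  then show "(SUP K::nat. cgf P (\<lambda>\<omega>. min (X \<omega>) (real K)) v) \<le> cgf P X v"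
    unfolding cgf_def using v
    by (intro SUP_least ennlog_mono nonneg_rv.mgf_ge_1[OF nonneg_rv_truncated]) auto
  show "cgf P X v \<le> (SUP K::nat. cgf P (\<lambda>\<omega>. min (X \<omega>) (real K)) v)" (is "_ \<le> ?s")
  proof (cases "?s = top")
    case False
    then obtain c where c: "?s = ennreal c" "0 \<le> c" by (cases ?s) auto
    have "mgf P (\<lambda>\<omega>. min (X \<omega>) (real K)) v \<le> ennreal (exp c)" for K :: nat
    proof -
      have "cgf P (\<lambda>\<omega>. min (X \<omega>) (real K)) v \<le> ennreal c" unfolding c(1)[symmetric] by (intro SUP_upper) simp
      then show ?thesis using nonneg_rv.cgf_le_iff[OF nonneg_rv_truncated v c(2), of "real K"] by simp
    qed
    then have "mgf P X v \<le> ennreal (exp c)"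
      unfolding mgf_truncated_SUP[OF v, symmetric] by (intro SUP_least)
    then show ?thesis using cgf_le_iff[OF v c(2)] c by simp
  next
    case True
    then show ?thesis by (simp only: top_greatest)
  qed
qed

lemma cgf_integral_truncated_SUP:
  assumes th: "0 \<le> \<theta>" and h [measurable]: "h \<in> borel_measurable borel" and h0: "\<And>s. 0 \<le> h s"
  shows "(SUP K::nat. cgf_integral P (\<lambda>\<omega>. min (X \<omega>) (real K)) h t \<theta>) = cgf_integral P X h t \<theta>"
proof -
  have [measurable]: "cgf P (\<lambda>\<omega>. min (X \<omega>) (real K)) \<in> borel_measurable borel" for K :: nat
    by (rule nonneg_rv.cgf_measurable[OF nonneg_rv_truncated]) simp
  have v: "0 \<le> \<theta> * h s" for s using th h0 by simp
  have "(SUP K::nat. cgf_integral P (\<lambda>\<omega>. min (X \<omega>) (real K)) h t \<theta>)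
     = (\<integral>\<^sup>+ s. (SUP K::nat. cgf P (\<lambda>\<omega>. min (X \<omega>) (real K)) (\<theta> * h s) * indicator {0..t} s) \<partial>lborel)"
    unfolding cgf_integral_def
    by (intro nn_integral_monotone_convergence_SUP[symmetric])
       (auto simp: incseq_def le_fun_def intro!: mult_right_mono cgf_truncated_mono v)
  also have "\<dots> = cgf_integral P X h t \<theta>"
    unfolding cgf_integral_def
    by (intro nn_integral_cong) (simp add: SUP_mult_right_ennreal[symmetric] cgf_truncated_SUP[OF v])
  finally show ?thesis .
qed

end

context bounded_exponential
begin

lemma \<Gamma>_ge_of_tail:
  assumes th: "0 \<le> \<theta>" and q: "0 < prob {\<omega> \<in> space P. x \<le> X \<omega>}"
  shows "\<theta> * x * ((1 - exp (- (\<mu> * t))) / \<mu>) + ln (prob {\<omega> \<in> space P. x \<le> X \<omega>}) * t \<le> \<Gamma> \<theta>"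
proof (rule has_integral_le[OF has_integral_exp_affine[OF mu_pos less_imp_le[OF t_pos]] \<Gamma>_integral[OF th]])
  fix s
  define v where "v = \<theta> * exp (- (\<mu> * s))"
  let ?A = "{\<omega> \<in> space P. x \<le> X \<omega>}"
  have v0: "0 \<le> v" using th by (simp add: v_def)
  have "ennreal (exp (v * x) * prob ?A) = (\<integral>\<^sup>+ \<omega>. ennreal (exp (v * x)) * indicator ?A \<omega> \<partial>P)"
    by (subst nn_integral_cmult_indicator) (auto simp: emeasure_eq_measure ennreal_mult)
  also have "\<dots> \<le> mgf P X v"
    unfolding mgf_def using v0 by (intro nn_integral_mono) (auto simp: indicator_def intro!: ennreal_leI mult_left_mono)
  also have "\<dots> = ennreal (exp (enn2real (cgf P X v)))" by (rule mgf_eq_exp_cgf[OF v0 cgf_finite[OF v0]])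
  finally have "exp (v * x) * prob ?A \<le> exp (enn2real (cgf P X v))" by simp
  then have "ln (exp (v * x) * prob ?A) \<le> ln (exp (enn2real (cgf P X v)))"
    using q by (intro ln_mono) auto
  then have "v * x + ln (prob ?A) \<le> enn2real (cgf P X v)"
    using q by (simp add: ln_mult)
  then show "\<theta> * x * exp (- (\<mu> * s)) + ln (prob ?A) \<le> enn2real (cgf P X (\<theta> * exp (- (\<mu> * s))))"
    by (simp add: v_def mult_ac)
qed

text \<open>The exponent of the level that a constant rate \<open>K\<close> would produce is minus the integral of
  \<open>ln (E exp (v * (X - K)))\<close>, \<open>v = \<theta> * exp (- \<mu> * s)\<close>. The expectation tends to \<open>P(X = K) = 0\<close>
  uniformly in \<open>s\<close> as \<open>\<theta>\<close> grows.\<close>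

lemma exponent_unbounded:
  assumes no_atom: "prob {\<omega> \<in> space P. X \<omega> = K} = 0"
  shows "\<exists>\<theta>>0. B \<le> \<theta> * (K * ((1 - exp (- (\<mu> * t))) / \<mu>)) - \<Gamma> \<theta>"
proof -
  \<comment> \<open>\<open>2 * p\<close> is the value of \<open>E exp (v * (X - K))\<close> at which the exponent reaches \<open>B\<close>\<close>
  define p where "p = exp (- B / t) / 2"
  have p: "0 < p" by (simp add: p_def)
  define A where "A n = {\<omega> \<in> space P. K - 1 / real (Suc n) < X \<omega>}" for n
  have [measurable]: "A n \<in> sets P" for n unfolding A_def by measurable
  have "(\<lambda>n. prob (A n)) \<longlonglongrightarrow> prob (\<Inter>n. A n)"
  proof (rule finite_Lim_measure_decseq)
    show "decseq (\<lambda>n. A n)"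
      unfolding A_def
    proof (rule decseq_SucI, safe)
      fix n \<omega> assume "K - 1 / real (Suc (Suc n)) < X \<omega>"
      moreover have "1 / real (Suc (Suc n)) \<le> 1 / real (Suc n)" by (simp add: frac_le)
      ultimately show "K - 1 / real (Suc n) < X \<omega>" by linarith
    qed
  qed auto
  moreover have "prob (\<Inter>n. A n) = prob {\<omega> \<in> space P. X \<omega> = K}"
  proof (rule finite_measure_eq_AE)
    show "AE \<omega> in P. (\<omega> \<in> (\<Inter>n. A n)) = (\<omega> \<in> {\<omega> \<in> space P. X \<omega> = K})"
      using X_le
    proof eventually_elim
      fix \<omega> assume le: "X \<omega> \<le> K"
      have "X \<omega> = K" if "\<And>n. K - 1 / real (Suc n) < X \<omega>"
      proof (rule ccontr)
        assume "X \<omega> \<noteq> K"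
        then obtain n where "1 / real (Suc n) < K - X \<omega>" using le reals_Archimedean[of "K - X \<omega>"] by (auto simp: inverse_eq_divide)
        then show False using that[of n] by linarith
      qed
      then show "(\<omega> \<in> (\<Inter>n. A n)) = (\<omega> \<in> {\<omega> \<in> space P. X \<omega> = K})"
        by (auto simp: A_def)
    qed
  qed auto
  ultimately have "(\<lambda>n. prob (A n)) \<longlonglongrightarrow> 0" by (simp add: no_atom)
  from order_tendstoD(2)[OF this p] obtain n where n: "prob (A n) < p"
    by (auto simp: eventually_sequentially)
  define \<eta> where "\<eta> = 1 / real (Suc n)"
  have eta: "0 < \<eta>" by (simp add: \<eta>_def)
  define e where "e = exp (- (\<mu> * t))"
  have e: "0 < e" by (simp add: e_def)
  define \<theta> where "\<theta> = max 1 (- ln p / (e * \<eta>))"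
  have th: "0 < \<theta>" by (simp add: \<theta>_def)
  have small: "exp (- v * \<eta>) \<le> p" if "\<theta> * e \<le> v" for v
  proof -
    have "- ln p \<le> \<theta> * (e * \<eta>)"
      using e eta by (subst pos_divide_le_eq[symmetric]) (auto simp: \<theta>_def)
    also have "\<dots> \<le> v * \<eta>" using that eta by (simp add: mult_right_mono flip: mult.assoc)
    finally have "- v * \<eta> \<le> ln p" by simp
    then show ?thesis using p by (metis exp_le_cancel_iff exp_ln)
  qed
  let ?A = "{\<omega> \<in> space P. K - \<eta> < X \<omega>}"
  have pA: "prob ?A < p" using n by (simp add: \<eta>_def A_def)
  have bound: "enn2real (cgf P X v) \<le> v * K + (- B / t)" if v: "\<theta> * e \<le> v" for v
  proof -
    have v0: "0 \<le> v" using v th e by (meson mult_nonneg_nonneg less_imp_le order_trans)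
    have "mgf P X v \<le> (\<integral>\<^sup>+ \<omega>. ennreal (exp (v * K)) * indicator ?A \<omega> + ennreal (exp (v * (K - \<eta>))) \<partial>P)"
      unfolding mgf_def
    proof (intro nn_integral_mono_AE, use X_le AE_space in eventually_elim)
      fix \<omega> assume le: "X \<omega> \<le> K" and w: "\<omega> \<in> space P"
      show "ennreal (exp (v * X \<omega>)) \<le> ennreal (exp (v * K)) * indicator ?A \<omega> + ennreal (exp (v * (K - \<eta>)))"
      proof (cases "K - \<eta> < X \<omega>")
        case True
        have "ennreal (exp (v * X \<omega>)) \<le> ennreal (exp (v * K))" using le v0 by (auto intro!: ennreal_leI mult_left_mono)
        then show ?thesis using True w by (simp add: add_increasing2)
      next
        case False
        then have "ennreal (exp (v * X \<omega>)) \<le> ennreal (exp (v * (K - \<eta>)))" using v0 by (auto intro!: ennreal_leI mult_left_mono)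
        then show ?thesis by (simp add: add_increasing)
      qed
    qed
    also have "\<dots> = ennreal (exp (v * K)) * emeasure P ?A + ennreal (exp (v * (K - \<eta>)))"
      by (subst nn_integral_add) (auto simp: nn_integral_cmult emeasure_space_1)
    also have "\<dots> = ennreal (exp (v * K) * (prob ?A + exp (- v * \<eta>)))"
      by (simp add: emeasure_eq_measure ring_distribs exp_diff exp_minus divide_inverse ennreal_mult ennreal_plus)
    also have "\<dots> \<le> ennreal (exp (v * K) * (p + p))"
      using pA small[OF v] by (intro ennreal_leI mult_left_mono add_mono) auto
    also have "exp (v * K) * (p + p) = exp (v * K + (- B / t))" by (simp only: exp_add) (simp add: p_def)
    finally have "mgf P X v \<le> ennreal (exp (v * K + (- B / t)))" .
    then have "exp (enn2real (cgf P X v)) \<le> exp (v * K + (- B / t))"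
      by (simp add: mgf_eq_exp_cgf[OF v0 cgf_finite[OF v0]])
    then show ?thesis by simp
  qed
  have "\<Gamma> \<theta> \<le> \<theta> * K * ((1 - exp (- (\<mu> * t))) / \<mu>) + (- B / t) * t"
  proof (rule has_integral_le[OF \<Gamma>_integral[OF less_imp_le[OF th]] has_integral_exp_affine[OF mu_pos less_imp_le[OF t_pos]]])
    fix s assume s: "s \<in> {0..t}"
    have "\<theta> * e \<le> \<theta> * exp (- (\<mu> * s))" using s th mu_pos by (simp add: e_def)
    from bound[OF this]
    show "enn2real (cgf P X (\<theta> * exp (- (\<mu> * s)))) \<le> \<theta> * K * exp (- (\<mu> * s)) + (- B / t)"
      by (simp add: mult_ac)
  qed
  then show ?thesis using th t_pos by (intro exI[of _ \<theta>]) (simp add: mult_ac)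
qed

end

text \<open>A tail beyond the level \<open>a\<close> makes the truncated exponents nonpositive at a common \<open>R\<close>, so their
  suprema may be taken over the compact interval \<open>{0..R}\<close>. There they decrease in \<open>K\<close> to the exponent
  of \<open>X\<close>, which is at most \<open>I\<close>. If all truncated suprema exceeded some \<open>c' > I\<close>, a cluster point of their
  maximisers would contradict this. The limit may be \<open>- \<infinity>\<close> for all positive \<open>\<theta>\<close>;
  then the supremum is the value 0 at \<open>\<theta> = 0\<close>, whence the hypothesis \<open>I \<ge> 0\<close>.\<close>

lemma truncated_exponent_witness:
  assumes X: "nonneg_rv P X" and int: "integrable P X" and mu: "0 < \<mu>" and t: "0 < t"
    and rho: "(LINT \<omega>|P. X \<omega>) / \<mu> * (1 - exp (- (\<mu> * t))) < a" and a: "0 \<le> a"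
    and x: "a < x * ((1 - exp (- (\<mu> * t))) / \<mu>)" and q: "0 < measure P {\<omega> \<in> space P. x \<le> X \<omega>}"
    and I: "\<And>\<theta>. 0 < \<theta> \<Longrightarrow> ereal (\<theta> * a) - enn2ereal (cgf_integral P X (\<lambda>s. exp (- (\<mu> * s))) t \<theta>) \<le> ereal I"
    and I0: "0 \<le> I" and c: "I < c"
  obtains K :: nat and b \<theta> where "a < b" "0 < \<theta>"
    "((\<lambda>\<theta>. enn2real (cgf_integral P (\<lambda>\<omega>. min (X \<omega>) (real K)) (\<lambda>s. exp (- (\<mu> * s))) t \<theta>)) has_real_derivative b) (at \<theta>)"
    "\<theta> * b - enn2real (cgf_integral P (\<lambda>\<omega>. min (X \<omega>) (real K)) (\<lambda>s. exp (- (\<mu> * s))) t \<theta>) < c"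
proof -
  interpret nonneg_rv P X by fact
  define h where "h = (\<lambda>s. exp (- (\<mu> * s)))"
  define XK where "XK K = (\<lambda>\<omega>. min (X \<omega>) (real K))" for K :: nat
  define G where "G K \<theta> = enn2real (cgf_integral P (XK K) h t \<theta>)" for K \<theta>
  define u where "u = (1 - exp (- (\<mu> * t))) / \<mu>"
  have be: "bounded_exponential P (XK K) (real K) \<mu> t" for K
    unfolding XK_def bounded_exponential_def bounded_exponential_axioms_def
    using truncated_rv[of "real K"] mu t by simp
  have bd: "bounded_discount P (XK K) (real K) h \<mu> t" for K
    using be[of K] forward_discount[OF mu t] by (simp add: bounded_discount_def bounded_exponential_def h_def)
  have G_eq: "G K = bounded_discount.\<Gamma> P (XK K) h t" for K
    by (simp add: fun_eq_iff G_def bounded_discount.\<Gamma>_def[OF bd])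
  have G_cont: "continuous_on {0..} (G K)" for K
    unfolding G_eq by (rule bounded_discount.\<Gamma>_continuous[OF bd])
  have G_int: "cgf_integral P (XK K) h t \<theta> = ennreal (G K \<theta>)" if "0 \<le> \<theta>" for K \<theta>
    unfolding G_eq by (rule bounded_discount.cgf_integral_eq[OF bd that])
  have G0: "0 \<le> G K \<theta>" "G K 0 = 0" for K \<theta>
    unfolding G_eq by (rule bounded_discount.\<Gamma>_nonneg[OF bd], rule bounded_discount.\<Gamma>_0[OF bd])
  have G_mono: "G K \<theta> \<le> G K' \<theta>" if "K \<le> K'" "0 \<le> \<theta>" for K K' \<theta>
  proof -
    have "cgf_integral P (XK K) h t \<theta> \<le> cgf_integral P (XK K') h t \<theta>"
      unfolding cgf_integral_def XK_def h_def using that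
      by (intro nn_integral_mono mult_right_mono cgf_truncated_mono) auto
    then show ?thesis using that by (simp add: G_int G0)
  qed
  have G_SUP: "(SUP K. ennreal (G K \<theta>)) = cgf_integral P X h t \<theta>" if "0 \<le> \<theta>" for \<theta>
    unfolding G_int[OF that, symmetric] XK_def h_def by (rule cgf_integral_truncated_SUP[OF that]) auto

  define q where "q = prob {\<omega> \<in> space P. x \<le> X \<omega>}"
  define b0 where "b0 = (a + x * u) / 2"
  have b0: "a < b0" "b0 < x * u" using x[folded u_def] by (simp_all add: b0_def mult.commute)
  \<comment> \<open>the tail estimate \<open>R * (x * u) + ln q * t\<close> for \<open>G K R\<close> exceeds \<open>R * b0\<close> from here on\<close>
  define R where "R = - (ln q * t) / (x * u - b0) + 1"
  have q01: "0 < q" "q \<le> 1" using q by (auto simp: q_def)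
  have "0 \<le> - (ln q * t)" using q01 t by (simp add: mult_nonpos_nonneg)
  then have R: "0 < R" using b0 unfolding R_def by (intro add_nonneg_pos divide_nonneg_pos) auto
  define K0 where "K0 = nat \<lceil>x\<rceil>"
  have xK0: "x \<le> real K0" by (simp add: K0_def real_nat_ceiling_ge)
  have coercive: "R * b0 \<le> G K R" if "K0 \<le> K" for K
  proof -
    have "x \<le> real K" using xK0 that by simp
    then have eq: "{\<omega> \<in> space P. x \<le> XK K \<omega>} = {\<omega> \<in> space P. x \<le> X \<omega>}" by (auto simp: XK_def)
    have "R * x * u + ln q * t \<le> G K R"
      using bounded_exponential.\<Gamma>_ge_of_tail[OF be, of R x K] R q01(1)
      unfolding eq q_def[symmetric] u_def[symmetric] h_def[symmetric] G_eq[symmetric] by simp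
    moreover have "(R - 1) * (x * u - b0) = - (ln q * t)" using b0 by (simp add: R_def)
    ultimately show ?thesis using b0 by (simp add: algebra_simps)
  qed

  define c' where "c' = (I + c) / 2"
  have c': "I < c'" "c' < c" using c by (auto simp: c'_def)
  have "\<exists>K\<ge>K0. \<forall>\<theta>\<in>{0..R}. \<theta> * a - G K \<theta> < c'"
  proof (rule ccontr)
    assume "\<not> ?thesis"
    then have "\<forall>K. \<exists>\<theta>. \<theta> \<in> {0..R} \<and> c' \<le> \<theta> * a - G (K0 + K) \<theta>"
      by (meson le_add1 not_less)
    then obtain T where T: "\<And>K. T K \<in> {0..R}" "\<And>K. c' \<le> T K * a - G (K0 + K) (T K)" by metis
    obtain \<theta> r where th: "\<theta> \<in> {0..R}" and r: "strict_mono r" and lim: "(T \<circ> r) \<longlonglongrightarrow> \<theta>"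
      using compact_Icc[of 0 R] T(1) unfolding compact_def by metis
    have ge: "c' \<le> \<theta> * a - G K \<theta>" for K
    proof (rule tendsto_lowerbound)
      have "(\<lambda>n. G K ((T \<circ> r) n)) \<longlonglongrightarrow> G K \<theta>"
        by (rule continuous_on_tendsto_compose[OF G_cont lim]) (use th T(1) in auto)
      then show "(\<lambda>n. (T \<circ> r) n * a - G K ((T \<circ> r) n)) \<longlonglongrightarrow> \<theta> * a - G K \<theta>"
        by (intro tendsto_diff tendsto_mult lim tendsto_const)
      show "\<forall>\<^sub>F n in sequentially. c' \<le> (T \<circ> r) n * a - G K ((T \<circ> r) n)"
        using eventually_ge_at_top[of K]
      proof eventually_elim
        fix n assume "K \<le> n"
        then have "K \<le> K0 + r n" using seq_suble[OF r, of n] by simp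
        then have "G K (T (r n)) \<le> G (K0 + r n) (T (r n))" using T(1)[of "r n"] by (intro G_mono) auto
        then show "c' \<le> (T \<circ> r) n * a - G K ((T \<circ> r) n)" using T(2)[of "r n"] by simp
      qed
    qed simp
    have th0: "0 < \<theta>"
      using ge[of 0] th c' I0 by (cases "\<theta> = 0") (auto simp: G0)
    have "cgf_integral P X h t \<theta> \<le> ennreal (\<theta> * a - c')"
      unfolding G_SUP[OF less_imp_le[OF th0], symmetric]
      by (intro SUP_least ennreal_leI) (use ge in \<open>simp add: algebra_simps\<close>)
    moreover have nn: "0 \<le> \<theta> * a - c'" using ge[of 0] G0(1)[of 0 \<theta>] by simp
    ultimately have "enn2ereal (cgf_integral P X h t \<theta>) \<le> ereal (\<theta> * a - c')"
      by (metis enn2ereal_ennreal less_eq_ennreal.rep_eq)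
    then have "ereal (\<theta> * a) - ereal (\<theta> * a - c') \<le> ereal (\<theta> * a) - enn2ereal (cgf_integral P X h t \<theta>)"
      by (intro ereal_minus_mono) auto
    also have "\<dots> \<le> ereal I" using I[OF th0] by (simp add: h_def)
    finally show False using c' by simp
  qed
  then obtain K where K: "K0 \<le> K" "\<And>\<theta>. \<theta> \<in> {0..R} \<Longrightarrow> \<theta> * a - G K \<theta> < c'" by auto
  \<comment> \<open>raising the level from \<open>a\<close> to \<open>b\<close> changes the exponent by at most \<open>R * (b - a)\<close> on \<open>{0..R}\<close>\<close>
  define b where "b = min b0 (a + (c - c') / R)"
  have b: "a < b" "b \<le> b0" using b0 c' R by (auto simp: b_def)
  have "b - a \<le> (c - c') / R" by (simp add: b_def min_le_iff_disj)
  then have Rb: "R * (b - a) \<le> c - c'" using R by (simp add: pos_le_divide_eq mult.commute)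
  have intK: "integrable P (XK K)"
    unfolding XK_def using int by (rule Bochner_Integration.integrable_bound) (use X_nonneg in \<open>auto elim!: eventually_mono\<close>)
  have "expectation (XK K) \<le> expectation X"
    using intK int by (intro integral_mono) (auto simp: XK_def)
  then have "expectation (XK K) / \<mu> * (1 - exp (- (\<mu> * t))) \<le> expectation X / \<mu> * (1 - exp (- (\<mu> * t)))"
    using mu t by (intro mult_right_mono divide_right_mono) auto
  then have mean: "expectation (XK K) / \<mu> * (1 - exp (- (\<mu> * t))) < b" using rho b by linarith
  have "R * b \<le> R * b0" using b R by (intro mult_left_mono) auto
  then have end_neg: "R * b - G K R \<le> 0" using coercive[OF K(1)] by linarith
  obtain \<theta> where th: "0 < \<theta>" "\<theta> < R" "(G K has_real_derivative b) (at \<theta>)"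
    using bounded_exponential.exponent_maximiser[OF be mean R] end_neg
    unfolding h_def[symmetric] G_eq[symmetric] by blast
  have "\<theta> * b - G K \<theta> = (\<theta> * a - G K \<theta>) + \<theta> * (b - a)" by (simp add: algebra_simps)
  also have "\<dots> < c' + R * (b - a)"
    using K(2)[of \<theta>] th b by (intro add_less_le_mono mult_right_mono) auto
  also have "\<dots> \<le> c" using Rb by simp
  finally have "\<theta> * b - G K \<theta> < c" .
  with th b show ?thesis
    by (intro that[of b \<theta> K]) (simp_all add: G_def[abs_def] XK_def h_def)
qed

section \<open>Tails of mixed Poisson random variables\<close>

lemma poisson_gap_pos:
  assumes "0 < a" "a < (b :: real)" shows "0 < b - a - a * ln (b / a)"
proof -
  have "ln (1 + (b / a - 1)) < b / a - 1" using assms by (intro ln_add_one_self_less_self) simp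
  then have "a * ln (b / a) < a * (b / a - 1)" using assms by (intro mult_strict_left_mono) auto
  then show ?thesis using assms by (simp add: right_diff_distrib)
qed

text \<open>Where the parameter exceeds \<open>b n\<close>, the Poisson variable misses the smaller level \<open>a n\<close> only with
  probability exponentially small in \<open>n\<close>.\<close>

lemma mixed_poisson_tail_ge:
  assumes W: "nonneg_rv P W" and mp: "mixed_poisson P M (distr P borel (\<lambda>\<omega>. real n * W \<omega>))"
    and n: "0 < n" and a: "0 < a" "a < b"
  shows "(1 - exp (- (b - a - a * ln (b / a)) * real n)) * measure P {\<omega> \<in> space P. b < W \<omega>}
    \<le> measure P {\<omega> \<in> space P. a \<le> real (M \<omega>) / real n}"
proof -
  interpret nonneg_rv P W by fact
  have R: "(\<lambda>\<omega>. real n * W \<omega>) \<in> borel_measurable P" "AE \<omega> in P. 0 \<le> real n * W \<omega>"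
    using X_nonneg by (auto elim: eventually_mono)
  have M [measurable]: "M \<in> measurable P (count_space UNIV)" using mp by (simp add: mixed_poisson_def)
  define e where "e = exp (- (b - a - a * ln (b / a)) * real n)"
  have e: "0 < e" "e \<le> 1" 
  proof -
    have "0 \<le> (b - a - a * ln (b / a)) * real n" using poisson_gap_pos[OF a] by (intro mult_nonneg_nonneg) auto
    then show "e \<le> 1" unfolding e_def minus_mult_left[symmetric] by simp
  qed (simp add: e_def)
  let ?A = "{\<omega> \<in> space P. a \<le> real (M \<omega>) / real n}"
  let ?B = "{\<omega> \<in> space P. b < W \<omega>}"
  have "ennreal ((1 - e) * prob ?B) = (\<integral>\<^sup>+ \<omega>. ennreal (1 - e) * indicator ?B \<omega> \<partial>P)"
    using e by (subst nn_integral_cmult_indicator) (auto simp: emeasure_eq_measure ennreal_mult)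
  also have "\<dots> \<le> (\<integral>\<^sup>+ \<omega>. (\<Sum>k. indicator {k. a * real n \<le> real k} k * ennreal (poisson_mass (real n * W \<omega>) k)) \<partial>P)"
  proof (intro nn_integral_mono)
    fix \<omega> assume "\<omega> \<in> space P"
    define S where "S = (\<Sum>k. indicator {k. a * real n \<le> real k} k * ennreal (poisson_mass (real n * W \<omega>) k))"
    show "ennreal (1 - e) * indicator ?B \<omega> \<le> S"
    proof (cases "\<omega> \<in> ?B")
      case True
      have "1 \<le> S + ennreal e"
        unfolding S_def e_def using True n by (intro poisson_lower_tail a) (auto simp: mult.commute)
      then have "ennreal (1 - e) \<le> S"
      proof (cases S)
        case (real r)
        from \<open>1 \<le> S + ennreal e\<close> show ?thesis
          using e real by (simp add: ennreal_leI flip: ennreal_plus ennreal_1)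
      qed simp
      then show ?thesis using True by simp
    qed simp
  qed
  also have "\<dots> = (\<integral>\<^sup>+ \<omega>. indicator {k. a * real n \<le> real k} (M \<omega>) \<partial>P)"
    by (rule mixed_poisson_nn_integral[OF prob_space_axioms mp R, symmetric])
  also have "\<dots> = (\<integral>\<^sup>+ \<omega>. indicator ?A \<omega> \<partial>P)"
    using n by (intro nn_integral_cong) (auto simp: indicator_def pos_le_divide_eq)
  also have "\<dots> = ennreal (prob ?A)" by (simp add: emeasure_eq_measure)
  finally show ?thesis by (simp add: e_def)
qed

text \<open>Markov's inequality for \<open>z ^ M\<close> with \<open>z = 1 + s / n\<close>: then \<open>(z - 1) * (n * W) = s * W\<close>, and
  \<open>z powr (- a * n)\<close> equals \<open>exp (- a * s)\<close> up to the quadratic error of the logarithm. For \<open>s\<close> of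
  order \<open>1 / \<delta>\<close> this error is of lower order as soon as \<open>n * \<delta>\<close> tends to infinity.\<close>

lemma mixed_poisson_tail_le:
  assumes W: "nonneg_rv P W" and mp: "mixed_poisson P M (distr P borel (\<lambda>\<omega>. real n * W \<omega>))"
    and n: "0 < n" and a: "0 \<le> a" and s: "0 \<le> s" "s \<le> real n"
  shows "emeasure P {\<omega> \<in> space P. a \<le> real (M \<omega>) / real n}
    \<le> ennreal (exp (- a * s + a * s\<^sup>2 / real n)) * mgf P W s"
proof -
  interpret nonneg_rv P W by fact
  have R: "(\<lambda>\<omega>. real n * W \<omega>) \<in> borel_measurable P" "AE \<omega> in P. 0 \<le> real n * W \<omega>"
    using X_nonneg by (auto elim: eventually_mono)
  have M [measurable]: "M \<in> measurable P (count_space UNIV)" using mp by (simp add: mixed_poisson_def)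
  define z where "z = 1 + s / real n"
  have z: "1 \<le> z" using s n by (simp add: z_def)
  define C where "C = exp (- a * s + a * s\<^sup>2 / real n)"
  have zC: "z powr (- a * real n) \<le> C"
  proof -
    have "s / real n - (s / real n)\<^sup>2 \<le> ln z"
      unfolding z_def using s n by (intro ln_one_plus_pos_lower_bound) auto
    then have "- a * real n * ln z \<le> - a * real n * (s / real n - (s / real n)\<^sup>2)"
      using a by (intro mult_left_mono_neg) (auto simp: mult_nonpos_nonneg)
    also have "\<dots> = - a * s + a * s\<^sup>2 / real n"
      using n by (simp add: power2_eq_square right_diff_distrib)
    finally show ?thesis using z by (simp add: powr_def C_def)
  qed
  let ?A = "{\<omega> \<in> space P. a \<le> real (M \<omega>) / real n}"
  have "emeasure P ?A = (\<integral>\<^sup>+ \<omega>. indicator ?A \<omega> \<partial>P)" by simp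
  also have "\<dots> \<le> (\<integral>\<^sup>+ \<omega>. ennreal C * ennreal (z ^ M \<omega>) \<partial>P)"
  proof (intro nn_integral_mono)
    fix \<omega>
    show "indicator ?A \<omega> \<le> ennreal C * ennreal (z ^ M \<omega>)"
    proof (cases "\<omega> \<in> ?A")
      case True
      then have "a * real n \<le> real (M \<omega>)" using n by (simp add: pos_le_divide_eq)
      then have "1 \<le> z powr (- a * real n + real (M \<omega>))" using z by (intro ge_one_powr_ge_zero) auto
      also have "\<dots> = z powr (- a * real n) * z ^ M \<omega>" using z by (subst powr_add) (simp add: powr_realpow)
      also have "\<dots> \<le> C * z ^ M \<omega>" using zC z by (intro mult_right_mono) auto
      finally have "ennreal 1 \<le> ennreal (C * z ^ M \<omega>)" by (rule ennreal_leI)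
      then show ?thesis using True z by (simp add: ennreal_mult C_def)
    qed simp
  qed
  also have "\<dots> = ennreal C * mgf P W s"
    using mixed_poisson_generating_function[OF prob_space_axioms mp R, of z] z n
    by (simp add: nn_integral_cmult mgf_def z_def)
  finally show ?thesis by (simp add: C_def)
qed

section \<open>The large deviation limit\<close>

lemma copies_nonneg:
  assumes X: "nonneg_rv P X" and L [measurable]: "\<And>j :: nat. L j \<in> borel_measurable P"
    and copies: "\<And>j. distr P borel (L j) = distr P borel X"
  shows "AE \<omega> in P. \<forall>j. 0 \<le> L j \<omega>"
proof (subst AE_all_countable, rule allI)
  fix j
  interpret nonneg_rv P X by fact
  have iff: "(AE x in distr P borel Y. 0 \<le> x) \<longleftrightarrow> (AE \<omega> in P. 0 \<le> Y \<omega>)"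
    if "Y \<in> borel_measurable P" for Y :: "_ \<Rightarrow> real"
    using that by (subst AE_distr_iff) auto
  show "AE \<omega> in P. 0 \<le> L j \<omega>"
    using X_nonneg iff[OF X_measurable] iff[OF L[of j]] by (simp only: copies)
qed

lemma (in discount) weighted_slots_lower_bound:
  assumes X: "nonneg_rv P X" and ind: "prob_space.indep_vars P (\<lambda>_. borel) L (UNIV :: nat set)"
    and copies: "\<And>j. distr P borel (L j) = distr P borel X"
    and d: "\<And>N. 0 < \<delta> N" and dlim: "\<delta> \<longlonglongrightarrow> 0" and K: "0 \<le> K"
    and th: "0 < \<theta>"
    and D: "((\<lambda>\<theta>. enn2real (cgf_integral P (\<lambda>\<omega>. min (X \<omega>) K) h t \<theta>)) has_real_derivative b) (at \<theta>)"
    and c: "\<theta> * b - enn2real (cgf_integral P (\<lambda>\<omega>. min (X \<omega>) K) h t \<theta>) < c" and b': "b' < b"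
  shows "\<forall>\<^sub>F N in sequentially. exp (- c / \<delta> N)
    \<le> measure P {\<omega> \<in> space P. b' < (\<Sum>j<n_slots t (\<delta> N). slot_weight h t (\<delta> N) j * L j \<omega>)}"
proof -
  interpret nonneg_rv P X by fact
  have L [measurable]: "L j \<in> borel_measurable P" for j using ind by (auto simp: indep_vars_def)
  interpret B: bounded_discount P "\<lambda>\<omega>. min (X \<omega>) K" K h \<mu> t
    using truncated_rv[OF K] discount_axioms by (simp add: bounded_discount_def)
  define W where "W N \<omega> = (\<Sum>j<n_slots t (\<delta> N). slot_weight h t (\<delta> N) j * min (L j \<omega>) K)" for N \<omega>
  have indK: "indep_vars (\<lambda>_. borel) (\<lambda>j \<omega>. min (L j \<omega>) K) UNIV"
    by (rule indep_vars_compose2[OF ind, where Y = "\<lambda>_ x. min x K"]) simp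
  have copiesK: "distr P borel (\<lambda>\<omega>. min (L j \<omega>) K) = distr P borel (\<lambda>\<omega>. min (X \<omega>) K)" for j
  proof -
    have "distr P borel (\<lambda>\<omega>. min (Y \<omega>) K) = distr (distr P borel Y) borel (\<lambda>x. min x K)"
      if "Y \<in> borel_measurable P" for Y
      using that by (subst distr_distr) (auto simp: o_def)
    then show ?thesis by (simp add: copies)
  qed
  have L0: "AE \<omega> in P. \<forall>j. 0 \<le> min (L j \<omega>) K"
    using copies_nonneg[OF X L copies] by eventually_elim (use K in auto)
  have W: "nonneg_rv P (W N)" for N
  proof
    show "W N \<in> borel_measurable P" unfolding W_def by measurable
    show "AE \<omega> in P. 0 \<le> W N \<omega>"
      using L0 unfolding W_def by eventually_elim (auto intro!: sum_nonneg mult_nonneg_nonneg slot_weight_nonneg)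
  qed
  have "\<forall>\<^sub>F N in sequentially. exp (- c / \<delta> N) \<le> prob {\<omega> \<in> space P. b' < W N \<omega>}"
  proof (rule exponential_tilting_lower_bound[OF W d dlim])
    show "cgf P (W N) (\<theta> / \<delta> N) \<noteq> top" if "0 < \<theta>" for N \<theta>
      unfolding W_def by (rule B.cgf_weighted_slots_tendsto(1)[OF indK copiesK d dlim]) (use that in simp)
    show "(\<lambda>N. \<delta> N * enn2real (cgf P (W N) (\<theta> / \<delta> N))) \<longlonglongrightarrow> B.\<Gamma> \<theta>" if "0 < \<theta>" for \<theta>
      unfolding W_def by (rule B.cgf_weighted_slots_tendsto(2)[OF indK copiesK d dlim]) (use that in simp)
    show "(B.\<Gamma> has_real_derivative b) (at \<theta>)" using D by (simp add: B.\<Gamma>_def[abs_def])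
    show "\<theta> * b - B.\<Gamma> \<theta> < c" using c by (simp add: B.\<Gamma>_def)
  qed (use th b' in auto)
  then show ?thesis
  proof eventually_elim
    fix N assume "exp (- c / \<delta> N) \<le> prob {\<omega> \<in> space P. b' < W N \<omega>}"
    also have "\<dots> \<le> prob {\<omega> \<in> space P. b' < (\<Sum>j<n_slots t (\<delta> N). slot_weight h t (\<delta> N) j * L j \<omega>)}"
    proof (rule finite_measure_mono)
      have "W N \<omega> \<le> (\<Sum>j<n_slots t (\<delta> N). slot_weight h t (\<delta> N) j * L j \<omega>)" for \<omega>
        unfolding W_def by (intro sum_mono mult_left_mono slot_weight_nonneg) auto
      then show "{\<omega> \<in> space P. b' < W N \<omega>}
          \<subseteq> {\<omega> \<in> space P. b' < (\<Sum>j<n_slots t (\<delta> N). slot_weight h t (\<delta> N) j * L j \<omega>)}"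
        by (auto intro: less_le_trans)
    qed measurable
    finally show "exp (- c / \<delta> N)
      \<le> prob {\<omega> \<in> space P. b' < (\<Sum>j<n_slots t (\<delta> N). slot_weight h t (\<delta> N) j * L j \<omega>)}" .
  qed
qed

lemma elog_le: "x \<le> ennreal (exp y) \<Longrightarrow> elog x \<le> ereal y"
proof -
  assume x: "x \<le> ennreal (exp y)"
  then have "x \<noteq> top" by (auto simp: top_unique)
  show ?thesis
  proof (cases "x = 0")
    case False
    with \<open>x \<noteq> top\<close> obtain r where r: "x = ennreal r" "0 < r" by (cases x) (auto simp: less_le)
    then have "r \<le> exp y" using x by simp
    then have "ln r \<le> y" using r by (metis exp_le_cancel_iff exp_ln)
    then show ?thesis using r False by (simp add: elog_def)
  qed (simp add: elog_def)
qed

lemma elog_ge: "exp y \<le> x \<Longrightarrow> ereal y \<le> elog (ennreal x)"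
proof -
  assume x: "exp y \<le> x"
  then have "0 < x" by (meson exp_gt_zero less_le_trans)
  with x have "y \<le> ln x" by (metis exp_le_cancel_iff exp_ln)
  then show ?thesis using \<open>0 < x\<close> by (simp add: elog_def)
qed

lemma ld_exponent_cgf_integral:
  "ld_exponent P X \<mu> t a \<theta> = ereal (\<theta> * a) - enn2ereal (cgf_integral P X (\<lambda>s. exp (- (\<mu> * s))) t \<theta>)"
  by (simp add: ld_exponent_def cgf_integral_def cgf_def ennlog_def)

text \<open>If no level \<open>x\<close> that suffices for \<open>a\<close> has a tail, then \<open>X\<close> is bounded by the level that just
  suffices, and the preceding estimate for bounded variables applies there.\<close>

lemma ld_exponent_unbounded:
  assumes X: "nonneg_rv P X" and mu: "0 < \<mu>" and t: "0 < t" and a: "0 < a"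
    and no_atoms: "\<And>x. measure P {\<omega> \<in> space P. X \<omega> = x} = 0"
    and tail: "\<And>x. a < x * ((1 - exp (- (\<mu> * t))) / \<mu>) \<Longrightarrow> measure P {\<omega> \<in> space P. x \<le> X \<omega>} = 0"
  shows "(SUP \<theta>\<in>{0<..}. ld_exponent P X \<mu> t a \<theta>) = \<infinity>"
proof (rule ereal_top)
  fix B
  interpret nonneg_rv P X by fact
  define u where "u = (1 - exp (- (\<mu> * t))) / \<mu>"
  have u: "0 < u" using mu t by (simp add: u_def)
  define y where "y = a / u"
  have y: "0 < y" "y * u = a" using a u by (auto simp: y_def)
  have "AE \<omega> in P. \<forall>n. X \<omega> < y + 1 / real (Suc n)"
  proof (subst AE_all_countable, rule allI)
    fix n
    have "y * u < (y + 1 / real (Suc n)) * u" using u by (intro mult_strict_right_mono) auto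
    then have "prob {\<omega> \<in> space P. y + 1 / real (Suc n) \<le> X \<omega>} = 0" using y by (intro tail) (simp add: u_def)
    then have "AE \<omega> in P. \<not> y + 1 / real (Suc n) \<le> X \<omega>"
      by (subst (asm) prob_eq_0) (auto elim: eventually_mono)
    then show "AE \<omega> in P. X \<omega> < y + 1 / real (Suc n)" by (simp add: not_le)
  qed
  then have le: "AE \<omega> in P. X \<omega> \<le> y"
  proof eventually_elim
    fix \<omega> assume *: "\<forall>n. X \<omega> < y + 1 / real (Suc n)"
    show "X \<omega> \<le> y"
    proof (rule ccontr)
      assume "\<not> X \<omega> \<le> y"
      then obtain n where "1 / real (Suc n) < X \<omega> - y" using reals_Archimedean[of "X \<omega> - y"] by (auto simp: inverse_eq_divide)
      with * show False by (auto dest: spec[of _ n])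
    qed
  qed
  interpret B: bounded_exponential P X y \<mu> t
    by unfold_locales (use le y mu t in auto)
  obtain \<theta> where th: "0 < \<theta>" "B \<le> \<theta> * (y * u) - B.\<Gamma> \<theta>"
    using B.exponent_unbounded[OF no_atoms] unfolding u_def by blast
  have "ereal B \<le> ereal (\<theta> * a) - ereal (B.\<Gamma> \<theta>)" using th y by simp
  also have "\<dots> = ld_exponent P X \<mu> t a \<theta>"
    using th B.cgf_integral_eq[of \<theta>] B.\<Gamma>_nonneg[of \<theta>] by (simp add: ld_exponent_cgf_integral enn2ereal_ennreal)
  also have "\<dots> \<le> (SUP \<theta>\<in>{0<..}. ld_exponent P X \<mu> t a \<theta>)" using th by (intro SUP_upper) auto
  finally show "ereal B \<le> (SUP \<theta>\<in>{0<..}. ld_exponent P X \<mu> t a \<theta>)" .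
qed

text \<open>Both descriptions of the queue length are instances, with the two discounts. The levels \<open>c\<close> below
  and above the rate are treated by Chernoff's bound and by tilting a truncated rate.\<close>

lemma (in discount) mixed_poisson_queue_large_deviation:
  assumes X: "nonneg_rv P X" and int: "integrable P X"
    and ind: "prob_space.indep_vars P (\<lambda>_. borel) L (UNIV :: nat set)"
    and copies: "\<And>j. distr P borel (L j) = distr P borel X"
    and no_atoms: "\<And>x. measure P {\<omega> \<in> space P. X \<omega> = x} = 0"
    and reflect: "\<And>Y \<theta>. nonneg_rv P Y \<Longrightarrow>
        cgf_integral P Y h t \<theta> = cgf_integral P Y (\<lambda>s. exp (- (\<mu> * s))) t \<theta>"
    and Delta: "0 < \<Delta>" and alpha: "0 < \<alpha>" "\<alpha> < 1"
    and M: "\<And>N. 1 \<le> N \<Longrightarrow> mixed_poisson P (M N)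
        (distr P borel (\<lambda>\<omega>. real N * (LINT s:{0..t}|lborel. env_rate \<Delta> \<alpha> L N s \<omega> * h s)))"
    and rho: "(LINT \<omega>|P. X \<omega>) / \<mu> * (1 - exp (- (\<mu> * t))) < a"
  shows "((\<lambda>N. ereal (\<Delta> * real N powr (- \<alpha>)) *
               elog (emeasure P {\<omega> \<in> space P. real (M N \<omega>) / real N \<ge> a}))
          \<longlongrightarrow> - max 0 (SUP \<theta>\<in>{0<..}. ld_exponent P X \<mu> t a \<theta>)) sequentially"
proof -
  interpret nonneg_rv P X by fact
  define S where "S = (SUP \<theta>\<in>{0<..}. ld_exponent P X \<mu> t a \<theta>)"
  have "0 \<le> expectation X" using X_nonneg by (rule integral_nonneg_AE)
  then have "0 \<le> expectation X / \<mu> * (1 - exp (- (\<mu> * t)))" using mu t by simp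
  then have a: "0 < a" using rho by simp
  have L [measurable]: "L j \<in> borel_measurable P" for j using ind by (auto simp: indep_vars_def)
  \<comment> \<open>shifted by one because the slot length for \<open>N = 0\<close> is 0\<close>
  define \<delta> where "\<delta> N = slot_length \<Delta> \<alpha> (Suc N)" for N
  define W where "W N \<omega> = (\<Sum>j<n_slots t (\<delta> N). slot_weight h t (\<delta> N) j * L j \<omega>)" for N \<omega>
  define A where "A N = {\<omega> \<in> space P. a \<le> real (M (Suc N) \<omega>) / real (Suc N)}" for N
  have d: "0 < \<delta> N" for N using Delta by (simp add: \<delta>_def slot_length_def)
  have Suc_lim: "filterlim (\<lambda>N. real (Suc N)) at_top sequentially"
    by (rule filterlim_compose[OF filterlim_real_sequentially filterlim_Suc])
  have dlim: "\<delta> \<longlonglongrightarrow> 0"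
  proof -
    have "(\<lambda>N. real (Suc N) powr (- \<alpha>)) \<longlonglongrightarrow> 0"
      using alpha by (intro tendsto_neg_powr Suc_lim) auto
    from tendsto_mult_left[OF this, of \<Delta>] show ?thesis by (simp add: \<delta>_def[abs_def] slot_length_def)
  qed
  have load: "(\<lambda>N. 1 / (\<delta> N * real (Suc N))) \<longlonglongrightarrow> 0"
  proof -
    have "(\<lambda>N. real (Suc N) powr (- (1 - \<alpha>))) \<longlonglongrightarrow> 0"
      using alpha by (intro tendsto_neg_powr Suc_lim) auto
    from tendsto_mult_left[OF this, of "1 / \<Delta>"]
    have "(\<lambda>N. 1 / \<Delta> * real (Suc N) powr (- (1 - \<alpha>))) \<longlonglongrightarrow> 0" by simp
    moreover have "1 / \<Delta> * real (Suc N) powr (- (1 - \<alpha>)) = 1 / (\<delta> N * real (Suc N))" for N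
    proof -
      have "real (Suc N) powr (1 - \<alpha>) = real (Suc N) powr (- \<alpha>) * real (Suc N)"
        using powr_add[of "real (Suc N)" "- \<alpha>" 1] by (simp add: powr_one)
      moreover have "1 / \<Delta> * real (Suc N) powr (- (1 - \<alpha>)) = 1 / (\<Delta> * real (Suc N) powr (1 - \<alpha>))"
        by (subst powr_minus_divide) simp
      ultimately show ?thesis by (simp only: \<delta>_def slot_length_def mult.assoc)
    qed
    ultimately show ?thesis by (simp only:)
  qed
  have W: "nonneg_rv P (W N)" for N
  proof
    show "W N \<in> borel_measurable P" unfolding W_def by measurable
    show "AE \<omega> in P. 0 \<le> W N \<omega>"
      using copies_nonneg[OF X L copies] unfolding W_def
      by eventually_elim (auto intro!: sum_nonneg mult_nonneg_nonneg slot_weight_nonneg)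
  qed
  have mp: "mixed_poisson P (M (Suc N)) (distr P borel (\<lambda>\<omega>. real (Suc N) * W N \<omega>))" for N
    using M[of "Suc N"] env_rate_integral[of \<Delta> \<alpha> "Suc N" L] d[of N] by (simp add: W_def \<delta>_def)
  have A [measurable]: "A N \<in> sets P" for N
  proof -
    have [measurable]: "M (Suc N) \<in> measurable P (count_space UNIV)" using mp by (simp add: mixed_poisson_def)
    show ?thesis unfolding A_def by measurable
  qed

  have upper: "\<forall>\<^sub>F N in sequentially. emeasure P (A N) \<le> ennreal (exp (- c / \<delta> N))"
    if th: "0 < \<theta>" and c: "ereal c < ld_exponent P X \<mu> t a \<theta>" for \<theta> c
  proof -
    have fin: "cgf_integral P X h t \<theta> \<noteq> top"
      using c reflect[OF X, of \<theta>] by (auto simp: ld_exponent_cgf_integral)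
    define g where "g = enn2real (cgf_integral P X h t \<theta>)"
    have g: "cgf_integral P X h t \<theta> = ennreal g" "0 \<le> g" using fin by (simp_all add: g_def less_top)
    have cg: "c < \<theta> * a - g"
      using c g reflect[OF X, of \<theta>] by (simp add: ld_exponent_cgf_integral enn2ereal_ennreal)
    \<comment> \<open>the slightly smaller parameter for which the Riemann sum lies below the integral\<close>
    define v where "v N = \<theta> * exp (- \<mu> * \<delta> N)" for N
    define s where "s N = v N / \<delta> N" for N
    have s0: "0 \<le> s N" for N using th d[of N] by (simp add: s_def v_def)
    have vlim: "v \<longlonglongrightarrow> \<theta>"
    proof -
      have "(\<lambda>N. \<theta> * exp (- \<mu> * \<delta> N)) \<longlonglongrightarrow> \<theta> * exp (- \<mu> * 0)" by (intro tendsto_intros dlim)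
      then show ?thesis by (simp add: v_def[abs_def])
    qed
    have mgfW: "mgf P (W N) (s N) \<le> ennreal (exp (g / \<delta> N))" for N
    proof -
      have le: "ennreal (\<delta> N) * cgf P (W N) (s N) \<le> ennreal g"
        using cgf_weighted_slots_le[OF X ind copies d[of N] less_imp_le[OF th]]
        unfolding W_def[symmetric] g s_def v_def .
      have "cgf P (W N) (s N) = ennreal (1 / \<delta> N) * (ennreal (\<delta> N) * cgf P (W N) (s N))"
        using d[of N] by (simp add: mult.assoc[symmetric] flip: ennreal_mult)
      also have "\<dots> \<le> ennreal (1 / \<delta> N) * ennreal g" using le by (rule mult_left_mono) simp
      also have "\<dots> = ennreal (g / \<delta> N)" using d[of N] g by (simp flip: ennreal_mult)
      finally show ?thesis
        using nonneg_rv.cgf_le_iff[OF W s0, of "g / \<delta> N" N] d[of N] g by simp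
    qed
    have lim: "(\<lambda>N. - a * v N + a * (v N)\<^sup>2 * (1 / (\<delta> N * real (Suc N))) + g) \<longlonglongrightarrow> - a * \<theta> + a * \<theta>\<^sup>2 * 0 + g"
      by (intro tendsto_intros vlim load)
    have lim2: "(\<lambda>N. v N * (1 / (\<delta> N * real (Suc N)))) \<longlonglongrightarrow> \<theta> * 0"
      by (intro tendsto_mult vlim load)
    have "\<forall>\<^sub>F N in sequentially. - a * v N + a * (v N)\<^sup>2 * (1 / (\<delta> N * real (Suc N))) + g < - c"
      using cg by (intro order_tendstoD(2)[OF lim]) (simp add: mult.commute)
    moreover have "\<forall>\<^sub>F N in sequentially. v N * (1 / (\<delta> N * real (Suc N))) < 1"
      by (intro order_tendstoD(2)[OF lim2]) simp
    ultimately show ?thesis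
    proof eventually_elim
      case (elim N)
      have "s N / real (Suc N) < 1" using elim(2) by (simp add: s_def)
      then have sN: "s N \<le> real (Suc N)" by (simp only: pos_divide_less_eq of_nat_0_less_iff zero_less_Suc mult_1 less_imp_le)
      have "emeasure P (A N) \<le> ennreal (exp (- a * s N + a * (s N)\<^sup>2 / real (Suc N))) * mgf P (W N) (s N)"
        unfolding A_def by (rule mixed_poisson_tail_le[OF W mp _ less_imp_le[OF a] s0 sN]) simp
      also have "\<dots> \<le> ennreal (exp (- a * s N + a * (s N)\<^sup>2 / real (Suc N))) * ennreal (exp (g / \<delta> N))"
        by (intro mult_left_mono mgfW) simp
      also have "\<dots> = ennreal (exp (- a * s N + a * (s N)\<^sup>2 / real (Suc N) + g / \<delta> N))"
        by (simp add: exp_add ennreal_mult)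
      also have "- a * s N + a * (s N)\<^sup>2 / real (Suc N) + g / \<delta> N
          = (- a * v N + a * (v N)\<^sup>2 * (1 / (\<delta> N * real (Suc N))) + g) / \<delta> N"
        by (simp add: s_def add_divide_distrib diff_divide_distrib power2_eq_square mult_ac del: of_nat_Suc)
      also have "ennreal (exp \<dots>) \<le> ennreal (exp (- c / \<delta> N))"
        using elim(1) d[of N] by (intro ennreal_leI) (simp only: exp_le_cancel_iff divide_right_mono less_imp_le)
      finally show "emeasure P (A N) \<le> ennreal (exp (- c / \<delta> N))" .
    qed
  qed

  have lower: "\<forall>\<^sub>F N in sequentially. exp (- c / \<delta> N) \<le> measure P (A N)" if c: "max 0 S < ereal c" for c
  proof -
    define I where "I = real_of_ereal (max 0 S)"
    have I: "max 0 S = ereal I" using c unfolding I_def by (cases "max 0 S") (auto simp: max_def split: if_splits)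
    have I0: "0 \<le> I" using I by (metis ereal_less_eq(5) max.cobounded1)
    have Ic: "I < c" using c I by simp
    obtain x where x: "a < x * ((1 - exp (- (\<mu> * t))) / \<mu>)" "0 < measure P {\<omega> \<in> space P. x \<le> X \<omega>}"
    proof (rule ccontr)
      assume "\<not> thesis"
      then have "measure P {\<omega> \<in> space P. x \<le> X \<omega>} = 0" if "a < x * ((1 - exp (- (\<mu> * t))) / \<mu>)" for x
        using that measure_nonneg[of P "{\<omega> \<in> space P. x \<le> X \<omega>}"] \<open>\<And>x. a < x * ((1 - exp (- (\<mu> * t))) / \<mu>) \<Longrightarrow> 0 < prob {\<omega> \<in> space P. x \<le> X \<omega>} \<Longrightarrow> thesis\<close>
        by (metis less_eq_real_def)
      from ld_exponent_unbounded[OF X mu t a no_atoms this] have "S = \<infinity>" by (simp add: S_def)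
      then show False using c by simp
    qed
    have Ile: "ereal (\<theta> * a) - enn2ereal (cgf_integral P X (\<lambda>s. exp (- (\<mu> * s))) t \<theta>) \<le> ereal I" if "0 < \<theta>" for \<theta>
    proof -
      have "ld_exponent P X \<mu> t a \<theta> \<le> S" unfolding S_def using that by (intro SUP_upper) auto
      also have "\<dots> \<le> ereal I" by (simp flip: I)
      finally show ?thesis by (simp add: ld_exponent_cgf_integral)
    qed
    define c' where "c' = (I + c) / 2"
    have c': "I < c'" "c' < c" using Ic by (auto simp: c'_def)
    obtain K :: nat and b \<theta> where b: "a < b" and th: "0 < \<theta>"
      and D: "((\<lambda>\<theta>. enn2real (cgf_integral P (\<lambda>\<omega>. min (X \<omega>) (real K)) (\<lambda>s. exp (- (\<mu> * s))) t \<theta>)) has_real_derivative b) (at \<theta>)"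
      and val: "\<theta> * b - enn2real (cgf_integral P (\<lambda>\<omega>. min (X \<omega>) (real K)) (\<lambda>s. exp (- (\<mu> * s))) t \<theta>) < c'"
      by (rule truncated_exponent_witness[OF X int mu t rho less_imp_le[OF a] x Ile I0 c'(1)])
    \<comment> \<open>room on both sides: the tilted environment exceeds \<open>b'\<close>, and the Poisson noise then does not fall below \<open>a\<close>\<close>
    define b' where "b' = (a + b) / 2"
    have b': "a < b'" "b' < b" using b by (auto simp: b'_def)
    have K: "0 \<le> real K" by simp
    note refl_K = reflect[OF nonneg_rv_truncated[OF K]]
    have ev1: "\<forall>\<^sub>F N in sequentially. exp (- c' / \<delta> N) \<le> prob {\<omega> \<in> space P. b' < W N \<omega>}"
      unfolding W_def
      by (rule weighted_slots_lower_bound[OF X ind copies d dlim K th, where b = b])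
         (use D val b' in \<open>simp_all only: refl_K\<close>)
    define \<gamma> where "\<gamma> = b' - a - a * ln (b' / a)"
    have gam: "0 < \<gamma>" unfolding \<gamma>_def by (rule poisson_gap_pos[OF a b'(1)])
    have "(\<lambda>N. exp (- \<gamma>) ^ Suc N) \<longlonglongrightarrow> 0" using gam by (intro LIMSEQ_Suc LIMSEQ_power_zero) simp
    then have ev2: "\<forall>\<^sub>F N in sequentially. exp (- \<gamma>) ^ Suc N < 1 / 2" by (rule order_tendstoD) simp
    have "filterlim (\<lambda>N. (c' - c) * inverse (\<delta> N)) at_bot sequentially"
      using c' dlim d by (intro filterlim_tendsto_neg_mult_at_bot[OF tendsto_const] filterlim_inverse_at_top) auto
    then have "(\<lambda>N. exp ((c' - c) * inverse (\<delta> N))) \<longlonglongrightarrow> 0" by (rule filterlim_compose[OF exp_at_bot])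
    then have ev3: "\<forall>\<^sub>F N in sequentially. exp ((c' - c) * inverse (\<delta> N)) < 1 / 2" by (rule order_tendstoD) simp
    from ev1 ev2 ev3 show ?thesis
    proof eventually_elim
      case (elim N)
      have pw: "exp (- \<gamma> * real (Suc N)) = exp (- \<gamma>) ^ Suc N" by (simp only: exp_of_nat2_mult)
      have "exp (- c / \<delta> N) = exp ((c' - c) * inverse (\<delta> N)) * exp (- c' / \<delta> N)"
        by (simp add: divide_inverse algebra_simps flip: exp_add)
      also have "\<dots> \<le> 1 / 2 * prob {\<omega> \<in> space P. b' < W N \<omega>}" using elim by (intro mult_mono) auto
      also have "\<dots> \<le> (1 - exp (- \<gamma> * real (Suc N))) * prob {\<omega> \<in> space P. b' < W N \<omega>}"
        using elim(2) unfolding pw by (intro mult_right_mono) auto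
      also have "\<dots> \<le> prob (A N)"
        unfolding A_def \<gamma>_def by (rule mixed_poisson_tail_ge[OF W mp _ a b'(1)]) simp
      finally show "exp (- c / \<delta> N) \<le> prob (A N)" .
    qed
  qed

  have "((\<lambda>N. ereal (\<delta> N) * elog (emeasure P (A N))) \<longlongrightarrow> - max 0 S) sequentially"
  proof (rule order_tendstoI)
    fix l assume l: "l < - max 0 S"
    then have "max 0 S < - l" by (simp add: ereal_less_uminus_reorder)
    then obtain c where c: "max 0 S < ereal c" "ereal c < - l" using ereal_dense2 by blast
    show "\<forall>\<^sub>F N in sequentially. l < ereal (\<delta> N) * elog (emeasure P (A N))"
      using lower[OF c(1)]
    proof eventually_elim
      fix N assume "exp (- c / \<delta> N) \<le> prob (A N)"
      then have "ereal (- c / \<delta> N) \<le> elog (emeasure P (A N))"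
        unfolding emeasure_eq_measure by (rule elog_ge)
      then have "ereal (\<delta> N) * ereal (- c / \<delta> N) \<le> ereal (\<delta> N) * elog (emeasure P (A N))"
        using d[of N] by (intro ereal_mult_left_mono) auto
      moreover have "ereal (\<delta> N) * ereal (- c / \<delta> N) = - ereal c" using d[of N] by simp
      moreover have "l < - ereal c" using c(2) by (simp add: ereal_less_uminus_reorder)
      ultimately show "l < ereal (\<delta> N) * elog (emeasure P (A N))" by simp
    qed
  next
    fix l assume l: "- max 0 S < l"
    show "\<forall>\<^sub>F N in sequentially. ereal (\<delta> N) * elog (emeasure P (A N)) < l"
    proof (cases "0 < l")
      case True
      have "ereal (\<delta> N) * elog (emeasure P (A N)) \<le> 0" for N
      proof -
        have "elog (emeasure P (A N)) \<le> ereal 0" by (intro elog_le) (simp add: emeasure_eq_measure)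
        then have "ereal (\<delta> N) * elog (emeasure P (A N)) \<le> ereal (\<delta> N) * ereal 0"
          using d[of N] by (intro ereal_mult_left_mono) auto
        then show ?thesis by (simp add: zero_ereal_def)
      qed
      then show ?thesis using True by (intro always_eventually allI) (rule le_less_trans)
    next
      case False
      have "- l < max 0 S" using l by (simp add: ereal_uminus_less_reorder)
      moreover have "0 \<le> - l" using False by simp
      ultimately have "- l < S" by (metis less_max_iff_disj not_less)
      then obtain \<theta> where th: "0 < \<theta>" "- l < ld_exponent P X \<mu> t a \<theta>"
        unfolding S_def less_SUP_iff by auto
      then obtain c where c: "- l < ereal c" "ereal c < ld_exponent P X \<mu> t a \<theta>" using ereal_dense2 by blast
      show ?thesis
        using upper[OF th(1) c(2)]
      proof eventually_elim
        fix N assume "emeasure P (A N) \<le> ennreal (exp (- c / \<delta> N))"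
        then have "elog (emeasure P (A N)) \<le> ereal (- c / \<delta> N)" by (rule elog_le)
        then have "ereal (\<delta> N) * elog (emeasure P (A N)) \<le> ereal (\<delta> N) * ereal (- c / \<delta> N)"
          using d[of N] by (intro ereal_mult_left_mono) auto
        moreover have "ereal (\<delta> N) * ereal (- c / \<delta> N) = - ereal c" using d[of N] by simp
        moreover have "- ereal c < l" using c(1) by (simp only: ereal_uminus_less_reorder)
        ultimately show "ereal (\<delta> N) * elog (emeasure P (A N)) < l" by simp
      qed
    qed
  qed
  then have "(\<lambda>N. ereal (\<Delta> * real (Suc N) powr (- \<alpha>)) *
               elog (emeasure P {\<omega> \<in> space P. real (M (Suc N) \<omega>) / real (Suc N) \<ge> a})) \<longlonglongrightarrow> - max 0 S"
    by (simp only: \<delta>_def slot_length_def A_def)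
  then show ?thesis unfolding S_def by (rule LIMSEQ_imp_Suc)
qed

section \<open>The queue in the random environment\<close>

lemma subalgebra_seq_algebra:
  assumes "\<And>j. L j \<in> borel_measurable P" shows "subalgebra P (seq_algebra P L)"
proof -
  have f: "(\<lambda>\<omega> j. L j \<omega>) \<in> measurable P (\<Pi>\<^sub>M j\<in>UNIV. borel)"
    by (rule measurable_PiM_single') (use assms in auto)
  show ?thesis
    unfolding subalgebra_def seq_algebra_def
    using sets_image_in_sets[OF refl f] by simp
qed

lemma env_rate_measurable:
  assumes [measurable]: "\<And>j. L j \<in> borel_measurable P"
  shows "(\<lambda>(\<omega>, s). env_rate \<Delta> \<alpha> L N s \<omega>) \<in> borel_measurable (P \<Otimes>\<^sub>M lborel)"
  unfolding env_rate_def case_prod_beta' by measurable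

lemma env_rate_nonneg:
  assumes d: "0 < slot_length \<Delta> \<alpha> N" and L: "\<And>j. 0 \<le> L j \<omega>"
  shows "0 \<le> env_rate \<Delta> \<alpha> L N s \<omega>"
proof (cases "0 \<le> s")
  case True
  then show ?thesis
    using env_rate_eq_sum[OF d, of s s L \<omega>] L by (auto intro!: sum_nonneg)
next
  case False
  have "s \<notin> {real j * slot_length \<Delta> \<alpha> N..<(real j + 1) * slot_length \<Delta> \<alpha> N}" for j
  proof -
    have "0 \<le> real j * slot_length \<Delta> \<alpha> N" using d by simp
    then have "s < real j * slot_length \<Delta> \<alpha> N" using False by linarith
    then show ?thesis by simp
  qed
  then show ?thesis by (simp add: env_rate_def)
qed

lemma env_rate_integrable:
  assumes d: "0 < slot_length \<Delta> \<alpha> N"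
  shows "set_integrable lborel {0..t} (\<lambda>s. env_rate \<Delta> \<alpha> L N s \<omega>)"
proof -
  let ?d = "slot_length \<Delta> \<alpha> N"
  have "integrable lborel (\<lambda>s. \<Sum>j<n_slots t ?d. L j \<omega> * indicator (slot t ?d j) s)"
    using d by (intro Bochner_Integration.integrable_sum integrable_mult_right integrable_real_indicator)
      (auto simp: emeasure_slot)
  moreover have "(\<Sum>j<n_slots t ?d. L j \<omega> * indicator (slot t ?d j) s) = indicator {0..t} s *\<^sub>R env_rate \<Delta> \<alpha> L N s \<omega>" for s
  proof (cases "s \<in> {0..t}")
    case True
    then show ?thesis by (simp only: env_rate_eq_sum[OF d True] indicator_simps real_scaleR_def mult_1)
  next
    case False
    then have "s \<notin> slot t ?d j" for j using slot_subset[of t ?d j] by blast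
    then show ?thesis using False by simp
  qed
  ultimately show ?thesis by (simp add: set_integrable_def)
qed

theorem mainTheorem4:
  fixes P :: "'a measure" and \<Lambda> :: "'a \<Rightarrow> real" and f :: "real \<Rightarrow> ennreal"
    and L :: "nat \<Rightarrow> 'a \<Rightarrow> real" and M :: "nat \<Rightarrow> 'a \<Rightarrow> nat"
    and \<Delta> \<mu> t \<alpha> a :: real
  assumes "prob_space P"
    and "0 < \<Delta>" and "0 < \<mu>" and "0 < t" and "0 < \<alpha>" and "\<alpha> < 1"
    and density: "distributed P lborel \<Lambda> f"
    and nonneg: "AE \<omega> in P. 0 \<le> \<Lambda> \<omega>"
    and moments: "integrable P \<Lambda>" "integrable P (\<lambda>\<omega>. (\<Lambda> \<omega>)\<^sup>2)"
    and indep: "prob_space.indep_vars P (\<lambda>_. borel) L UNIV"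
    and copies: "\<And>j. distr P borel (L j) = distr P borel \<Lambda>"
    and M: "(\<forall>N\<ge>1. infinite_server_queue P (seq_algebra P L)
               (\<lambda>s \<omega>. real N * env_rate \<Delta> \<alpha> L N s \<omega>) \<mu> t (M N)) \<or>
            (\<forall>N\<ge>1. mixed_poisson P (M N)
               (distr P borel (\<lambda>\<omega>. real N * kappa \<mu> t (env_rate \<Delta> \<alpha> L N) \<omega>)))"
    and a_rho: "a > (LINT \<omega>|P. \<Lambda> \<omega>) / \<mu> * (1 - exp (- \<mu> * t))"
    and a_u: "upper_endpoint P \<Lambda> / ereal \<mu> * ereal (1 - exp (- \<mu> * t)) \<ge> ereal a"
  shows "((\<lambda>N. ereal (\<Delta> * real N powr (- \<alpha>)) *
               elog (emeasure P {\<omega> \<in> space P. real (M N \<omega>) / real N \<ge> a}))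
          \<longlongrightarrow> - max 0 (SUP \<theta>\<in>{0<..}. ld_exponent P \<Lambda> \<mu> t a \<theta>)) sequentially"
proof -
  interpret prob_space P by fact
  have X: "nonneg_rv P \<Lambda>"
    using distributed_measurable[OF density] nonneg by unfold_locales auto
  then have meas [measurable]: "\<Lambda> \<in> borel_measurable P" by (rule nonneg_rv.X_measurable)
  have L [measurable]: "L j \<in> borel_measurable P" for j using indep by (auto simp: indep_vars_def)
  have no_atoms: "prob {\<omega> \<in> space P. \<Lambda> \<omega> = x} = 0" for x
  proof -
    have "{\<omega> \<in> space P. \<Lambda> \<omega> = x} = \<Lambda> -` {x} \<inter> space P" by auto
    then have "emeasure P {\<omega> \<in> space P. \<Lambda> \<omega> = x} = (\<integral>\<^sup>+ y. f y * indicator {x} y \<partial>lborel)"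
      using distributed_emeasure[OF density, of "{x}"] by simp
    also have "\<dots> = 0"
      using AE_lborel_singleton[of x] by (intro nn_integral_0_iff_AE[THEN iffD2])
        (use distributed_borel_measurable[OF density] in \<open>auto simp: indicator_def\<close>)
    finally show ?thesis by (simp add: measure_def)
  qed
  have rho: "expectation \<Lambda> / \<mu> * (1 - exp (- (\<mu> * t))) < a" using a_rho by simp
  have d: "0 < slot_length \<Delta> \<alpha> N" if "1 \<le> N" for N
    using that \<open>0 < \<Delta>\<close> by (simp add: slot_length_def)
  note common = X moments(1) indep copies no_atoms _ \<open>0 < \<Delta>\<close> \<open>0 < \<alpha>\<close> \<open>\<alpha> < 1\<close> _ rho
  from M show ?thesis
  proof
    assume queue: "\<forall>N\<ge>1. infinite_server_queue P (seq_algebra P L)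
               (\<lambda>s \<omega>. real N * env_rate \<Delta> \<alpha> L N s \<omega>) \<mu> t (M N)"
    show ?thesis
    proof (rule discount.mixed_poisson_queue_large_deviation[OF backward_discount[OF \<open>0 < \<mu>\<close> \<open>0 < t\<close>] common])
      fix N :: nat assume N: "1 \<le> N"
      have "mixed_poisson P (M N) (distr P borel
          (\<lambda>\<omega>. LINT s:{0..t}|lborel. real N * env_rate \<Delta> \<alpha> L N s \<omega> * exp (- \<mu> * (t - s))))"
      proof (rule infinite_server_queue_mixed_poisson[OF \<open>prob_space P\<close> subalgebra_seq_algebra[OF L] _ \<open>0 < \<mu>\<close> \<open>0 < t\<close>])
        show "infinite_server_queue P (seq_algebra P L) (\<lambda>s \<omega>. real N * env_rate \<Delta> \<alpha> L N s \<omega>) \<mu> t (M N)"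
          using queue N by simp
        have "(\<lambda>x. real N * (\<lambda>(\<omega>, s). env_rate \<Delta> \<alpha> L N s \<omega>) x) \<in> borel_measurable (P \<Otimes>\<^sub>M lborel)"
          by (intro borel_measurable_times borel_measurable_const env_rate_measurable L)
        then show "(\<lambda>(\<omega>, s). real N * env_rate \<Delta> \<alpha> L N s \<omega>) \<in> borel_measurable (P \<Otimes>\<^sub>M lborel)"
          by (simp add: case_prod_beta')
        show "AE \<omega> in P. \<forall>s. 0 \<le> real N * env_rate \<Delta> \<alpha> L N s \<omega>"
          using copies_nonneg[OF X L copies]
          by eventually_elim (auto intro!: mult_nonneg_nonneg env_rate_nonneg d N)
        show "AE \<omega> in P. set_integrable lborel {0..t} (\<lambda>s. real N * env_rate \<Delta> \<alpha> L N s \<omega>)"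
          by (intro AE_I2 set_integrable_mult_right env_rate_integrable d N)
      qed
      moreover have "(LINT s:{0..t}|lborel. real N * env_rate \<Delta> \<alpha> L N s \<omega> * exp (- \<mu> * (t - s)))
        = real N * (LINT s:{0..t}|lborel. env_rate \<Delta> \<alpha> L N s \<omega> * exp (- (\<mu> * (t - s))))" for \<omega>
        by (subst set_integral_mult_right[symmetric]) (simp add: mult.assoc)
      ultimately show "mixed_poisson P (M N) (distr P borel
          (\<lambda>\<omega>. real N * (LINT s:{0..t}|lborel. env_rate \<Delta> \<alpha> L N s \<omega> * exp (- (\<mu> * (t - s))))))"
        by (simp only:)
    qed (rule cgf_integral_reflect)
  next
    assume mp: "\<forall>N\<ge>1. mixed_poisson P (M N)
               (distr P borel (\<lambda>\<omega>. real N * kappa \<mu> t (env_rate \<Delta> \<alpha> L N) \<omega>))"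
    show ?thesis
    proof (rule discount.mixed_poisson_queue_large_deviation[OF forward_discount[OF \<open>0 < \<mu>\<close> \<open>0 < t\<close>] common])
      fix N :: nat assume "1 \<le> N"
      then show "mixed_poisson P (M N) (distr P borel
          (\<lambda>\<omega>. real N * (LINT s:{0..t}|lborel. env_rate \<Delta> \<alpha> L N s \<omega> * exp (- (\<mu> * s)))))"
        using mp by (simp add: kappa_def)
    qed simp
  qed
qed

end
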